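(* Let $E$ be a Banach space and let $A,B\in C_h(\mathbb{R}^+,\mathcal{L}(E))$ be such that $B(t)-A(t)$ is a compact operator for every $t$. Then $W_A^s$ is a compact perturbation of $W_B^s$ and $$\dim(W_A^s,W_B^s)=\dim\bigl(E^-(A(+\infty)),E^-(B(+\infty))\bigr).$$
   Context: $C_h(\mathbb{R}^+,\mathcal{L}(E))$ is the set of continuous $A\colon[0,+\infty)\to\mathcal{L}(E)$ having a norm limit $A(+\infty)$ as $t\to+\infty$ with $\sigma(A(+\infty))\cap i\mathbb{R}=\emptyset$ (for real $E$, spectra are those of the complexification). $E^-(A_0)$ is the range of the spectral projector of $A_0$ associated with $\sigma(A_0)\cap\{\operatorname{Re}z<0\}$. $X_A$ is the solution of $X'=AX$, $X(0)=I$ in $\mathcal{L}(E)$, and $W_A^s=\{x\in E:\lim_{t\to+\infty}X_A(t)x=0\}$; it is a closed complemented subspace for $A\in C_h(\mathbb{R}^+,\mathcal{L}(E))$. Two closed complemented subspaces $X,Y\subset E$ are compact perturbation of each other if, for projectors (bounded idempotents) $P,Q$ with ranges $X,Y$, the operators $(I-P)Q$ and $(I-Q)P$ are compact (independent of the choice of projectors). Then $Q|_X\colon X\to Y$ is Fredholm and the relative dimension is $\dim(X,Y):=\operatorname{ind}(Q|_X\colon X\to Y)$, independent of the choice of projectors. *)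

theory Defs
  imports "HOL-Analysis.Analysis"
begin

text \<open>
  A Banach space over the reals is a type of class \<^class>\<open>banach\<close> with scaling
  \<^const>\<open>scaleR\<close>; a complex Banach space is such a type together with a complex scaling
  that extends \<^const>\<open>scaleR\<close> and is compatible with the norm. The notions below that make
  sense over both fields take the scaling \<open>s\<close> as a parameter.
\<close>

definition complex_banach_scaling :: "(complex \<Rightarrow> 'a::banach \<Rightarrow> 'a) \<Rightarrow> bool" where
  "complex_banach_scaling s \<longleftrightarrow>
     vector_space s \<and>
     (\<forall>r x. s (of_real r) x = r *\<^sub>R x) \<and>
     (\<forall>z x. norm (s z x) = norm z * norm x)"

definition scalar_linear ::
    "('k \<Rightarrow> 'a \<Rightarrow> 'a) \<Rightarrow> ('a::real_normed_vector \<Rightarrow>\<^sub>L 'a) \<Rightarrow> bool" where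
  "scalar_linear s T \<longleftrightarrow> (\<forall>c x. blinfun_apply T (s c x) = s c (blinfun_apply T x))"

definition compact_operator ::
    "('a::real_normed_vector \<Rightarrow>\<^sub>L 'b::real_normed_vector) \<Rightarrow> bool" where
  "compact_operator T \<longleftrightarrow> compact (closure (blinfun_apply T ` cball 0 1))"


subsection \<open>Spectra and spectral projectors\<close>

text \<open>
  In this subsection \<open>s\<close> only has to be a bounded scaling: the norm of the
  complexification below is a Hilbert sum norm, which is equivalent to, but need not be, a
  complex-homogeneous norm. If \<open>T\<close> is complex linear, so is every inverse of \<open>z - T\<close>.
\<close>

definition scalar_op :: "('k \<Rightarrow> 'a \<Rightarrow> 'a) \<Rightarrow> 'k \<Rightarrow> ('a::real_normed_vector \<Rightarrow>\<^sub>L 'a)" where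
  "scalar_op s z = Blinfun (s z)"

definition spectrum ::
    "(complex \<Rightarrow> 'a \<Rightarrow> 'a) \<Rightarrow> ('a::real_normed_vector \<Rightarrow>\<^sub>L 'a) \<Rightarrow> complex set" where
  "spectrum s T =
     {z. \<not> (\<exists>R. R o\<^sub>L (scalar_op s z - T) = id_blinfun \<and> (scalar_op s z - T) o\<^sub>L R = id_blinfun)}"

definition resolvent ::
    "(complex \<Rightarrow> 'a \<Rightarrow> 'a) \<Rightarrow> ('a::real_normed_vector \<Rightarrow>\<^sub>L 'a) \<Rightarrow> complex \<Rightarrow> ('a \<Rightarrow>\<^sub>L 'a)" where
  "resolvent s T z =
     (THE R. R o\<^sub>L (scalar_op s z - T) = id_blinfun \<and> (scalar_op s z - T) o\<^sub>L R = id_blinfun)"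

text \<open>
  The Riesz projector \<open>1/(2\<pi>i) \<integral>\<^sub>\<gamma> (z - T)\<inverse> dz\<close> associated with the part of the spectrum in the
  open left half plane, for \<open>T\<close> without spectrum on the imaginary axis. As the spectrum lies in
  the closed disc of radius \<open>norm T\<close>, the counterclockwise boundary \<open>\<gamma>\<close> of the rectangle with
  corners \<open>-r - r i\<close> and \<open>r i\<close>, where \<open>r = norm T + 1\<close>, avoids the spectrum and encloses exactly
  that part of it.
\<close>

definition neg_projector ::
    "(complex \<Rightarrow> 'a \<Rightarrow> 'a) \<Rightarrow> ('a::banach \<Rightarrow>\<^sub>L 'a) \<Rightarrow> ('a \<Rightarrow>\<^sub>L 'a)" where
  "neg_projector s T =
     (let r = norm T + 1;
          \<gamma> = rectpath (Complex (- r) (- r)) (Complex 0 r)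
      in scalar_op s (1 / (2 * of_real pi * \<i>)) o\<^sub>L
         integral {0..1}
           (\<lambda>t. scalar_op s (vector_derivative \<gamma> (at t within {0..1})) o\<^sub>L resolvent s T (\<gamma> t)))"

definition neg_space :: "(complex \<Rightarrow> 'a \<Rightarrow> 'a) \<Rightarrow> ('a::banach \<Rightarrow>\<^sub>L 'a) \<Rightarrow> 'a set" where
  "neg_space s T = range (blinfun_apply (neg_projector s T))"

text \<open>The complexification of a real space: \<open>(x, y)\<close> stands for \<open>x + i y\<close>.\<close>

definition complexification_scaling ::
    "complex \<Rightarrow> 'a::real_vector \<times> 'a \<Rightarrow> 'a \<times> 'a" where
  "complexification_scaling z = (\<lambda>(x, y). (Re z *\<^sub>R x - Im z *\<^sub>R y, Im z *\<^sub>R x + Re z *\<^sub>R y))"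

definition complexify ::
    "('a::real_normed_vector \<Rightarrow>\<^sub>L 'a) \<Rightarrow> (('a \<times> 'a) \<Rightarrow>\<^sub>L ('a \<times> 'a))" where
  "complexify T = Blinfun (\<lambda>(x, y). (blinfun_apply T x, blinfun_apply T y))"

definition real_spectrum :: "('a::real_normed_vector \<Rightarrow>\<^sub>L 'a) \<Rightarrow> complex set" where
  "real_spectrum T = spectrum complexification_scaling (complexify T)"

text \<open>
  The contour in \<^const>\<open>neg_projector\<close> is symmetric about the real axis, so the projector of a
  complexified operator is itself the complexification of a real projector, namely
  the one whose range is taken here.
\<close>

definition real_neg_space :: "('a::banach \<Rightarrow>\<^sub>L 'a) \<Rightarrow> 'a set" where
  "real_neg_space T =
     range (\<lambda>x. fst (blinfun_apply (neg_projector complexification_scaling (complexify T)) (x, 0)))"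


subsection \<open>Asymptotically hyperbolic paths and their stable spaces\<close>

text \<open>Paths are total functions of which only the values on \<open>[0, \<infinity>)\<close> matter.\<close>

definition C_h ::
    "('k \<Rightarrow> 'a \<Rightarrow> 'a) \<Rightarrow> (('a::banach \<Rightarrow>\<^sub>L 'a) \<Rightarrow> complex set) \<Rightarrow> (real \<Rightarrow> ('a \<Rightarrow>\<^sub>L 'a)) set" where
  "C_h s \<sigma> =
     {A. (\<forall>t\<ge>0. scalar_linear s (A t)) \<and> continuous_on {0..} A \<and>
         (\<exists>L. (A \<longlongrightarrow> L) at_top \<and> \<sigma> L \<inter> {z. Re z = 0} = {})}"

definition limit_op :: "(real \<Rightarrow> ('a::banach \<Rightarrow>\<^sub>L 'a)) \<Rightarrow> ('a \<Rightarrow>\<^sub>L 'a)" where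
  "limit_op A = Lim at_top A"

text \<open>The solution is unique on \<open>[0, \<infinity>)\<close>; the choice concerns only negative times.\<close>

definition fundamental_solution ::
    "(real \<Rightarrow> ('a::banach \<Rightarrow>\<^sub>L 'a)) \<Rightarrow> real \<Rightarrow> ('a \<Rightarrow>\<^sub>L 'a)" where
  "fundamental_solution A =
     (SOME X. X 0 = id_blinfun \<and>
        (\<forall>t\<ge>0. (X has_vector_derivative (A t o\<^sub>L X t)) (at t within {0..})))"

definition stable_space :: "(real \<Rightarrow> ('a::banach \<Rightarrow>\<^sub>L 'a)) \<Rightarrow> 'a set" where
  "stable_space A = {x. ((\<lambda>t. blinfun_apply (fundamental_solution A t) x) \<longlongrightarrow> 0) at_top}"


subsection \<open>Compact perturbations and relative dimension\<close>

definition is_projector_onto ::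
    "('k \<Rightarrow> 'a \<Rightarrow> 'a) \<Rightarrow> ('a::banach \<Rightarrow>\<^sub>L 'a) \<Rightarrow> 'a set \<Rightarrow> bool" where
  "is_projector_onto s P X \<longleftrightarrow>
     scalar_linear s P \<and> P o\<^sub>L P = P \<and> range (blinfun_apply P) = X"

text \<open>The ranges of bounded projectors are exactly the closed complemented subspaces.\<close>

definition compact_perturbation ::
    "('k \<Rightarrow> 'a \<Rightarrow> 'a) \<Rightarrow> 'a::banach set \<Rightarrow> 'a set \<Rightarrow> bool" where
  "compact_perturbation s X Y \<longleftrightarrow>
     (\<exists>P. is_projector_onto s P X) \<and> (\<exists>Q. is_projector_onto s Q Y) \<and>
     (\<forall>P Q. is_projector_onto s P X \<and> is_projector_onto s Q Y \<longrightarrow>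
        compact_operator ((id_blinfun - P) o\<^sub>L Q) \<and> compact_operator ((id_blinfun - Q) o\<^sub>L P))"

text \<open>
  The dimension of the quotient \<open>Y / R\<close>, as the dimension of an algebraic complement of \<open>R\<close>
  in \<open>Y\<close>.
\<close>

definition codim_in ::
    "('k::field \<Rightarrow> 'a \<Rightarrow> 'a) \<Rightarrow> 'a::ab_group_add set \<Rightarrow> 'a set \<Rightarrow> nat" where
  "codim_in s Y R =
     vector_space.dim s
       (SOME C. module.subspace s C \<and> C \<inter> R = {0} \<and> {c + r |c r. c \<in> C \<and> r \<in> R} = Y)"

text \<open>
  The index of a Fredholm operator \<open>T: X \<rightarrow> Y\<close>. Infinite dimensions are \<open>0\<close> in the library, so
  the value means nothing if \<open>T\<close> is not Fredholm.
\<close>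

definition fredholm_index ::
    "('k::field \<Rightarrow> 'a \<Rightarrow> 'a) \<Rightarrow> 'a::ab_group_add set \<Rightarrow> 'a set \<Rightarrow> ('a \<Rightarrow> 'a) \<Rightarrow> int" where
  "fredholm_index s X Y T =
     int (vector_space.dim s {x \<in> X. T x = 0}) - int (codim_in s Y (T ` X))"

definition relative_dim ::
    "('k::field \<Rightarrow> 'a \<Rightarrow> 'a) \<Rightarrow> 'a::banach set \<Rightarrow> 'a set \<Rightarrow> int" where
  "relative_dim s X Y =
     fredholm_index s X Y (blinfun_apply (SOME Q. is_projector_onto s Q Y))"

end

theory Submission
  imports Defs
begin

text \<open>
  For an asymptotically hyperbolic path \<open>A\<close> with limit \<open>A0\<close> let \<open>P\<close> be the Riesz projector of
  \<open>A0\<close>. It is the only operator commuting with \<open>A0\<close> such that \<open>exp (t A0) P\<close> and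
  \<open>exp (- t A0) (id - P)\<close> tend to \<open>0\<close>. If \<open>B0\<close> is a compact perturbation of \<open>A0\<close> with projector
  \<open>Q\<close>, then \<open>P (id - Q) = (exp (t A0) P) (exp (- t A0) exp (t B0)) (exp (- t B0) (id - Q))\<close>, where the
  middle factor is a compact perturbation of the identity, so letting \<open>t\<close> tend to infinity shows
  that \<open>P - Q\<close> is compact.

  From a late time \<open>T\<close> on, a Lyapunov--Perron iteration produces a projector \<open>P'\<close> with the same
  kernel as \<open>P\<close> whose range consists of the initial values of decaying solutions. Hence the stable
  space is the image of the range of \<open>P\<close> under the isomorphism \<open>U = X(T)\<inverse> (id + P' - P)\<close>. All
  ingredients of \<open>U\<close> change by compact operators when \<open>A\<close> does, so the theorem reduces to the
  statement that isomorphisms \<open>U\<close> and \<open>V\<close> with compact difference do not change the relative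
  dimension: \<open>dim (U X, V Y) = dim (X, Y)\<close>. This is the invariance of the Fredholm index under
  compact perturbations, which follows from Riesz' theorem that \<open>id + K\<close> has index \<open>0\<close>.
\<close>

subsection \<open>Compact operators\<close>

text \<open>The imaginary axis is itself part of the contour, and \<open>exp (t z)\<close> has
  modulus one there, so direct estimates give no decay; integration by parts gains a factor
  \<open>1/t\<close>, and a dichotomy asks for decay without a rate. Idempotence of the Riesz
  projector comes from no double contour integral: the projectors of \<open>T\<close> and
  \<open>- T\<close> add up to the identity, and P (id - P) is a constant that factors into two
  decaying terms. The norm of a complexification need not be complex homogeneous, so contour
  integrals are formed on a real space with an operator \<open>J\<close> of square
  \<open>- id\<close>; this serves both scalar fields, and the real projector is a compression of
  the complex one. Time is discretised because one long step makes all coefficients of the iteration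
  small without an exponential rate; the conditions on step and starting time hold eventually, so
  both paths can share them. The index is compared on fixed spaces: pulled back by the isomorphisms,
  the two projections are maps from \<open>X\<close> to \<open>Y\<close> with the same parametrix,
  the restriction of \<open>P\<close> to \<open>Y\<close>.\<close>

lemmas blinfun_compose_simps =
  bounded_bilinear.add_left[OF bounded_bilinear_blinfun_compose]
  bounded_bilinear.add_right[OF bounded_bilinear_blinfun_compose]
  bounded_bilinear.diff_left[OF bounded_bilinear_blinfun_compose]
  bounded_bilinear.diff_right[OF bounded_bilinear_blinfun_compose]
  bounded_bilinear.minus_left[OF bounded_bilinear_blinfun_compose]
  bounded_bilinear.minus_right[OF bounded_bilinear_blinfun_compose]
  bounded_bilinear.scaleR_left[OF bounded_bilinear_blinfun_compose]
  bounded_bilinear.scaleR_right[OF bounded_bilinear_blinfun_compose]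

lemma blinfun_compose_assoc: "(a o\<^sub>L b) o\<^sub>L c = a o\<^sub>L (b o\<^sub>L c)"
  by (simp add: blinfun_eqI)

lemma id_blinfun_compose [simp]: "id_blinfun o\<^sub>L a = a" "a o\<^sub>L id_blinfun = a"
  by (simp_all add: blinfun_eqI)

text \<open>In a complete codomain relative compactness is total boundedness. Finite nets can be
  pushed through sums, compositions and norm limits, which yields the closure properties
  below.\<close>

lemma compact_operator_iff_totally_bounded:
  fixes T :: "'a::real_normed_vector \<Rightarrow>\<^sub>L 'b::banach"
  shows "compact_operator T \<longleftrightarrow>
    (\<forall>e>0. \<exists>k. finite k \<and> (\<forall>x\<in>cball 0 1. \<exists>y\<in>k. dist y (blinfun_apply T x) < e))"
    (is "_ = ?R")
proof
  assume "compact_operator T"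
  then have *: "\<And>e. e > 0 \<Longrightarrow> \<exists>k. finite k \<and> closure (blinfun_apply T ` cball 0 1) \<subseteq> (\<Union>x\<in>k. ball x e)"
    unfolding compact_operator_def compact_eq_totally_bounded by simp
  show ?R
  proof (intro allI impI)
    fix e :: real assume "e > 0"
    then obtain k where k: "finite k" "closure (blinfun_apply T ` cball 0 1) \<subseteq> (\<Union>x\<in>k. ball x e)"
      using * by metis
    have "\<exists>y\<in>k. dist y (blinfun_apply T x) < e" if "x \<in> cball 0 1" for x
    proof -
      have "blinfun_apply T x \<in> closure (blinfun_apply T ` cball 0 1)"
        using closure_subset[of "blinfun_apply T ` cball 0 1"] that by blast
      then have "blinfun_apply T x \<in> (\<Union>x\<in>k. ball x e)" using k(2) by (rule rev_subsetD)
      then show ?thesis by simp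
    qed
    then show "\<exists>k. finite k \<and> (\<forall>x\<in>cball 0 1. \<exists>y\<in>k. dist y (blinfun_apply T x) < e)"
      using k(1) by metis
  qed
next
  assume R: ?R
  show "compact_operator T"
    unfolding compact_operator_def compact_eq_totally_bounded
  proof (intro conjI allI impI)
    show "complete (closure (blinfun_apply T ` cball 0 1))"
      by (simp add: complete_eq_closed)
    fix e :: real assume "e > 0"
    then obtain k where k: "finite k" "\<forall>x\<in>cball 0 1. \<exists>y\<in>k. dist y (blinfun_apply T x) < e/2"
      using R[rule_format, of "e/2"] by auto
    \<comment> \<open>Finitely many closed balls form a closed set, which therefore contains the
      closure too; the radius \<open>e/2\<close> leaves room for open balls of radius
      \<open>e\<close>.\<close>
    have "closure (blinfun_apply T ` cball 0 1) \<subseteq> (\<Union>x\<in>k. cball x (e/2))"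
    proof (rule closure_minimal)
      show "blinfun_apply T ` cball 0 1 \<subseteq> (\<Union>x\<in>k. cball x (e/2))"
      proof clarify
        fix x :: 'a assume "x \<in> cball 0 1"
        then obtain y where "y \<in> k" "dist y (blinfun_apply T x) < e/2" using k(2) by metis
        then show "blinfun_apply T x \<in> (\<Union>x\<in>k. cball x (e/2))" by (intro UN_I[of y]) auto
      qed
      show "closed (\<Union>x\<in>k. cball x (e/2))"
        using k(1) by (intro closed_UN) auto
    qed
    also have "\<dots> \<subseteq> (\<Union>x\<in>k. ball x e)"
      using \<open>e > 0\<close> by (intro UN_mono) auto
    finally show "\<exists>k. finite k \<and> closure (blinfun_apply T ` cball 0 1) \<subseteq> (\<Union>x\<in>k. ball x e)"
      using k(1) by metis
  qed
qed

lemma compact_operator_0 [simp]: "compact_operator (0 :: 'a::real_normed_vector \<Rightarrow>\<^sub>L 'b::banach)"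
  unfolding compact_operator_iff_totally_bounded by (auto intro!: exI[of _ "{0}"])

lemma compact_operator_add:
  fixes S T :: "'a::real_normed_vector \<Rightarrow>\<^sub>L 'b::banach"
  assumes "compact_operator S" "compact_operator T"
  shows "compact_operator (S + T)"
  unfolding compact_operator_iff_totally_bounded
proof (intro allI impI)
  fix e :: real assume "e > 0"
  then have "e/2 > 0" by simp
  then obtain k l where k: "finite k" "\<forall>x\<in>cball 0 1. \<exists>y\<in>k. dist y (blinfun_apply S x) < e/2"
    and l: "finite l" "\<forall>x\<in>cball 0 1. \<exists>y\<in>l. dist y (blinfun_apply T x) < e/2"
    using assms unfolding compact_operator_iff_totally_bounded by meson
  show "\<exists>k. finite k \<and> (\<forall>x\<in>cball 0 1. \<exists>y\<in>k. dist y (blinfun_apply (S + T) x) < e)"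
  proof (intro exI[of _ "(\<lambda>(y, z). y + z) ` (k \<times> l)"] conjI ballI)
    fix x :: 'a assume "x \<in> cball 0 1"
    then obtain y z where "y \<in> k" "dist y (blinfun_apply S x) < e/2"
      "z \<in> l" "dist z (blinfun_apply T x) < e/2"
      using k l by blast
    then show "\<exists>y\<in>(\<lambda>(y, z). y + z) ` (k \<times> l). dist y (blinfun_apply (S + T) x) < e"
      using dist_triangle_add[of y z "blinfun_apply S x" "blinfun_apply T x"]
      by (intro bexI[of _ "y + z"]) (auto simp: blinfun.add_left)
  qed (use k l in auto)
qed

lemma compact_operator_compose_left:
  fixes S :: "'b::banach \<Rightarrow>\<^sub>L 'c::banach" and T :: "'a::real_normed_vector \<Rightarrow>\<^sub>L 'b"
  assumes "compact_operator T"
  shows "compact_operator (S o\<^sub>L T)"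
  unfolding compact_operator_iff_totally_bounded
proof (intro allI impI)
  fix e :: real assume "e > 0"
  \<comment> \<open>The summand 1 keeps the quotient meaningful for \<open>S = 0\<close> and makes
    the final estimate strict.\<close>
  define d where "d = e / (norm S + 1)"
  have "d > 0" using \<open>e > 0\<close> unfolding d_def by (simp add: add_nonneg_pos)
  then obtain k where k: "finite k" "\<forall>x\<in>cball 0 1. \<exists>y\<in>k. dist y (blinfun_apply T x) < d"
    using assms unfolding compact_operator_iff_totally_bounded by meson
  show "\<exists>k. finite k \<and> (\<forall>x\<in>cball 0 1. \<exists>y\<in>k. dist y (blinfun_apply (S o\<^sub>L T) x) < e)"
  proof (intro exI[of _ "blinfun_apply S ` k"] conjI ballI)
    fix x :: 'a assume "x \<in> cball 0 1"
    then obtain y where y: "y \<in> k" "dist y (blinfun_apply T x) < d"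
      using k by blast
    have "dist (blinfun_apply S y) (blinfun_apply S (blinfun_apply T x)) \<le> norm S * dist y (blinfun_apply T x)"
      unfolding dist_norm blinfun.diff_right[symmetric] by (rule norm_blinfun)
    also have "\<dots> \<le> norm S * d" using y by (simp add: mult_left_mono)
    also have "\<dots> < (norm S + 1) * d" using \<open>d > 0\<close> by (simp add: algebra_simps)
    also have "\<dots> = e" unfolding d_def by (simp add: add_nonneg_eq_0_iff)
    finally show "\<exists>y\<in>blinfun_apply S ` k. dist y (blinfun_apply (S o\<^sub>L T) x) < e"
      using y by auto
  qed (use k in auto)
qed

text \<open>\<open>T\<close> maps the unit ball into the ball of radius
  \<open>c = norm T + 1\<close>, so \<open>c\<close> times an \<open>e / c\<close>-net for
  \<open>S\<close> is an \<open>e\<close>-net for the composition.\<close>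

lemma compact_operator_compose_right:
  fixes S :: "'b::real_normed_vector \<Rightarrow>\<^sub>L 'c::banach" and T :: "'a::real_normed_vector \<Rightarrow>\<^sub>L 'b"
  assumes "compact_operator S"
  shows "compact_operator (S o\<^sub>L T)"
  unfolding compact_operator_iff_totally_bounded
proof (intro allI impI)
  fix e :: real assume "e > 0"
  define c where "c = norm T + 1"
  have c: "c > 0" unfolding c_def by (simp add: add_nonneg_pos)
  then obtain k where k: "finite k" "\<forall>x\<in>cball 0 1. \<exists>y\<in>k. dist y (blinfun_apply S x) < e / c"
    using assms \<open>e > 0\<close> unfolding compact_operator_iff_totally_bounded by (meson divide_pos_pos)
  show "\<exists>k. finite k \<and> (\<forall>x\<in>cball 0 1. \<exists>y\<in>k. dist y (blinfun_apply (S o\<^sub>L T) x) < e)"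
  proof (intro exI[of _ "(\<lambda>y. c *\<^sub>R y) ` k"] conjI ballI)
    fix x :: 'a assume x: "x \<in> cball 0 1"
    have "norm (blinfun_apply T x) \<le> norm T * norm x" by (rule norm_blinfun)
    also have "\<dots> \<le> norm T * 1" using x by (intro mult_left_mono) auto
    finally have "norm (blinfun_apply T x) \<le> c" unfolding c_def by simp
    then have "(1/c) *\<^sub>R blinfun_apply T x \<in> cball 0 1" using c by (simp add: field_simps)
    then obtain y where y: "y \<in> k" "dist y (blinfun_apply S ((1/c) *\<^sub>R blinfun_apply T x)) < e / c"
      using k by blast
    have "dist (c *\<^sub>R y) (blinfun_apply S (blinfun_apply T x))
        = dist (c *\<^sub>R y) (c *\<^sub>R blinfun_apply S ((1/c) *\<^sub>R blinfun_apply T x))"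
      using c by (simp add: blinfun.scaleR_right)
    also have "\<dots> = c * dist y (blinfun_apply S ((1/c) *\<^sub>R blinfun_apply T x))"
      using c by (simp only: dist_norm flip: scaleR_diff_right) simp
    also have "\<dots> < e" using y(2) c by (simp add: field_simps)
    finally show "\<exists>y\<in>(\<lambda>y. c *\<^sub>R y) ` k. dist y (blinfun_apply (S o\<^sub>L T) x) < e"
      using y by auto
  qed (use k in auto)
qed

lemma compact_operator_scaleR:
  fixes T :: "'a::real_normed_vector \<Rightarrow>\<^sub>L 'b::banach"
  assumes "compact_operator T"
  shows "compact_operator (r *\<^sub>R T)"
  using compact_operator_compose_left[OF assms, of "r *\<^sub>R id_blinfun"]
  by (simp add: blinfun_compose_simps)

lemma compact_operator_minus:
  fixes T :: "'a::real_normed_vector \<Rightarrow>\<^sub>L 'b::banach"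
  assumes "compact_operator T"
  shows "compact_operator (- T)"
  using compact_operator_scaleR[OF assms, of "-1"] by simp

lemma compact_operator_diff:
  fixes S T :: "'a::real_normed_vector \<Rightarrow>\<^sub>L 'b::banach"
  assumes "compact_operator S" "compact_operator T"
  shows "compact_operator (S - T)"
  using compact_operator_add[OF assms(1) compact_operator_minus[OF assms(2)]] by simp

text \<open>An \<open>e/2\<close>-net for a compact operator within distance \<open>e/2\<close> of
  \<open>T\<close> is an \<open>e\<close>-net for \<open>T\<close>.\<close>

lemma closed_compact_operators:
  "closed {T :: 'a::real_normed_vector \<Rightarrow>\<^sub>L 'b::banach. compact_operator T}"
proof (rule closure_subset_eq[THEN iffD1], rule subsetI)
  fix T :: "'a \<Rightarrow>\<^sub>L 'b"
  assume "T \<in> closure {T. compact_operator T}"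
  then have T: "\<forall>e>0. \<exists>S\<in>{T. compact_operator T}. dist S T < e"
    by (simp add: closure_approachable)
  show "T \<in> {T. compact_operator T}"
    unfolding mem_Collect_eq compact_operator_iff_totally_bounded
  proof (intro allI impI)
    fix e :: real assume "e > 0"
    then obtain S where S: "compact_operator S" "dist S T < e/2"
      using T[rule_format, of "e/2"] by auto
    obtain k where k: "finite k" "\<forall>x\<in>cball 0 1. \<exists>y\<in>k. dist y (blinfun_apply S x) < e/2"
      using S(1)[unfolded compact_operator_iff_totally_bounded, rule_format, of "e/2"] \<open>e > 0\<close> by auto
    have "\<exists>y\<in>k. dist y (blinfun_apply T x) < e" if x: "x \<in> cball 0 1" for x
    proof -
      obtain y where y: "y \<in> k" "dist y (blinfun_apply S x) < e/2" using k x by blast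
      have "dist (blinfun_apply S x) (blinfun_apply T x) \<le> norm (S - T) * norm x"
        unfolding dist_norm blinfun.diff_left[symmetric] by (rule norm_blinfun)
      also have "\<dots> \<le> norm (S - T) * 1" using x by (intro mult_left_mono) auto
      finally have "dist (blinfun_apply S x) (blinfun_apply T x) < e/2"
        using S(2) by (simp add: dist_norm)
      then have "dist y (blinfun_apply T x) < e"
        using y(2) dist_triangle[of y "blinfun_apply T x" "blinfun_apply S x"] by linarith
      then show ?thesis using y(1) by blast
    qed
    then show "\<exists>k. finite k \<and> (\<forall>x\<in>cball 0 1. \<exists>y\<in>k. dist y (blinfun_apply T x) < e)"
      using k(1) by blast
  qed
qed

lemma compact_operator_tendsto:
  fixes f :: "'c \<Rightarrow> 'a::real_normed_vector \<Rightarrow>\<^sub>L 'b::banach"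
  assumes "(f \<longlongrightarrow> T) F" "F \<noteq> bot" "\<forall>\<^sub>F x in F. compact_operator (f x)"
  shows "compact_operator T"
  using Lim_in_closed_set[OF closed_compact_operators _ assms(2,1)] assms(3) by simp

lemma compact_operator_subspace:
  "subspace {T :: 'a::real_normed_vector \<Rightarrow>\<^sub>L 'b::banach. compact_operator T}"
  by (simp add: real_vector.subspace_def compact_operator_add compact_operator_scaleR)

text \<open>Riemann sums are linear combinations of values of \<open>f\<close>, so they lie in
  \<open>S\<close>, and they approximate the integral. For the subspace of compact operators this
  carries compactness from a derivative to the increments of the function.\<close>

lemma integral_in_closed_subspace:
  fixes f :: "real \<Rightarrow> 'f::real_normed_vector"
  assumes S: "subspace S" "closed S"
    and f: "(f has_integral I) {a..b}" "\<And>x. x \<in> {a..b} \<Longrightarrow> f x \<in> S"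
  shows "I \<in> S"
proof -
  have "\<exists>y\<in>S. dist y I < e" if "e > 0" for e
  proof -
    obtain g where g: "gauge g" "\<And>D. D tagged_division_of cbox a b \<Longrightarrow> g fine D \<Longrightarrow>
        norm ((\<Sum>(x, k)\<in>D. measure lborel k *\<^sub>R f x) - I) < e"
      using f(1) \<open>e > 0\<close> has_integral[of f I a b] by auto
    obtain D where D: "D tagged_division_of cbox a b" "g fine D"
      using fine_division_exists[OF g(1)] by blast
    have "(\<Sum>(x, k)\<in>D. measure lborel k *\<^sub>R f x) \<in> S"
    proof (rule real_vector.subspace_sum[OF S(1)], clarify)
      fix x k assume "(x, k) \<in> D"
      then have "x \<in> {a..b}" using tag_in_interval[OF D(1)] by simp
      then show "measure lborel k *\<^sub>R f x \<in> S" using f(2) S(1) real_vector.subspace_scale by blast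
    qed
    then show ?thesis using g(2)[OF D] by (auto simp: dist_norm)
  qed
  then show ?thesis using S(2) using closed_approachable by blast
qed

section \<open>Congruence modulo compact operators\<close>

definition compact_eq ::
    "('a::real_normed_vector \<Rightarrow>\<^sub>L 'b::banach) \<Rightarrow> ('a \<Rightarrow>\<^sub>L 'b) \<Rightarrow> bool" (infix "\<sim>\<^sub>K" 50) where
  "S \<sim>\<^sub>K T \<longleftrightarrow> compact_operator (S - T)"

lemma compact_eq_refl [simp]: "T \<sim>\<^sub>K T"
  by (simp add: compact_eq_def)

lemma compact_eq_sym: "S \<sim>\<^sub>K T \<Longrightarrow> T \<sim>\<^sub>K S"
  unfolding compact_eq_def using compact_operator_minus by fastforce

lemma compact_eq_trans [trans]: "R \<sim>\<^sub>K S \<Longrightarrow> S \<sim>\<^sub>K T \<Longrightarrow> R \<sim>\<^sub>K T"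
  unfolding compact_eq_def using compact_operator_add[of "R - S" "S - T"] by simp

lemma compact_eq_eq_trans [trans]: "R = S \<Longrightarrow> S \<sim>\<^sub>K T \<Longrightarrow> R \<sim>\<^sub>K T" "R \<sim>\<^sub>K S \<Longrightarrow> S = T \<Longrightarrow> R \<sim>\<^sub>K T"
  by simp_all

lemma compact_eq_add: "S \<sim>\<^sub>K S' \<Longrightarrow> T \<sim>\<^sub>K T' \<Longrightarrow> S + T \<sim>\<^sub>K S' + T'"
  unfolding compact_eq_def using compact_operator_add[of "S - S'" "T - T'"] by (simp add: algebra_simps)

lemma compact_eq_diff: "S \<sim>\<^sub>K S' \<Longrightarrow> T \<sim>\<^sub>K T' \<Longrightarrow> S - T \<sim>\<^sub>K S' - T'"
  unfolding compact_eq_def using compact_operator_diff[of "S - S'" "T - T'"] by (simp add: algebra_simps)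

lemma compact_eq_compose:
  fixes S :: "'b::banach \<Rightarrow>\<^sub>L 'c::banach" and T :: "'a::real_normed_vector \<Rightarrow>\<^sub>L 'b"
  assumes "S \<sim>\<^sub>K S'" "T \<sim>\<^sub>K T'"
  shows "(S o\<^sub>L T) \<sim>\<^sub>K S' o\<^sub>L T'"
proof -
  have "(S o\<^sub>L T) - (S' o\<^sub>L T') = ((S - S') o\<^sub>L T) + (S' o\<^sub>L (T - T'))"
    by (simp add: blinfun_compose_simps)
  then show ?thesis
    using assms unfolding compact_eq_def
    by (simp add: compact_operator_add compact_operator_compose_left compact_operator_compose_right)
qed

lemma compact_eq_0_iff: "T \<sim>\<^sub>K 0 \<longleftrightarrow> compact_operator T"
  by (simp add: compact_eq_def)

lemma compact_eq_tendsto: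
  assumes "(f \<longlongrightarrow> S) F" "(g \<longlongrightarrow> T) F" "F \<noteq> bot" "\<forall>\<^sub>F x in F. f x \<sim>\<^sub>K g x"
  shows "S \<sim>\<^sub>K T"
  using compact_operator_tendsto[OF tendsto_diff[OF assms(1,2)] assms(3)] assms(4)
  unfolding compact_eq_def by simp

text \<open>Modulo compact operators, S' = S' T T' = S' S T' = T'.\<close>

lemma compact_eq_inverse:
  fixes S S' T T' :: "'a::banach \<Rightarrow>\<^sub>L 'a"
  assumes "S o\<^sub>L S' = id_blinfun" "S' o\<^sub>L S = id_blinfun" "T o\<^sub>L T' = id_blinfun" "T' o\<^sub>L T = id_blinfun"
    and "S \<sim>\<^sub>K T"
  shows "S' \<sim>\<^sub>K T'"
proof -
  have "((S' o\<^sub>L T) o\<^sub>L T') \<sim>\<^sub>K ((S' o\<^sub>L S) o\<^sub>L T')"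
    by (intro compact_eq_compose compact_eq_refl compact_eq_sym[OF assms(5)])
  then show ?thesis using assms by (simp add: blinfun_compose_assoc)
qed

subsection \<open>Linear differential equations\<close>

lemma at_within_half_line:
  fixes t :: real
  assumes "t < T"
  shows "at t within {0..T} = at t within {0..}"
  by (rule at_within_nhd[of t "{..<T}"]) (use assms in auto)

lemma continuous_on_half_line:
  fixes f :: "real \<Rightarrow> 'f::topological_space"
  assumes "\<And>T. continuous_on {0..T} f"
  shows "continuous_on {0..} f"
  unfolding continuous_on_eq_continuous_within
proof
  fix t :: real assume "t \<in> {0..}"
  then have "continuous (at t within {0..t+1}) f"
    using assms[of "t+1"] unfolding continuous_on_eq_continuous_within by auto
  then show "continuous (at t within {0..}) f"
    by (simp add: at_within_half_line)
qed

lemma integral_has_vector_derivative_half_line: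
  fixes f :: "real \<Rightarrow> 'f::banach"
  assumes "continuous_on {0..} f" "t \<ge> 0"
  shows "((\<lambda>u. integral {0..u} f) has_vector_derivative f t) (at t within {0..})"
proof -
  have "((\<lambda>u. integral {0..u} f) has_vector_derivative f t) (at t within {0..t+1})"
    by (rule integral_has_vector_derivative)
      (use assms in \<open>auto intro: continuous_on_subset\<close>)
  then show ?thesis by (simp add: at_within_half_line)
qed

lemma has_vector_derivative_half_line_continuous_on:
  assumes "\<And>t. t \<ge> 0 \<Longrightarrow> (f has_vector_derivative f' t) (at t within {0..})"
  shows "continuous_on {0..} f"
  unfolding continuous_on_eq_continuous_within
  by (intro ballI has_vector_derivative_continuous[OF assms]) simp

text \<open>The mean value inequality asks for two-sided derivatives in the open interval only, and
  there the derivative within the half line is a full one.\<close>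

lemma norm_diff_le_of_derivative_le:
  fixes f :: "real \<Rightarrow> 'f::real_normed_vector"
  assumes "\<And>t. t \<ge> 0 \<Longrightarrow> (f has_vector_derivative f' t) (at t within {0..})"
    and "\<And>t. (\<phi> has_vector_derivative \<phi>' t) (at t)"
    and "\<And>t. 0 < t \<Longrightarrow> t < T \<Longrightarrow> norm (f' t) \<le> \<phi>' t"
    and "T \<ge> 0"
  shows "norm (f T - f 0) \<le> \<phi> T - \<phi> 0"
proof (cases "T = 0")
  case False
  show ?thesis
  proof (rule differentiable_bound_general[where f' = f' and \<phi>' = \<phi>'])
    show "0 < T" using False assms(4) by simp
    show "continuous_on {0..T} f"
      using has_vector_derivative_half_line_continuous_on[OF assms(1)]
      by (rule continuous_on_subset) auto
    show "continuous_on {0..T} \<phi>"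
      by (intro continuous_at_imp_continuous_on ballI has_vector_derivative_continuous[OF assms(2)])
    show "(f has_vector_derivative f' x) (at x)" if "0 < x" "x < T" for x
    proof -
      have "(f has_vector_derivative f' x) (at x within {0<..})"
        by (rule has_vector_derivative_within_subset[OF assms(1)]) (use that in auto)
      then show ?thesis using at_within_open[of x "{0<..}"] that by simp
    qed
    show "(\<phi> has_vector_derivative \<phi>' x) (at x)" for x by (rule assms(2))
    show "norm (f' x) \<le> \<phi>' x" if "0 < x" "x < T" for x using that by (rule assms(3))
  qed
qed simp

text \<open>The weight \<open>exp (2 a t)\<close> turns the integral inequality into a contraction by one half.\<close>

lemma gronwall_weighted:
  fixes w :: "real \<Rightarrow> 'f::real_normed_vector"
  assumes w: "\<And>t. t \<ge> 0 \<Longrightarrow> (w has_vector_derivative w' t) (at t within {0..})"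
    and bound: "\<And>t. 0 \<le> t \<Longrightarrow> t \<le> T \<Longrightarrow> norm (w' t) \<le> a * norm (w t) + c"
    and "a > 0" "c \<ge> 0" and t: "0 \<le> t" "t \<le> T"
  shows "norm (w t) \<le> 2 * (norm (w 0) + c * T) * exp (2 * a * t)"
proof -
  define h where "h = (\<lambda>t. exp (- (2 * a * t)) * norm (w t))"
  have "continuous_on {0..T} w"
    using has_vector_derivative_half_line_continuous_on[OF w] by (rule continuous_on_subset) auto
  then have "continuous_on {0..T} h"
    unfolding h_def by (intro continuous_intros)
  then obtain t0 where t0: "t0 \<in> {0..T}" "\<And>s. s \<in> {0..T} \<Longrightarrow> h s \<le> h t0"
    using continuous_attains_sup[of "{0..T}" h] t by auto
  define M where "M = h t0"
  have M: "norm (w s) \<le> M * exp (2 * a * s)" if "s \<in> {0..T}" for s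
  proof -
    have "h s * exp (2 * a * s) \<le> M * exp (2 * a * s)"
      using t0(2)[OF that] unfolding M_def by simp
    then show ?thesis unfolding h_def by (simp add: exp_minus field_simps)
  qed
  \<comment> \<open>An antiderivative of the bound for \<open>w'\<close>. Integrating
    \<open>a * M * exp (2 * a * s)\<close> halves \<open>M\<close>, so at the maximum point
    \<open>t0\<close> this term can be absorbed on the left.\<close>
  define \<phi> where "\<phi> = (\<lambda>s. M / 2 * exp (2 * a * s) + c * s)"
  have "norm (w t0 - w 0) \<le> \<phi> t0 - \<phi> 0"
  proof (rule norm_diff_le_of_derivative_le[OF w])
    show "(\<phi> has_vector_derivative a * (M * exp (2 * a * s)) + c) (at s)" for s
      unfolding \<phi>_def has_real_derivative_iff_has_vector_derivative[symmetric]
      by (auto intro!: derivative_eq_intros)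
    fix s assume s: "0 < s" "s < t0"
    then have "norm (w' s) \<le> a * norm (w s) + c" using bound t0(1) by auto
    also have "\<dots> \<le> a * (M * exp (2 * a * s)) + c"
      using M[of s] s t0(1) \<open>a > 0\<close> by (intro add_right_mono mult_left_mono) auto
    finally show "norm (w' s) \<le> a * (M * exp (2 * a * s)) + c" .
  qed (use t0 in auto)
  moreover have "M \<ge> 0" unfolding M_def h_def by simp
  ultimately have "norm (w t0) \<le> norm (w 0) + c * t0 + M / 2 * exp (2 * a * t0)"
    using norm_triangle_sub[of "w t0" "w 0"] unfolding \<phi>_def by simp
  also have "\<dots> \<le> norm (w 0) + c * T + M / 2 * exp (2 * a * t0)"
    using t0(1) \<open>c \<ge> 0\<close> by (simp add: mult_left_mono)
  finally have "M \<le> exp (- (2 * a * t0)) * (norm (w 0) + c * T + M / 2 * exp (2 * a * t0))"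
    unfolding M_def h_def by simp
  also have "\<dots> = exp (- (2 * a * t0)) * (norm (w 0) + c * T) + M / 2"
    by (simp add: algebra_simps exp_minus)
  also have "exp (- (2 * a * t0)) * (norm (w 0) + c * T) \<le> 1 * (norm (w 0) + c * T)"
    using t0(1) t \<open>a > 0\<close> \<open>c \<ge> 0\<close> by (intro mult_right_mono) auto
  finally have "M \<le> 2 * (norm (w 0) + c * T)" by simp
  then have "M * exp (2 * a * t) \<le> 2 * (norm (w 0) + c * T) * exp (2 * a * t)"
    by (intro mult_right_mono) auto
  moreover have "norm (w t) \<le> M * exp (2 * a * t)" using M[of t] t by simp
  ultimately show ?thesis by (rule order_trans[rotated])
qed

text \<open>One notion for the three equations that occur: X' = A X, Z' = - Z A and W' = A W - W A.
  Linearity enters through differences, and continuity is asked along continuous curves because that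
  is what the Picard integrals use.\<close>

definition ode_field :: "(real \<Rightarrow> 'f::real_normed_vector \<Rightarrow> 'f) \<Rightarrow> bool" where
  "ode_field L \<longleftrightarrow>
     (\<exists>a>0. \<forall>t\<ge>0. \<forall>x. norm (L t x) \<le> a * norm x) \<and>
     (\<forall>t x y. L t (x - y) = L t x - L t y) \<and>
     (\<forall>x. continuous_on {0..} x \<longrightarrow> continuous_on {0..} (\<lambda>t. L t (x t)))"

definition solves :: "(real \<Rightarrow> 'f::real_normed_vector \<Rightarrow> 'f) \<Rightarrow> (real \<Rightarrow> 'f) \<Rightarrow> bool" where
  "solves L x \<longleftrightarrow> (\<forall>t\<ge>0. (x has_vector_derivative L t (x t)) (at t within {0..}))"

lemma solves_unique:
  assumes L: "ode_field L" and "solves L x" "solves L y" "x 0 = y 0" "t \<ge> 0"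
  shows "x t = y t"
proof -
  obtain a where a: "a > 0" "\<And>t x. t \<ge> 0 \<Longrightarrow> norm (L t x) \<le> a * norm x"
    using L unfolding ode_field_def by auto
  have "((\<lambda>s. x s - y s) has_vector_derivative L s (x s - y s)) (at s within {0..})" if "s \<ge> 0" for s
    using has_vector_derivative_diff[of x _ "at s within {0..}" y] assms(2,3) that L
    unfolding solves_def ode_field_def by auto
  then have "norm (x t - y t) \<le> 2 * (norm (x 0 - y 0) + 0 * t) * exp (2 * a * t)"
    by (rule gronwall_weighted) (use a assms in auto)
  then show ?thesis using assms(4) by simp
qed

text \<open>Starting from the zero function rather than from \<open>x0\<close> makes the n-th
  iterate the sum of the first n differences, so that the Weierstrass test applies to it.\<close>

primrec picard :: "(real \<Rightarrow> 'f::real_normed_vector \<Rightarrow> 'f) \<Rightarrow> 'f \<Rightarrow> nat \<Rightarrow> real \<Rightarrow> 'f" where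
  "picard L x0 0 = (\<lambda>t. 0)"
| "picard L x0 (Suc k) = (\<lambda>t. x0 + integral {0..t} (\<lambda>s. L s (picard L x0 k s)))"

lemma solves_exists:
  fixes x0 :: "'f::banach"
  assumes L: "ode_field L"
  shows "\<exists>x. x 0 = x0 \<and> solves L x"
proof -
  obtain a where a: "a > 0" "\<And>t x. t \<ge> 0 \<Longrightarrow> norm (L t x) \<le> a * norm x"
    using L unfolding ode_field_def by auto
  have L_diff: "L t (x - y) = L t x - L t y" for t x y
    using L unfolding ode_field_def by auto
  have L0: "L t 0 = 0" for t
    using L_diff[of t 0 0] by simp
  have L_cont: "continuous_on {0..} (\<lambda>t. L t (x t))" if "continuous_on {0..} x" for x
    using L that unfolding ode_field_def by auto
  define p where "p = picard L x0"
  have p_0: "p 0 = (\<lambda>t. 0)" and p_Suc: "p (Suc k) = (\<lambda>t. x0 + integral {0..t} (\<lambda>s. L s (p k s)))" for k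
    unfolding p_def by simp_all
  have p_cont: "continuous_on {0..} (p k)"
    and p_deriv: "t \<ge> 0 \<Longrightarrow> (p (Suc k) has_vector_derivative L t (p k t)) (at t within {0..})" for k t
  proof -
    have deriv: "(p (Suc k) has_vector_derivative L t (p k t)) (at t within {0..})"
      if "continuous_on {0..} (p k)" "t \<ge> 0" for k t
      unfolding p_Suc
      using has_vector_derivative_add[OF has_vector_derivative_const
          integral_has_vector_derivative_half_line[OF L_cont[OF that(1)] that(2)], of x0] by simp
    show c: "continuous_on {0..} (p k)" for k
    proof (induction k)
      case 0 then show ?case by (simp add: p_0)
    next
      case (Suc k)
      show ?case
        by (rule has_vector_derivative_half_line_continuous_on) (rule deriv[OF Suc])
    qed
    show "t \<ge> 0 \<Longrightarrow> (p (Suc k) has_vector_derivative L t (p k t)) (at t within {0..})"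
      by (rule deriv[OF c])
  qed
  have p_init: "p (Suc k) 0 = x0" for k by (simp add: p_Suc)
  have step: "norm (p (Suc k) t - p k t) \<le> norm x0 * (1/2)^k * exp (2 * a * t)" if "t \<ge> 0" for k t
    using that
  proof (induction k arbitrary: t)
    case 0
    have "p (Suc 0) t = x0" by (simp add: p_Suc p_0 L0)
    then show ?case using 0 a(1) by (simp add: p_0 mult_le_cancel_left1)
  next
    case (Suc k)
    define d where "d = (\<lambda>t. p (Suc (Suc k)) t - p (Suc k) t)"
    \<comment> \<open>Its derivative is exactly \<open>a\<close> times the bound for the previous
      difference: integrating \<open>exp (2 * a * s)\<close> contributes \<open>1 / (2 * a)\<close>,
      which is the factor 1/2.\<close>
    define \<phi> where "\<phi> = (\<lambda>s. norm x0 * (1/2)^Suc k * exp (2 * a * s))"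
    have "norm (d t - d 0) \<le> \<phi> t - \<phi> 0"
    proof (rule norm_diff_le_of_derivative_le)
      show "(d has_vector_derivative L s (p (Suc k) s - p k s)) (at s within {0..})" if "s \<ge> 0" for s
        unfolding d_def L_diff by (intro has_vector_derivative_diff p_deriv that)
      show "(\<phi> has_vector_derivative a * (norm x0 * (1/2)^k * exp (2 * a * s))) (at s)" for s
        unfolding \<phi>_def has_real_derivative_iff_has_vector_derivative[symmetric]
        by (auto intro!: derivative_eq_intros)
      show "norm (L s (p (Suc k) s - p k s)) \<le> a * (norm x0 * (1/2)^k * exp (2 * a * s))" if "0 < s" for s
        by (rule order_trans[OF a(2) mult_left_mono[OF Suc.IH]]) (use a(1) that in auto)
    qed fact
    moreover have "d 0 = 0" by (simp add: d_def p_init)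
    moreover have "\<phi> 0 \<ge> 0" by (simp add: \<phi>_def)
    ultimately have "norm (d t) \<le> \<phi> t" by simp
    then show ?case unfolding d_def \<phi>_def .
  qed
  define x where "x = (\<lambda>t. \<Sum>k. p (Suc k) t - p k t)"
  have unif: "uniform_limit {0..T} p x sequentially" for T
  proof -
    have "uniform_limit {0..T} (\<lambda>n t. \<Sum>k<n. p (Suc k) t - p k t) x sequentially"
      unfolding x_def
    proof (rule Weierstrass_m_test)
      show "norm (p (Suc k) t - p k t) \<le> norm x0 * (1/2)^k * exp (2 * a * T)" if "t \<in> {0..T}" for k t
      proof -
        have "norm (p (Suc k) t - p k t) \<le> norm x0 * (1/2)^k * exp (2 * a * t)"
          using step that by simp
        also have "\<dots> \<le> norm x0 * (1/2)^k * exp (2 * a * T)"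
          using that a(1) by (intro mult_left_mono) auto
        finally show ?thesis .
      qed
      show "summable (\<lambda>k. norm x0 * (1/2)^k * exp (2 * a * T))"
        by (intro summable_mult summable_mult2 summable_geometric) simp
    qed
    moreover have "(\<Sum>k<n. p (Suc k) t - p k t) = p n t" for n t
      by (subst sum_lessThan_telescope) (simp add: p_0)
    ultimately show ?thesis by simp
  qed
  have x_cont: "continuous_on {0..} x"
  proof (rule continuous_on_half_line)
    fix T show "continuous_on {0..T} x"
      by (rule uniform_limit_theorem[OF _ unif])
        (use p_cont in \<open>auto intro!: always_eventually continuous_on_subset[OF p_cont]\<close>)
  qed
  have lim: "(\<lambda>n. p n t) \<longlonglongrightarrow> x t" if "t \<ge> 0" for t
    using tendsto_uniform_limitI[OF unif[of t], of t] that by simp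
  have eq: "x t = x0 + integral {0..t} (\<lambda>s. L s (x s))" if "t \<ge> 0" for t
  proof -
    have ul: "uniform_limit {0..t} (\<lambda>n s. L s (p n s)) (\<lambda>s. L s (x s)) sequentially"
    proof (rule uniform_limitI)
      fix e :: real assume "e > 0"
      then have "\<forall>\<^sub>F n in sequentially. \<forall>s\<in>{0..t}. dist (p n s) (x s) < e / a"
        using unif[of t] a(1) unfolding uniform_limit_iff by simp
      then show "\<forall>\<^sub>F n in sequentially. \<forall>s\<in>{0..t}. dist (L s (p n s)) (L s (x s)) < e"
      proof eventually_elim
        case (elim n)
        show ?case
        proof
          fix s assume s: "s \<in> {0..t}"
          have "dist (L s (p n s)) (L s (x s)) \<le> a * dist (p n s) (x s)"
            using a(2)[of s "p n s - x s"] s by (simp add: dist_norm L_diff)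
          also have "\<dots> < e"
            using elim s a(1) by (simp add: field_simps)
          finally show "dist (L s (p n s)) (L s (x s)) < e" .
        qed
      qed
    qed
    obtain I J where I: "\<And>n. ((\<lambda>s. L s (p n s)) has_integral I n) {0..t}"
      "((\<lambda>s. L s (x s)) has_integral J) {0..t}" "I \<longlonglongrightarrow> J"
      by (rule uniform_limit_integral[OF ul])
        (auto intro!: continuous_on_subset[OF L_cont[OF p_cont]])
    have "p (Suc n) t = x0 + I n" for n
      using integral_unique[OF I(1)[of n]] by (simp add: p_Suc)
    then have "(\<lambda>n. p (Suc n) t) \<longlonglongrightarrow> x0 + J"
      using tendsto_add[OF tendsto_const I(3)] by simp
    then have "x t = x0 + J"
      using LIMSEQ_unique lim[OF that] LIMSEQ_Suc by blast
    then show ?thesis using integral_unique[OF I(2)] by simp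
  qed
  have "solves L x"
    unfolding solves_def
  proof (intro allI impI)
    fix t :: real assume t: "t \<ge> 0"
    have "((\<lambda>t. x0 + integral {0..t} (\<lambda>s. L s (x s))) has_vector_derivative L t (x t)) (at t within {0..})"
      using has_vector_derivative_add[OF has_vector_derivative_const
          integral_has_vector_derivative_half_line[OF L_cont[OF x_cont] t], of x0] by simp
    then show "(x has_vector_derivative L t (x t)) (at t within {0..})"
      by (rule has_vector_derivative_transform[rotated 2]) (use eq t in auto)
  qed
  moreover have "x 0 = x0" using eq[of 0] by simp
  ultimately show ?thesis by blast
qed

subsection \<open>Fundamental solutions\<close>

text \<open>A bound on the whole half line gives the equation one global Lipschitz constant, which
  the Picard iteration and the Gronwall estimate share.\<close>

definition bounded_path :: "(real \<Rightarrow> 'f::real_normed_vector) \<Rightarrow> bool" where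
  "bounded_path A \<longleftrightarrow> continuous_on {0..} A \<and> (\<exists>a. \<forall>t\<ge>0. norm (A t) \<le> a)"

lemma bounded_path_const [simp]: "bounded_path (\<lambda>t. A)"
  unfolding bounded_path_def by auto

lemma ode_field_compose_left:
  fixes A :: "real \<Rightarrow> 'b::real_normed_vector \<Rightarrow>\<^sub>L 'b"
  assumes "bounded_path A"
  shows "ode_field (\<lambda>t (X :: 'a::real_normed_vector \<Rightarrow>\<^sub>L 'b). A t o\<^sub>L X)"
proof -
  obtain a where a: "\<And>t. t \<ge> 0 \<Longrightarrow> norm (A t) \<le> a"
    using assms unfolding bounded_path_def by auto
  have "norm (A t o\<^sub>L X) \<le> (\<bar>a\<bar> + 1) * norm X" if "t \<ge> 0" for t and X :: "'a \<Rightarrow>\<^sub>L 'b"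
    by (rule order_trans[OF norm_blinfun_compose mult_right_mono]) (use a[OF that] in auto)
  moreover have "\<bar>a\<bar> + 1 > 0" by simp
  ultimately show ?thesis
    using assms unfolding ode_field_def bounded_path_def
    by (intro conjI allI impI exI[of _ "\<bar>a\<bar> + 1"])
      (auto simp: blinfun_compose_simps intro!: bounded_bilinear.continuous_on[OF bounded_bilinear_blinfun_compose])
qed

lemma ode_field_compose_right:
  fixes A :: "real \<Rightarrow> 'b::real_normed_vector \<Rightarrow>\<^sub>L 'b"
  assumes "bounded_path A"
  shows "ode_field (\<lambda>t (X :: 'b \<Rightarrow>\<^sub>L 'a::real_normed_vector). - (X o\<^sub>L A t))"
proof -
  obtain a where a: "\<And>t. t \<ge> 0 \<Longrightarrow> norm (A t) \<le> a"
    using assms unfolding bounded_path_def by auto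
  have "norm (X o\<^sub>L A t) \<le> (\<bar>a\<bar> + 1) * norm X" if "t \<ge> 0" for t and X :: "'b \<Rightarrow>\<^sub>L 'a"
    by (subst mult.commute, rule order_trans[OF norm_blinfun_compose mult_left_mono]) (use a[OF that] in auto)
  moreover have "\<bar>a\<bar> + 1 > 0" by simp
  ultimately show ?thesis
    using assms unfolding ode_field_def bounded_path_def
    by (intro conjI allI impI exI[of _ "\<bar>a\<bar> + 1"])
      (auto simp: blinfun_compose_simps
        intro!: continuous_on_minus bounded_bilinear.continuous_on[OF bounded_bilinear_blinfun_compose])
qed

text \<open>The inverse of the fundamental solution is obtained as the solution of the adjoint
  equation; that it is a two-sided inverse is proved afterwards.\<close>

definition inverse_solution :: "(real \<Rightarrow> ('a::banach \<Rightarrow>\<^sub>L 'a)) \<Rightarrow> real \<Rightarrow> ('a \<Rightarrow>\<^sub>L 'a)" where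
  "inverse_solution A =
     (SOME Z. Z 0 = id_blinfun \<and> solves (\<lambda>t Z. - (Z o\<^sub>L A t)) Z)"

lemmas has_vector_derivative_compose =
  bounded_bilinear.has_vector_derivative[OF bounded_bilinear_blinfun_compose]

context
  fixes A :: "real \<Rightarrow> ('a::banach \<Rightarrow>\<^sub>L 'a)"
  assumes A: "bounded_path A"
begin

lemma fundamental_solution_0: "fundamental_solution A 0 = id_blinfun"
  and fundamental_solution_solves: "solves (\<lambda>t X. A t o\<^sub>L X) (fundamental_solution A)"
proof -
  have "\<exists>X. X 0 = id_blinfun \<and> solves (\<lambda>t X. A t o\<^sub>L X) X"
    by (intro solves_exists ode_field_compose_left A)
  from someI_ex[OF this]
  show "fundamental_solution A 0 = id_blinfun" "solves (\<lambda>t X. A t o\<^sub>L X) (fundamental_solution A)"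
    unfolding fundamental_solution_def solves_def by auto
qed

lemma inverse_solution_0: "inverse_solution A 0 = id_blinfun"
  and inverse_solution_solves: "solves (\<lambda>t Z. - (Z o\<^sub>L A t)) (inverse_solution A)"
proof -
  have "\<exists>Z. Z 0 = id_blinfun \<and> solves (\<lambda>t Z. - (Z o\<^sub>L A t)) Z"
    by (intro solves_exists ode_field_compose_right A)
  from someI_ex[OF this]
  show "inverse_solution A 0 = id_blinfun" "solves (\<lambda>t Z. - (Z o\<^sub>L A t)) (inverse_solution A)"
    unfolding inverse_solution_def by auto
qed

lemma fundamental_solution_deriv:
  "t \<ge> 0 \<Longrightarrow> (fundamental_solution A has_vector_derivative (A t o\<^sub>L fundamental_solution A t)) (at t within {0..})"
  using fundamental_solution_solves unfolding solves_def by simp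

lemma inverse_solution_deriv:
  "t \<ge> 0 \<Longrightarrow> (inverse_solution A has_vector_derivative - (inverse_solution A t o\<^sub>L A t)) (at t within {0..})"
  using inverse_solution_solves unfolding solves_def by simp

text \<open>The derivative of Z X is - Z A X + Z A X = 0.\<close>

lemma inverse_solution_left:
  assumes "t \<ge> 0"
  shows "inverse_solution A t o\<^sub>L fundamental_solution A t = id_blinfun"
proof -
  have "((\<lambda>t. inverse_solution A t o\<^sub>L fundamental_solution A t) has_vector_derivative 0) (at s within {0..})"
    if "s \<in> {0..}" for s
    using has_vector_derivative_compose[OF inverse_solution_deriv[of s] fundamental_solution_deriv[of s]] that
    by (simp add: blinfun_compose_simps blinfun_compose_assoc)
  then obtain c where c: "\<And>s. s \<in> {0..} \<Longrightarrow> inverse_solution A s o\<^sub>L fundamental_solution A s = c"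
    using has_vector_derivative_zero_constant[OF convex_real_interval(1)] by blast
  from c[of 0] c[of t] assms show ?thesis
    by (simp add: inverse_solution_0 fundamental_solution_0)
qed

text \<open>The derivative of X Z does not cancel formally. Instead X Z solves the commutator
  equation W' = A W - W A, which the constant identity solves as well, so uniqueness
  applies.\<close>

lemma inverse_solution_right:
  assumes "t \<ge> 0"
  shows "fundamental_solution A t o\<^sub>L inverse_solution A t = id_blinfun"
proof -
  obtain a where a: "\<And>t. t \<ge> 0 \<Longrightarrow> norm (A t) \<le> a"
    using A unfolding bounded_path_def by auto
  let ?L = "\<lambda>t (X :: 'a \<Rightarrow>\<^sub>L 'a). (A t o\<^sub>L X) - (X o\<^sub>L A t)"
  have "ode_field ?L"
    unfolding ode_field_def
  proof (intro conjI allI impI)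
    have "norm (?L t X) \<le> (2 * \<bar>a\<bar> + 1) * norm X" if "t \<ge> 0" for t X
    proof -
      have "norm (?L t X) \<le> norm (A t) * norm X + norm X * norm (A t)"
        by (rule norm_triangle_le_diff) (intro add_mono norm_blinfun_compose)
      also have "\<dots> \<le> \<bar>a\<bar> * norm X + \<bar>a\<bar> * norm X"
        using a[OF that] mult_right_mono[of "norm (A t)" "\<bar>a\<bar>" "norm X"] by (simp add: mult.commute)
      finally show ?thesis using norm_ge_zero[of X] unfolding distrib_right by linarith
    qed
    then show "\<exists>a>0. \<forall>t\<ge>0. \<forall>x. norm (?L t x) \<le> a * norm x"
      by (intro exI[of _ "2 * \<bar>a\<bar> + 1"]) auto
    show "?L t (X - Y) = ?L t X - ?L t Y" for t X Y
      by (simp add: blinfun_compose_simps)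
    show "continuous_on {0..} (\<lambda>t. ?L t (X t))" if "continuous_on {0..} X" for X
      using that A unfolding bounded_path_def
      by (intro continuous_on_diff bounded_bilinear.continuous_on[OF bounded_bilinear_blinfun_compose]) auto
  qed
  moreover have "solves ?L (\<lambda>t. fundamental_solution A t o\<^sub>L inverse_solution A t)"
    unfolding solves_def
  proof (intro allI impI)
    fix s :: real assume "s \<ge> 0"
    from has_vector_derivative_compose[OF fundamental_solution_deriv[OF this] inverse_solution_deriv[OF this]]
    show "((\<lambda>t. fundamental_solution A t o\<^sub>L inverse_solution A t) has_vector_derivative
        ?L s (fundamental_solution A s o\<^sub>L inverse_solution A s)) (at s within {0..})"
      by (simp add: blinfun_compose_simps blinfun_compose_assoc)
  qed
  moreover have "solves ?L (\<lambda>t. id_blinfun)"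
    unfolding solves_def by simp
  ultimately show ?thesis
    by (rule solves_unique) (use assms in \<open>auto simp: inverse_solution_0 fundamental_solution_0\<close>)
qed

end

lemma fundamental_solution_unique:
  fixes Y :: "real \<Rightarrow> ('b::real_normed_vector \<Rightarrow>\<^sub>L 'a::banach)"
  assumes A: "bounded_path A" and "solves (\<lambda>t Y. A t o\<^sub>L Y) Y" and "t \<ge> 0"
  shows "Y t = fundamental_solution A t o\<^sub>L Y 0"
proof (rule solves_unique[OF ode_field_compose_left[OF A] assms(2)])
  show "solves (\<lambda>t Y. A t o\<^sub>L Y) (\<lambda>t. fundamental_solution A t o\<^sub>L Y 0)"
    unfolding solves_def
  proof (intro allI impI)
    fix s :: real assume "s \<ge> 0"
    from has_vector_derivative_compose[OF fundamental_solution_deriv[OF A this] has_vector_derivative_const]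
    show "((\<lambda>t. fundamental_solution A t o\<^sub>L Y 0) has_vector_derivative
        (A s o\<^sub>L (fundamental_solution A s o\<^sub>L Y 0))) (at s within {0..})"
      by (simp add: blinfun_compose_assoc)
  qed
qed (use assms in \<open>auto simp: fundamental_solution_0\<close>)

text \<open>Both sides solve Y' = B Y with initial value \<open>C\<close>. With \<open>A = B\<close>
  this is a commutation rule; with different spaces it relates a flow to the flow of its
  complexification.\<close>

lemma fundamental_solution_intertwine:
  fixes A :: "real \<Rightarrow> ('a::banach \<Rightarrow>\<^sub>L 'a)" and B :: "real \<Rightarrow> ('b::banach \<Rightarrow>\<^sub>L 'b)"
  assumes A: "bounded_path A" and B: "bounded_path B"
    and C: "\<And>t. t \<ge> 0 \<Longrightarrow> C o\<^sub>L A t = B t o\<^sub>L C" and "t \<ge> 0"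
  shows "C o\<^sub>L fundamental_solution A t = fundamental_solution B t o\<^sub>L C"
proof -
  have "solves (\<lambda>t Y. B t o\<^sub>L Y) (\<lambda>t. C o\<^sub>L fundamental_solution A t)"
    unfolding solves_def
  proof (intro allI impI)
    fix s :: real assume s: "s \<ge> 0"
    from has_vector_derivative_compose[OF has_vector_derivative_const[of C] fundamental_solution_deriv[OF A s]]
    show "((\<lambda>t. C o\<^sub>L fundamental_solution A t) has_vector_derivative
        (B s o\<^sub>L (C o\<^sub>L fundamental_solution A s))) (at s within {0..})"
      using C[OF s] by (simp add: blinfun_compose_assoc[symmetric])
  qed
  from fundamental_solution_unique[OF B this \<open>t \<ge> 0\<close>] show ?thesis
    by (simp add: fundamental_solution_0[OF A])
qed

lemma inverse_solution_commute:
  fixes A :: "real \<Rightarrow> ('a::banach \<Rightarrow>\<^sub>L 'a)"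
  assumes A: "bounded_path A" and C: "\<And>t. t \<ge> 0 \<Longrightarrow> C o\<^sub>L A t = A t o\<^sub>L C" and t: "t \<ge> 0"
  shows "C o\<^sub>L inverse_solution A t = inverse_solution A t o\<^sub>L C"
proof -
  let ?X = "fundamental_solution A t" and ?Z = "inverse_solution A t"
  have "?Z o\<^sub>L (C o\<^sub>L ?X) o\<^sub>L ?Z = ?Z o\<^sub>L (?X o\<^sub>L C) o\<^sub>L ?Z"
    using fundamental_solution_intertwine[OF A A C t] by simp
  then have "?Z o\<^sub>L C o\<^sub>L (?X o\<^sub>L ?Z) = (?Z o\<^sub>L ?X) o\<^sub>L C o\<^sub>L ?Z"
    by (simp add: blinfun_compose_assoc)
  then show ?thesis
    by (simp add: inverse_solution_left[OF A t] inverse_solution_right[OF A t])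
qed

text \<open>Variation of constants: the product has the compact derivative Z (B - A) X, so its
  increments from the identity are integrals of compact operators.\<close>

lemma inverse_solution_compose_compact:
  fixes A B :: "real \<Rightarrow> ('a::banach \<Rightarrow>\<^sub>L 'a)"
  assumes A: "bounded_path A" and B: "bounded_path B"
    and compact: "\<And>t. t \<ge> 0 \<Longrightarrow> B t \<sim>\<^sub>K A t" and t: "t \<ge> 0"
  shows "(inverse_solution A t o\<^sub>L fundamental_solution B t) \<sim>\<^sub>K id_blinfun"
proof -
  let ?W = "\<lambda>t. inverse_solution A t o\<^sub>L fundamental_solution B t"
  let ?D = "\<lambda>t. inverse_solution A t o\<^sub>L (B t - A t) o\<^sub>L fundamental_solution B t"
  have "(?W has_vector_derivative ?D s) (at s within {0..})" if "s \<ge> 0" for s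
    using has_vector_derivative_compose[OF inverse_solution_deriv[OF A that] fundamental_solution_deriv[OF B that]]
    by (simp add: blinfun_compose_simps blinfun_compose_assoc)
  then have "(?W has_vector_derivative ?D s) (at s within {0..t})" if "s \<in> {0..t}" for s
    by (rule has_vector_derivative_within_subset) (use that in auto)
  with t have "(?D has_integral (?W t - ?W 0)) {0..t}"
    by (rule fundamental_theorem_of_calculus)
  then have "?W t - ?W 0 \<in> {T. compact_operator T}"
    by (rule integral_in_closed_subspace[OF compact_operator_subspace closed_compact_operators])
      (use compact in \<open>simp add: compact_eq_def compact_operator_compose_left compact_operator_compose_right\<close>)
  then show ?thesis
    by (simp add: compact_eq_def inverse_solution_0[OF A] fundamental_solution_0[OF B])
qed

lemma fundamental_solution_compact_eq:
  fixes A B :: "real \<Rightarrow> ('a::banach \<Rightarrow>\<^sub>L 'a)"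
  assumes A: "bounded_path A" and B: "bounded_path B"
    and compact: "\<And>t. t \<ge> 0 \<Longrightarrow> B t \<sim>\<^sub>K A t" and t: "t \<ge> 0"
  shows "fundamental_solution B t \<sim>\<^sub>K fundamental_solution A t"
    and "inverse_solution B t \<sim>\<^sub>K inverse_solution A t"
proof -
  let ?X = "fundamental_solution A t" and ?Z = "inverse_solution A t"
  have "(?X o\<^sub>L (?Z o\<^sub>L fundamental_solution B t)) \<sim>\<^sub>K (?X o\<^sub>L id_blinfun)"
    by (intro compact_eq_compose compact_eq_refl inverse_solution_compose_compact A B compact t)
  then show 1: "fundamental_solution B t \<sim>\<^sub>K ?X"
    by (simp add: blinfun_compose_assoc[symmetric] inverse_solution_right[OF A t])
  show "inverse_solution B t \<sim>\<^sub>K ?Z"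
    by (rule compact_eq_inverse[OF _ _ _ _ 1])
      (simp_all add: inverse_solution_right inverse_solution_left A B t)
qed

text \<open>The propagator from time \<open>t0\<close> to time \<open>t0 + t\<close>. The last
  argument is the elapsed time, so that the propagator again lives on the half line.\<close>

definition evolution :: "(real \<Rightarrow> ('a::banach \<Rightarrow>\<^sub>L 'a)) \<Rightarrow> real \<Rightarrow> real \<Rightarrow> ('a \<Rightarrow>\<^sub>L 'a)" where
  "evolution A t0 t = fundamental_solution A (t0 + t) o\<^sub>L inverse_solution A t0"

lemma evolution_deriv:
  assumes A: "bounded_path A" and t0: "t0 \<ge> 0" and t: "t \<ge> 0"
  shows "(evolution A t0 has_vector_derivative (A (t0 + t) o\<^sub>L evolution A t0 t)) (at t within {0..})"
proof -
  have "(fundamental_solution A has_vector_derivative (A (t0 + t) o\<^sub>L fundamental_solution A (t0 + t)))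
      (at (t0 + t) within (\<lambda>t. t0 + t) ` {0..})"
    by (rule has_vector_derivative_within_subset[OF fundamental_solution_deriv[OF A]]) (use t0 t in auto)
  moreover have "((\<lambda>t. t0 + t) has_vector_derivative 1) (at t within {0..})"
    by (auto intro!: derivative_eq_intros)
  ultimately have "((\<lambda>t. fundamental_solution A (t0 + t)) has_vector_derivative
      (A (t0 + t) o\<^sub>L fundamental_solution A (t0 + t))) (at t within {0..})"
    using vector_diff_chain_within[of "\<lambda>t. t0 + t" 1 t "{0..}" "fundamental_solution A"] by (simp add: o_def)
  from has_vector_derivative_compose[OF this has_vector_derivative_const]
  show ?thesis unfolding evolution_def by (simp add: blinfun_compose_assoc)
qed

lemma evolution_0:
  assumes "bounded_path A" "t0 \<ge> 0"
  shows "evolution A t0 0 = id_blinfun"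
  unfolding evolution_def by (simp add: inverse_solution_right assms)

lemma norm_evolution_le:
  assumes A: "bounded_path A" and a: "a > 0" "\<And>t. t \<ge> 0 \<Longrightarrow> norm (A t) \<le> a"
    and t0: "t0 \<ge> 0" and t: "t \<ge> 0"
  shows "norm (evolution A t0 t) \<le> 2 * exp (2 * a * t)"
proof -
  have "norm (evolution A t0 t) \<le> 2 * (norm (evolution A t0 0) + 0 * t) * exp (2 * a * t)"
  proof (rule gronwall_weighted[OF evolution_deriv[OF A t0]])
    fix s :: real assume "0 \<le> s"
    then show "norm (A (t0 + s) o\<^sub>L evolution A t0 s) \<le> a * norm (evolution A t0 s) + 0"
      using norm_blinfun_compose[of "A (t0 + s)" "evolution A t0 s"] t0
        mult_right_mono[OF a(2)[of "t0 + s"], of "norm (evolution A t0 s)"] by simp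
  qed (use a t in auto)
  \<comment> \<open>The identity has norm at most one, with strict inequality on the zero
    space.\<close>
  also have "\<dots> \<le> 2 * (1 + 0 * t) * exp (2 * a * t)"
    using norm_blinfun_id_le[where 'a='a] by (simp add: evolution_0[OF A t0])
  finally show ?thesis by simp
qed

lemma norm_fundamental_solution_const_le:
  assumes "a > 0" "norm A0 \<le> a" "t \<ge> 0"
  shows "norm (fundamental_solution (\<lambda>t. A0) t) \<le> 2 * exp (2 * a * t)"
  using norm_evolution_le[of "\<lambda>t. A0" a 0 t] assms
  by (simp add: evolution_def inverse_solution_0)

text \<open>The difference vanishes at 0 and solves the equation of the propagator with an
  additional forcing (A(t0 + s) - A0) V(s). On [0, t] this forcing is at most \<delta> times the
  crude exponential bound for V, and the Gronwall estimate contributes the second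
  exponential.\<close>

lemma evolution_close:
  assumes A: "bounded_path A" and a: "a > 0" "\<And>t. t \<ge> 0 \<Longrightarrow> norm (A t) \<le> a" "norm A0 \<le> a"
    and t0: "t0 \<ge> 0" and t: "t \<ge> 0" and \<delta>: "\<And>t. t \<ge> t0 \<Longrightarrow> norm (A t - A0) \<le> \<delta>"
  shows "norm (evolution A t0 t - fundamental_solution (\<lambda>t. A0) t) \<le> \<delta> * (4 * t * exp (2 * a * t) * exp (2 * a * t))"
proof -
  let ?V = "fundamental_solution (\<lambda>t. A0)"
  define w where "w = (\<lambda>t. evolution A t0 t - ?V t)"
  have \<delta>0: "\<delta> \<ge> 0" using \<delta>[of t0] norm_ge_zero order_trans by blast
  have w: "(w has_vector_derivative ((A (t0 + s) o\<^sub>L w s) + ((A (t0 + s) - A0) o\<^sub>L ?V s))) (at s within {0..})"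
    if "s \<ge> 0" for s
    using has_vector_derivative_diff[OF evolution_deriv[OF A t0 that]
        fundamental_solution_deriv[of "\<lambda>t. A0", OF _ that]]
    unfolding w_def by (simp add: blinfun_compose_simps)
  have "norm (w t) \<le> 2 * (norm (w 0) + \<delta> * (2 * exp (2 * a * t)) * t) * exp (2 * a * t)"
  proof (rule gronwall_weighted[OF w])
    fix s :: real assume s: "0 \<le> s" "s \<le> t"
    have "norm (?V s) \<le> 2 * exp (2 * a * s)"
      using norm_fundamental_solution_const_le a s by blast
    also have "\<dots> \<le> 2 * exp (2 * a * t)" using s a by simp
    finally have V: "norm (?V s) \<le> 2 * exp (2 * a * t)" .
    have "norm (A (t0 + s) o\<^sub>L w s) \<le> a * norm (w s)"
      using norm_blinfun_compose[of "A (t0 + s)" "w s"] t0 s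
        mult_right_mono[OF a(2)[of "t0 + s"], of "norm (w s)"] by simp
    moreover have "norm ((A (t0 + s) - A0) o\<^sub>L ?V s) \<le> \<delta> * (2 * exp (2 * a * t))"
      using norm_blinfun_compose[of "A (t0 + s) - A0" "?V s"] V
        mult_mono[OF \<delta>[of "t0 + s"] V] s \<delta>0 by simp
    ultimately show "norm ((A (t0 + s) o\<^sub>L w s) + ((A (t0 + s) - A0) o\<^sub>L ?V s)) \<le>
        a * norm (w s) + \<delta> * (2 * exp (2 * a * t))"
      by (rule norm_triangle_mono)
  qed (use a t \<delta>0 in auto)
  then show ?thesis
    unfolding w_def by (simp add: evolution_0[OF A t0] fundamental_solution_0 algebra_simps)
qed

subsection \<open>Contour integrals of operator-valued functions\<close>

lemma continuous_on_linepath_compose: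
  assumes "continuous_on (closed_segment p q) F"
  shows "continuous_on {0..1} (\<lambda>t. F (linepath p q t))"
  by (rule continuous_on_compose2[OF assms]) (auto intro: continuous_on_linepath linepath_in_path)

lemma bounded_linear_compose_left: "bounded_linear (\<lambda>X. C o\<^sub>L X)"
  and bounded_linear_compose_right: "bounded_linear (\<lambda>X. X o\<^sub>L C)"
  for C :: "'b::real_normed_vector \<Rightarrow>\<^sub>L 'c::real_normed_vector"
  by (simp_all add: bounded_bilinear.bounded_linear_left[OF bounded_bilinear_blinfun_compose]
      bounded_bilinear.bounded_linear_right[OF bounded_bilinear_blinfun_compose])

lemma eventually_in_at_within: "\<forall>\<^sub>F w in at z within S. w \<in> S"
  by (simp add: eventually_at_filter)

text \<open>The Caratheodory form of differentiability. It suits the resolvent, whose identity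
  factors \<open>u - t\<close> out of the difference exactly.\<close>

lemma has_vector_derivative_of_difference_quotient:
  fixes f :: "real \<Rightarrow> 'f::real_normed_vector"
  assumes "\<And>u. u \<in> S \<Longrightarrow> f u - f t = (u - t) *\<^sub>R g u" "(g \<longlongrightarrow> g t) (at t within S)"
  shows "(f has_vector_derivative g t) (at t within S)"
  unfolding has_vector_derivative_def has_derivative_within_alt2
proof (intro conjI allI impI)
  show "bounded_linear (\<lambda>x. x *\<^sub>R g t)" by (rule bounded_linear_scaleR_left)
  fix e :: real assume "e > 0"
  then have "\<forall>\<^sub>F u in at t within S. dist (g u) (g t) < e" using assms(2) tendstoD by blast
  then show "\<forall>\<^sub>F u in at t within S. norm (f u - f t - (u - t) *\<^sub>R g t) \<le> e * norm (u - t)"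
    using eventually_in_at_within
  proof eventually_elim
    case (elim u)
    have "norm (f u - f t - (u - t) *\<^sub>R g t) = norm (g u - g t) * norm (u - t)"
      using assms(1)[of u] elim by (simp flip: scaleR_diff_right)
    also have "\<dots> \<le> e * norm (u - t)"
      using elim by (intro mult_right_mono) (auto simp: dist_norm)
    finally show ?case .
  qed
qed

text \<open>
  A complex structure \<open>J\<close> on a real Banach space covers both complex Banach spaces and
  complexifications, whose norm need not be complex homogeneous.
\<close>

locale complex_structure =
  fixes J :: "'a::banach \<Rightarrow>\<^sub>L 'a" and s :: "complex \<Rightarrow> 'a \<Rightarrow> 'a"
  assumes J_J: "J o\<^sub>L J = - id_blinfun"
    and s_eq: "s z x = Re z *\<^sub>R x + Im z *\<^sub>R blinfun_apply J x"
begin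

abbreviation \<sigma> :: "complex \<Rightarrow> ('a \<Rightarrow>\<^sub>L 'a)" where "\<sigma> \<equiv> scalar_op s"

lemma scalar_op_eq: "\<sigma> z = Re z *\<^sub>R id_blinfun + Im z *\<^sub>R J"
proof -
  have "s z = blinfun_apply (Re z *\<^sub>R id_blinfun + Im z *\<^sub>R J)"
    by (rule ext) (simp add: s_eq blinfun.bilinear_simps)
  then show ?thesis by (simp add: scalar_op_def blinfun_apply_inverse)
qed

lemma J_J_apply [simp]: "blinfun_apply J (blinfun_apply J x) = - x"
proof -
  have "blinfun_apply (J o\<^sub>L J) x = blinfun_apply (- id_blinfun) x" by (simp only: J_J)
  then show ?thesis by (simp add: blinfun.bilinear_simps)
qed

lemma scalar_op_add: "\<sigma> (z + w) = \<sigma> z + \<sigma> w"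
  and scalar_op_diff: "\<sigma> (z - w) = \<sigma> z - \<sigma> w"
  and scalar_op_minus: "\<sigma> (- z) = - \<sigma> z"
  and scalar_op_scaleR: "\<sigma> (r *\<^sub>R z) = r *\<^sub>R \<sigma> z"
  and scalar_op_1 [simp]: "\<sigma> 1 = id_blinfun"
  and scalar_op_0 [simp]: "\<sigma> 0 = 0"
  and scalar_op_of_real: "\<sigma> (of_real r) = r *\<^sub>R id_blinfun"
  by (simp_all add: scalar_op_eq algebra_simps)

lemma scalar_op_mult: "\<sigma> (z * w) = \<sigma> z o\<^sub>L \<sigma> w"
  by (rule blinfun_eqI) (simp add: scalar_op_eq blinfun.bilinear_simps algebra_simps)

lemma scalar_op_commute: "C o\<^sub>L J = J o\<^sub>L C \<Longrightarrow> C o\<^sub>L \<sigma> z = \<sigma> z o\<^sub>L C"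
  by (simp add: scalar_op_eq blinfun_compose_simps)

lemma scalar_op_scalar_op_commute: "\<sigma> z o\<^sub>L \<sigma> w = \<sigma> w o\<^sub>L \<sigma> z"
  by (simp flip: scalar_op_mult add: mult.commute)

text \<open>The price for a norm that need not be complex homogeneous: multiplication by
  \<open>z\<close> has norm at most \<kappa> |z|.\<close>

definition \<kappa> :: real where "\<kappa> = 1 + norm J"

lemma kappa_ge_1: "\<kappa> \<ge> 1"
  by (simp add: \<kappa>_def)

lemma norm_scalar_op_le: "norm (\<sigma> z) \<le> \<kappa> * cmod z"
proof -
  have "norm (\<sigma> z) \<le> norm (Re z *\<^sub>R (id_blinfun :: 'a \<Rightarrow>\<^sub>L 'a)) + norm (Im z *\<^sub>R J)"
    unfolding scalar_op_eq by (rule norm_triangle_ineq)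
  also have "\<dots> \<le> cmod z * 1 + cmod z * norm J"
    unfolding norm_scaleR using norm_blinfun_id_le[where 'a='a]
    by (intro add_mono mult_mono) (auto simp: abs_Re_le_cmod abs_Im_le_cmod)
  finally show ?thesis by (simp add: \<kappa>_def algebra_simps)
qed

lemma bounded_linear_scalar_op: "bounded_linear \<sigma>"
proof (rule bounded_linear_intro)
  show "norm (\<sigma> z) \<le> norm z * \<kappa>" for z
    using norm_scalar_op_le[of z] by (simp add: mult.commute)
qed (rule scalar_op_add, rule scalar_op_scaleR)

text \<open>The integral of F(z) dz over the segment from \<open>p\<close> to \<open>q\<close>; dz
  contributes the constant scalar \<open>q - p\<close>, which acts as an operator in front of the
  integral.\<close>

definition edge :: "complex \<Rightarrow> complex \<Rightarrow> (complex \<Rightarrow> ('a \<Rightarrow>\<^sub>L 'a)) \<Rightarrow> ('a \<Rightarrow>\<^sub>L 'a)" where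
  "edge p q F = \<sigma> (q - p) o\<^sub>L integral {0..1} (\<lambda>t. F (linepath p q t))"

lemma integrable_linepath:
  assumes "continuous_on (closed_segment p q) (F :: complex \<Rightarrow> 'a \<Rightarrow>\<^sub>L 'a)"
  shows "(\<lambda>t. F (linepath p q t)) integrable_on {0..1}"
  using continuous_on_linepath_compose[OF assms] by (rule integrable_continuous_real)

lemma edge_cong:
  assumes "\<And>z. z \<in> closed_segment p q \<Longrightarrow> F z = G z"
  shows "edge p q F = edge p q G"
  unfolding edge_def
  by (intro arg_cong2[where f = blinfun_compose] refl integral_cong assms) (auto intro: linepath_in_path)

lemma edge_add:
  assumes "continuous_on (closed_segment p q) F" "continuous_on (closed_segment p q) G"
  shows "edge p q (\<lambda>z. F z + G z) = edge p q F + edge p q G"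
  unfolding edge_def
  by (simp add: integral_add integrable_linepath assms blinfun_compose_simps)

lemma edge_minus: "edge p q (\<lambda>z. - F z) = - edge p q F"
  unfolding edge_def by (simp add: blinfun_compose_simps)

lemma edge_scaleR: "edge p q (\<lambda>z. r *\<^sub>R F z) = r *\<^sub>R edge p q F"
  unfolding edge_def by (simp add: blinfun_compose_simps)

lemma integral_compose_left:
  fixes C :: "'a \<Rightarrow>\<^sub>L 'a"
  assumes "f integrable_on {0..1::real}"
  shows "integral {0..1} (\<lambda>t. C o\<^sub>L f t) = C o\<^sub>L integral {0..1} f"
  using integral_linear[OF assms bounded_linear_compose_left[of C]] by (simp add: o_def)

lemma integral_compose_right:
  fixes C :: "'a \<Rightarrow>\<^sub>L 'a"
  assumes "f integrable_on {0..1::real}"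
  shows "integral {0..1} (\<lambda>t. f t o\<^sub>L C) = integral {0..1} f o\<^sub>L C"
  using integral_linear[OF assms bounded_linear_compose_right[of C]] by (simp add: o_def)

text \<open>\<open>C\<close> has to pass the scalar factor in front of the integral, hence the
  commutation with \<open>J\<close>; composition on the right meets no such factor.\<close>

lemma edge_compose_left:
  assumes "continuous_on (closed_segment p q) F" "C o\<^sub>L J = J o\<^sub>L C"
  shows "edge p q (\<lambda>z. C o\<^sub>L F z) = C o\<^sub>L edge p q F"
  unfolding edge_def integral_compose_left[OF integrable_linepath[OF assms(1)]]
  by (simp add: blinfun_compose_assoc[symmetric] scalar_op_commute[OF assms(2)])

lemma edge_compose_right:
  assumes "continuous_on (closed_segment p q) F"
  shows "edge p q (\<lambda>z. F z o\<^sub>L C) = edge p q F o\<^sub>L C"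
  unfolding edge_def integral_compose_right[OF integrable_linepath[OF assms(1)]]
  by (simp add: blinfun_compose_assoc)

lemma norm_edge_le:
  assumes "continuous_on (closed_segment p q) F" "\<And>z. z \<in> closed_segment p q \<Longrightarrow> norm (F z) \<le> B"
  shows "norm (edge p q F) \<le> \<kappa> * cmod (q - p) * B"
proof -
  have "norm (integral {0..1} (\<lambda>t. F (linepath p q t))) \<le> B * (1 - 0)"
    by (rule integral_bound)
      (use continuous_on_linepath_compose[OF assms(1)] in \<open>simp_all add: assms(2) linepath_in_path\<close>)
  moreover have "norm (edge p q F) \<le> norm (\<sigma> (q - p)) * norm (integral {0..1} (\<lambda>t. F (linepath p q t)))"
    unfolding edge_def by (rule norm_blinfun_compose)
  ultimately show ?thesis
    using mult_mono[OF norm_scalar_op_le[of "q - p"], of _ B] kappa_ge_1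
    by (fastforce elim: order_trans)
qed

lemma edge_reverse: 
  assumes "continuous_on (closed_segment p q) F"
  shows "edge q p F = - edge p q F"
proof -
  let ?I = "integral {0..1} (\<lambda>t. F (linepath p q t))"
  have "((\<lambda>t. F (linepath p q t)) has_integral ?I) {0..1}"
    using integrable_linepath[OF assms] by blast
  from iffD2[OF has_integral_reflect_real this]
  have "((\<lambda>t. F (linepath p q (- t))) has_integral ?I) (cbox (- 1) 0)"
    by simp
  from has_integral_affinity'[OF this, of 1 "-1"]
  have "((\<lambda>t. F (linepath p q (1 - t))) has_integral ?I) {0..1}"
    by simp
  moreover have "linepath p q (1 - t) = linepath q p t" for t
    by (simp add: linepath_def algebra_simps)
  ultimately have "integral {0..1} (\<lambda>t. F (linepath q p t)) = integral {0..1} (\<lambda>t. F (linepath p q t))"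
    by (simp add: integral_unique)
  then show ?thesis
    unfolding edge_def by (simp add: scalar_op_diff blinfun_compose_simps)
qed

text \<open>Substituting - z for z changes the sign of dz.\<close>

lemma edge_negate: "edge p q (\<lambda>z. F (- z)) = - edge (- p) (- q) F"
proof -
  have "- linepath p q t = linepath (- p) (- q) t" for t
    by (simp add: linepath_def algebra_simps)
  then show ?thesis
    unfolding edge_def by (simp add: scalar_op_diff scalar_op_minus blinfun_compose_simps)
qed

text \<open>Complex differentiability recorded only along segments inside \<open>S\<close>, as the
  chain rule for \<open>linepath\<close>. This is the form in which the fundamental theorem
  evaluates an edge.\<close>

definition has_cderiv_on ::
    "complex set \<Rightarrow> (complex \<Rightarrow> ('a \<Rightarrow>\<^sub>L 'a)) \<Rightarrow> (complex \<Rightarrow> ('a \<Rightarrow>\<^sub>L 'a)) \<Rightarrow> bool" where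
  "has_cderiv_on S G g \<longleftrightarrow> (\<forall>p q. closed_segment p q \<subseteq> S \<longrightarrow> (\<forall>t\<in>{0..1}.
     ((\<lambda>t. G (linepath p q t)) has_vector_derivative (\<sigma> (q - p) o\<^sub>L g (linepath p q t))) (at t within {0..1})))"

lemma edge_cderiv:
  assumes "has_cderiv_on S G g" "closed_segment p q \<subseteq> S" "continuous_on S g"
  shows "edge p q g = G q - G p"
proof -
  have c: "continuous_on (closed_segment p q) g"
    using assms(2,3) continuous_on_subset by blast
  have "((\<lambda>t. \<sigma> (q - p) o\<^sub>L g (linepath p q t)) has_integral (G (linepath p q 1) - G (linepath p q 0))) {0..1}"
    by (rule fundamental_theorem_of_calculus) (use assms in \<open>auto simp: has_cderiv_on_def\<close>)
  then have "integral {0..1} (\<lambda>t. \<sigma> (q - p) o\<^sub>L g (linepath p q t)) = G q - G p"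
    by (simp add: integral_unique linepath_0' linepath_1')
  then show ?thesis
    unfolding edge_def integral_compose_left[OF integrable_linepath[OF c]] .
qed

lemma has_cderiv_on_scalar:
  assumes "\<And>z. z \<in> S \<Longrightarrow> (f has_field_derivative f' z) (at z)"
  shows "has_cderiv_on S (\<lambda>z. \<sigma> (f z)) (\<lambda>z. \<sigma> (f' z))"
  unfolding has_cderiv_on_def
proof (intro allI impI ballI)
  fix p q :: complex and t :: real
  assume pq: "closed_segment p q \<subseteq> S" and t: "t \<in> {0..1}"
  then have "linepath p q t \<in> S" using linepath_in_path by blast
  then have f: "(f has_field_derivative f' (linepath p q t)) (at (linepath p q t))"
    by (rule assms)
  have "(linepath p q has_vector_derivative (q - p)) (at t within {0..1})"
    by (rule has_vector_derivative_linepath_within)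
  from field_vector_diff_chain_within[OF this has_field_derivative_at_within[OF f]]
  have "((\<lambda>t. f (linepath p q t)) has_vector_derivative ((q - p) * f' (linepath p q t))) (at t within {0..1})"
    by (simp add: o_def)
  from bounded_linear.has_vector_derivative[OF bounded_linear_scalar_op this]
  show "((\<lambda>t. \<sigma> (f (linepath p q t))) has_vector_derivative
      (\<sigma> (q - p) o\<^sub>L \<sigma> (f' (linepath p q t)))) (at t within {0..1})"
    by (simp add: scalar_op_mult)
qed

lemma has_cderiv_on_scalar_compose:
  assumes "\<And>z. z \<in> S \<Longrightarrow> (f has_field_derivative f' z) (at z)" "has_cderiv_on S G g"
  shows "has_cderiv_on S (\<lambda>z. \<sigma> (f z) o\<^sub>L G z) (\<lambda>z. (\<sigma> (f' z) o\<^sub>L G z) + (\<sigma> (f z) o\<^sub>L g z))"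
  unfolding has_cderiv_on_def
proof (intro allI impI ballI)
  fix p q :: complex and t :: real
  assume "closed_segment p q \<subseteq> S" and "t \<in> {0..1}"
  then have d: "((\<lambda>t. \<sigma> (f (linepath p q t))) has_vector_derivative
      (\<sigma> (q - p) o\<^sub>L \<sigma> (f' (linepath p q t)))) (at t within {0..1})"
    "((\<lambda>t. G (linepath p q t)) has_vector_derivative (\<sigma> (q - p) o\<^sub>L g (linepath p q t))) (at t within {0..1})"
    using has_cderiv_on_scalar[OF assms(1)] assms(2) unfolding has_cderiv_on_def by blast+
  have *: "\<sigma> (f (linepath p q t)) o\<^sub>L (\<sigma> (q - p) o\<^sub>L X) = \<sigma> (q - p) o\<^sub>L (\<sigma> (f (linepath p q t)) o\<^sub>L X)" for X
    by (metis blinfun_compose_assoc scalar_op_scalar_op_commute)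
  from has_vector_derivative_compose[OF d]
  show "((\<lambda>t. \<sigma> (f (linepath p q t)) o\<^sub>L G (linepath p q t)) has_vector_derivative
      (\<sigma> (q - p) o\<^sub>L ((\<sigma> (f' (linepath p q t)) o\<^sub>L G (linepath p q t)) +
        (\<sigma> (f (linepath p q t)) o\<^sub>L g (linepath p q t))))) (at t within {0..1})"
    by (simp add: blinfun_compose_simps blinfun_compose_assoc * add.commute)
qed

text \<open>A linear change of parameter from [u, v] to [0, 1]. The path is prescribed on the open
  interval only: at the corners its derivative is uncontrolled, and two points do not affect the
  integral.\<close>

lemma contour_piece:
  assumes uv: "u < v" "{u..v} \<subseteq> {0..1}"
    and \<gamma>: "\<And>t. t \<in> {u<..<v} \<Longrightarrow> \<gamma> t = linepath p q ((t - u) / (v - u))"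
    and F: "continuous_on (closed_segment p q) F"
  shows "((\<lambda>t. \<sigma> (vector_derivative \<gamma> (at t within {0..1})) o\<^sub>L F (\<gamma> t)) has_integral edge p q F) {u..v}"
proof -
  let ?I = "integral {0..1} (\<lambda>t. F (linepath p q t))"
  define m where "m = 1 / (v - u)"
  have m: "m > 0" using uv by (simp add: m_def)
  have lim: "(0 - - u * m) /\<^sub>R m = u" "(1 - - u * m) /\<^sub>R m = v"
    using m uv by (simp_all add: m_def field_simps)
  have "((\<lambda>t. F (linepath p q t)) has_integral ?I) {0..1}"
    using integrable_linepath[OF F] by blast
  then have "((\<lambda>t. F (linepath p q t)) has_integral ?I) (cbox 0 1)" by simp
  from has_integral_affinity'[OF this m, of "- u * m"]
  have "((\<lambda>t. F (linepath p q (m * t + - u * m))) has_integral (?I /\<^sub>R m)) {u..v}"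
    unfolding lim by simp
  from has_integral_linear[OF this bounded_linear_compose_left[of "\<sigma> (m *\<^sub>R (q - p))"]]
  have "((\<lambda>t. \<sigma> (m *\<^sub>R (q - p)) o\<^sub>L F (linepath p q (m * t + - u * m))) has_integral edge p q F) {u..v}"
    using m unfolding edge_def scalar_op_scaleR o_def by (simp add: blinfun_compose_simps)
  then show ?thesis
  proof (rule has_integral_spike_finite[of "{u, v}", rotated 2])
    fix t assume "t \<in> {u..v} - {u, v}"
    then have t: "t \<in> {u<..<v}" by auto
    have eq: "(\<lambda>t. linepath p q ((t - u) / (v - u))) = (\<lambda>t. p + (m * (t - u)) *\<^sub>R (q - p))"
      by (simp add: fun_eq_iff linepath_def m_def algebra_simps scaleR_diff_right diff_divide_distrib)
    have "((\<lambda>t. linepath p q ((t - u) / (v - u))) has_vector_derivative (m *\<^sub>R (q - p))) (at t)"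
      unfolding eq by (auto intro!: derivative_eq_intros)
    then have "(\<gamma> has_vector_derivative (m *\<^sub>R (q - p))) (at t)"
      by (rule has_vector_derivative_transform_within_open[of _ _ _ "{u<..<v}"]) (use t \<gamma> in auto)
    then have "vector_derivative \<gamma> (at t within {0..1}) = m *\<^sub>R (q - p)"
      by (rule vector_derivative_at_within_ivl) (use t uv in auto)
    moreover have "(t - u) / (v - u) = m * t + - u * m"
      by (simp add: m_def field_simps diff_divide_distrib)
    ultimately show "(\<sigma> (vector_derivative \<gamma> (at t within {0..1})) o\<^sub>L F (\<gamma> t)) =
        (\<sigma> (m *\<^sub>R (q - p)) o\<^sub>L F (linepath p q (m * t + - u * m)))"
      using \<gamma>[OF t] by simp
  qed simp
qed

text \<open>\<open>+++\<close> halves the parameter interval at each joint and nests to the right,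
  so the corners sit at 1/2, 3/4 and 7/8.\<close>

lemma contour_integral_four_edges:
  assumes F: "continuous_on S F" and "closed_segment a1 a2 \<subseteq> S" "closed_segment a2 a3 \<subseteq> S"
    "closed_segment a3 a4 \<subseteq> S" "closed_segment a4 a1 \<subseteq> S"
  defines "\<gamma> \<equiv> linepath a1 a2 +++ linepath a2 a3 +++ linepath a3 a4 +++ linepath a4 a1"
  shows "integral {0..1} (\<lambda>t. \<sigma> (vector_derivative \<gamma> (at t within {0..1})) o\<^sub>L F (\<gamma> t)) =
    edge a1 a2 F + edge a2 a3 F + edge a3 a4 F + edge a4 a1 F"
proof -
  note sub = assms(2-5)[THEN continuous_on_subset[OF F]]
  let ?f = "\<lambda>t. \<sigma> (vector_derivative \<gamma> (at t within {0..1})) o\<^sub>L F (\<gamma> t)"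
  have "(?f has_integral edge a1 a2 F) {0..1/2}"
    by (rule contour_piece[OF _ _ _ sub(1)]) (auto simp: \<gamma>_def joinpaths_def mult.commute)
  moreover have "(?f has_integral edge a2 a3 F) {1/2..3/4}"
    by (rule contour_piece[OF _ _ _ sub(2)]) (auto simp: \<gamma>_def joinpaths_def algebra_simps)
  moreover have "(?f has_integral edge a3 a4 F) {3/4..7/8}"
    by (rule contour_piece[OF _ _ _ sub(3)]) (auto simp: \<gamma>_def joinpaths_def algebra_simps)
  moreover have "(?f has_integral edge a4 a1 F) {7/8..1}"
    by (rule contour_piece[OF _ _ _ sub(4)]) (auto simp: \<gamma>_def joinpaths_def algebra_simps)
  ultimately have "(?f has_integral (edge a1 a2 F + (edge a2 a3 F + (edge a3 a4 F + edge a4 a1 F)))) {0..1}"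
    by (intro has_integral_combine[of 0 "1/2" 1] has_integral_combine[of "1/2" "3/4" 1]
        has_integral_combine[of "3/4" "7/8" 1]) auto
  then show ?thesis by (simp add: integral_unique add.assoc)
qed

subsection \<open>Resolvents\<close>

context
  fixes T :: "'a \<Rightarrow>\<^sub>L 'a"
  assumes T_J: "T o\<^sub>L J = J o\<^sub>L T"
begin

abbreviation R :: "complex \<Rightarrow> ('a \<Rightarrow>\<^sub>L 'a)" where "R \<equiv> resolvent s T"

abbreviation \<rho> :: "complex set" where "\<rho> \<equiv> - spectrum s T"

text \<open>The definite description is legitimate because two-sided inverses are unique.\<close>

lemma resolvent_left: "z \<in> \<rho> \<Longrightarrow> R z o\<^sub>L (\<sigma> z - T) = id_blinfun"
  and resolvent_right: "z \<in> \<rho> \<Longrightarrow> (\<sigma> z - T) o\<^sub>L R z = id_blinfun"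
proof -
  assume "z \<in> \<rho>"
  then obtain Y where Y: "Y o\<^sub>L (\<sigma> z - T) = id_blinfun" "(\<sigma> z - T) o\<^sub>L Y = id_blinfun"
    unfolding spectrum_def by auto
  have "R z o\<^sub>L (\<sigma> z - T) = id_blinfun \<and> (\<sigma> z - T) o\<^sub>L R z = id_blinfun"
    unfolding resolvent_def
  proof (rule theI)
    fix Y' assume Y': "Y' o\<^sub>L (\<sigma> z - T) = id_blinfun \<and> (\<sigma> z - T) o\<^sub>L Y' = id_blinfun"
    have "Y' = Y' o\<^sub>L ((\<sigma> z - T) o\<^sub>L Y)" by (simp add: Y)
    also have "\<dots> = Y" using Y' by (simp flip: blinfun_compose_assoc)
    finally show "Y' = Y" .
  qed (use Y in blast)
  then show "R z o\<^sub>L (\<sigma> z - T) = id_blinfun" "(\<sigma> z - T) o\<^sub>L R z = id_blinfun" by auto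
qed

lemma resolvent_unique:
  assumes "z \<in> \<rho>" "(\<sigma> z - T) o\<^sub>L Y = id_blinfun"
  shows "R z = Y"
proof -
  have "R z = R z o\<^sub>L ((\<sigma> z - T) o\<^sub>L Y)" by (simp add: assms)
  also have "\<dots> = Y" using resolvent_left[OF assms(1)] by (simp flip: blinfun_compose_assoc)
  finally show ?thesis .
qed

lemma resolvent_commute:
  assumes z: "z \<in> \<rho>" and C: "C o\<^sub>L J = J o\<^sub>L C" "C o\<^sub>L T = T o\<^sub>L C"
  shows "C o\<^sub>L R z = R z o\<^sub>L C"
proof -
  have "C o\<^sub>L (\<sigma> z - T) = (\<sigma> z - T) o\<^sub>L C"
    using C scalar_op_commute[OF C(1)] by (simp add: blinfun_compose_simps)
  then have "(R z o\<^sub>L (C o\<^sub>L (\<sigma> z - T))) o\<^sub>L R z = (R z o\<^sub>L ((\<sigma> z - T) o\<^sub>L C)) o\<^sub>L R z" by simp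
  then have "(R z o\<^sub>L C) o\<^sub>L ((\<sigma> z - T) o\<^sub>L R z) = (R z o\<^sub>L (\<sigma> z - T)) o\<^sub>L (C o\<^sub>L R z)"
    by (simp only: blinfun_compose_assoc)
  then show ?thesis by (simp add: resolvent_left[OF z] resolvent_right[OF z])
qed

lemma scalar_op_resolvent: "z \<in> \<rho> \<Longrightarrow> \<sigma> z o\<^sub>L R z = id_blinfun + (T o\<^sub>L R z)"
  using resolvent_right[of z] by (simp add: blinfun_compose_simps algebra_simps)

text \<open>The first resolvent identity, from inserting the two inverses on opposite sides.\<close>

lemma resolvent_diff:
  assumes "z \<in> \<rho>" "w \<in> \<rho>"
  shows "R w - R z = R w o\<^sub>L (\<sigma> (z - w) o\<^sub>L R z)"
proof -
  have "R w - R z = (R w o\<^sub>L ((\<sigma> z - T) o\<^sub>L R z)) - ((R w o\<^sub>L (\<sigma> w - T)) o\<^sub>L R z)"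
    by (simp add: resolvent_left[OF assms(2)] resolvent_right[OF assms(1)])
  then show ?thesis by (simp add: blinfun_compose_simps blinfun_compose_assoc scalar_op_diff)
qed

text \<open>The resolvent identity bounds the difference by norm (R w) times c |z - w|. As soon as c
  |z - w| is below 1/2, this forces norm (R w) to be at most 2 norm (R z), and the difference tends
  to 0 with |z - w|.\<close>

lemma continuous_on_resolvent: "continuous_on \<rho> R"
  unfolding continuous_on_def
proof
  fix z assume z: "z \<in> \<rho>"
  define c where "c = \<kappa> * norm (R z)"
  have c0: "c \<ge> 0" using kappa_ge_1 by (simp add: c_def)
  have le: "norm (R w - R z) \<le> norm (R w) * (c * cmod (z - w))" if w: "w \<in> \<rho>" for w
  proof -
    have "norm (R w - R z) \<le> norm (R w) * (norm (\<sigma> (z - w)) * norm (R z))"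
      unfolding resolvent_diff[OF z w]
      by (rule order_trans[OF norm_blinfun_compose]) (intro mult_left_mono norm_blinfun_compose norm_ge_zero)
    also have "\<dots> \<le> norm (R w) * (\<kappa> * cmod (z - w) * norm (R z))"
      by (intro mult_left_mono mult_right_mono norm_scalar_op_le norm_ge_zero)
    finally show ?thesis by (simp add: c_def algebra_simps)
  qed
  have lim: "((\<lambda>w. c * cmod (z - w)) \<longlongrightarrow> 0) (at z within \<rho>)"
    by (rule tendsto_eq_intros refl)+ simp
  have half: "0 < (1/2 :: real)" by simp
  have "\<forall>\<^sub>F w in at z within \<rho>. norm (R w - R z) \<le> 2 * norm (R z) * (c * cmod (z - w))"
    using order_tendstoD(2)[OF lim half] eventually_in_at_within
  proof eventually_elim
    case (elim w)
    have "norm (R w) \<le> norm (R z) + norm (R w) * (c * cmod (z - w))"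
      using norm_triangle_sub[of "R w" "R z"] le[of w] elim by linarith
    moreover have "norm (R w) * (c * cmod (z - w)) \<le> norm (R w) * (1/2)"
      using elim by (intro mult_left_mono) auto
    ultimately have "norm (R w) \<le> 2 * norm (R z)" by simp
    then have "norm (R w) * (c * cmod (z - w)) \<le> 2 * norm (R z) * (c * cmod (z - w))"
      using c0 by (intro mult_right_mono) auto
    then show ?case using le[of w] elim by linarith
  qed
  moreover have "((\<lambda>w. 2 * norm (R z) * (c * cmod (z - w))) \<longlongrightarrow> 0) (at z within \<rho>)"
    using tendsto_mult_right_zero[OF lim] by simp
  ultimately have "((\<lambda>w. R w - R z) \<longlongrightarrow> 0) (at z within \<rho>)"
    by (rule Lim_null_comparison)
  then show "(R \<longlongrightarrow> R z) (at z within \<rho>)"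
    by (rule LIM_zero_cancel)
qed

lemma has_cderiv_on_resolvent: "has_cderiv_on \<rho> R (\<lambda>z. - (R z o\<^sub>L R z))"
  unfolding has_cderiv_on_def
proof (intro allI impI ballI)
  fix p q :: complex and t :: real
  assume pq: "closed_segment p q \<subseteq> \<rho>" and t: "t \<in> {0..1}"
  let ?l = "linepath p q"
  have l: "?l u \<in> \<rho>" if "u \<in> {0..1}" for u using pq that linepath_in_path by blast
  define g where "g = (\<lambda>u. R (?l u) o\<^sub>L (\<sigma> (p - q) o\<^sub>L R (?l t)))"
  have "((\<lambda>t. R (?l t)) has_vector_derivative g t) (at t within {0..1})"
  proof (rule has_vector_derivative_of_difference_quotient)
    fix u :: real assume u: "u \<in> {0..1}"
    have "?l t - ?l u = (u - t) *\<^sub>R (p - q)" by (simp add: linepath_def algebra_simps)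
    then show "R (?l u) - R (?l t) = (u - t) *\<^sub>R g u"
      unfolding resolvent_diff[OF l[OF t] l[OF u]] g_def
      by (simp add: scalar_op_scaleR blinfun_compose_simps)
  next
    have "continuous_on {0..1} (\<lambda>u. R (?l u))"
      by (rule continuous_on_linepath_compose) (rule continuous_on_subset[OF continuous_on_resolvent pq])
    then have "((\<lambda>u. R (?l u)) \<longlongrightarrow> R (?l t)) (at t within {0..1})"
      using t by (simp add: continuous_on_def)
    then show "(g \<longlongrightarrow> g t) (at t within {0..1})"
      unfolding g_def by (intro bounded_bilinear.tendsto[OF bounded_bilinear_blinfun_compose] tendsto_const)
  qed
  moreover have "g t = \<sigma> (q - p) o\<^sub>L - (R (?l t) o\<^sub>L R (?l t))"
  proof -
    have "R (?l t) o\<^sub>L \<sigma> (p - q) = \<sigma> (p - q) o\<^sub>L R (?l t)"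
      using resolvent_commute[OF l[OF t], of "\<sigma> (p - q)"] scalar_op_commute[OF T_J]
        scalar_op_commute[of J] by simp
    then have "g t = \<sigma> (p - q) o\<^sub>L (R (?l t) o\<^sub>L R (?l t))"
      unfolding g_def by (simp only: blinfun_compose_assoc[symmetric])
    then show ?thesis
      by (simp add: blinfun_compose_simps scalar_op_diff)
  qed
  ultimately show "((\<lambda>t. R (?l t)) has_vector_derivative (\<sigma> (q - p) o\<^sub>L - (R (?l t) o\<^sub>L R (?l t))))
      (at t within {0..1})"
    by simp
qed

end

end

subsection \<open>The Riesz projector of the left half plane\<close>

lemma norm_bounded_on_compact:
  assumes "compact S" "continuous_on S f"
  obtains b where "\<And>z. z \<in> S \<Longrightarrow> norm (f z) \<le> b"
  using compact_imp_bounded[OF compact_continuous_image[OF assms(2,1)]]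
  unfolding bounded_iff by auto

section \<open>Powers of an operator and the Neumann series\<close>

primrec op_power :: "('a::real_normed_vector \<Rightarrow>\<^sub>L 'a) \<Rightarrow> nat \<Rightarrow> ('a \<Rightarrow>\<^sub>L 'a)" where
  "op_power T 0 = id_blinfun"
| "op_power T (Suc n) = T o\<^sub>L op_power T n"

lemma norm_op_power_le: "norm (op_power T n) \<le> norm T ^ n"
proof (induction n)
  case 0 then show ?case by (simp add: norm_blinfun_id_le)
next
  case (Suc n)
  have "norm (op_power T (Suc n)) \<le> norm T * norm (op_power T n)"
    by (simp add: norm_blinfun_compose)
  also have "\<dots> \<le> norm T * norm T ^ n" using Suc by (intro mult_left_mono) auto
  finally show ?case by simp
qed

lemma op_power_commute:
  assumes "C o\<^sub>L T = T o\<^sub>L C"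
  shows "C o\<^sub>L op_power T n = op_power T n o\<^sub>L C"
proof (induction n)
  case (Suc n)
  have "C o\<^sub>L (T o\<^sub>L op_power T n) = T o\<^sub>L (C o\<^sub>L op_power T n)"
    by (simp flip: blinfun_compose_assoc add: assms)
  then show ?case using Suc by (simp add: blinfun_compose_assoc)
qed simp

text \<open>Neumann series: the terms are z^-(n+1) T^n, and multiplying by z - T makes the series
  telescope from the identity to 0.\<close>

lemma (in complex_structure) not_in_spectrum_of_norm_less:
  assumes T_J: "T o\<^sub>L J = J o\<^sub>L T" and z: "norm T < cmod z"
  shows "z \<notin> spectrum s T"
proof -
  have "z \<noteq> 0" using z norm_ge_zero[of T] by auto
  define u where "u = inverse z"
  define f where "f = (\<lambda>n. \<sigma> (u ^ Suc n) o\<^sub>L op_power T n)"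
  define g where "g = (\<lambda>n. \<sigma> (u ^ n) o\<^sub>L op_power T n)"
  define q where "q = cmod u * norm T"
  have q: "0 \<le> q" "q < 1"
  proof -
    have "cmod u = inverse (cmod z)" by (simp add: u_def norm_inverse)
    moreover have "cmod z > 0" using \<open>z \<noteq> 0\<close> by simp
    ultimately show "0 \<le> q" "q < 1" using z by (simp_all add: q_def divide_less_eq flip: divide_inverse_commute)
  qed
  \<comment> \<open>All powers of \<open>u\<close> are collected in one scalar before estimating, so
    \<kappa> enters once and not with exponent n; otherwise the series would converge only for
    larger |z|. The cases \<open>k = 1\<close> and \<open>k = 0\<close> give summability of
    \<open>f\<close> and the limit of \<open>g\<close>.\<close>
  have g_le: "norm (\<sigma> (u ^ (k + n)) o\<^sub>L op_power T n) \<le> \<kappa> * cmod u ^ k * q ^ n" for n k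
  proof -
    have "norm (\<sigma> (u ^ (k + n)) o\<^sub>L op_power T n) \<le> (\<kappa> * cmod (u ^ (k + n))) * norm T ^ n"
      using kappa_ge_1 by (intro order_trans[OF norm_blinfun_compose] mult_mono norm_scalar_op_le norm_op_power_le) auto
    then show ?thesis by (simp add: q_def power_add norm_mult norm_power power_mult_distrib algebra_simps)
  qed
  have "summable f"
    unfolding f_def
  proof (rule summable_comparison_test')
    show "summable (\<lambda>n. \<kappa> * cmod u ^ 1 * q ^ n)"
      using q by (intro summable_mult summable_geometric) simp
    show "norm (\<sigma> (u ^ Suc n) o\<^sub>L op_power T n) \<le> \<kappa> * cmod u ^ 1 * q ^ n" if "n \<ge> 0" for n
      using g_le[of 1 n] by simp
  qed
  then have f: "f sums suminf f" by (rule summable_sums)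
  have "(\<lambda>n. \<kappa> * q ^ n) \<longlonglongrightarrow> \<kappa> * 0"
    using q by (intro tendsto_mult tendsto_const LIMSEQ_power_zero) simp
  then have "g \<longlonglongrightarrow> 0"
    by (intro Lim_null_comparison[of g "\<lambda>n. \<kappa> * q ^ n"]) (use g_le[of 0] in \<open>auto simp: g_def\<close>)
  from telescope_sums'[OF this] have tel: "(\<lambda>n. g n - g (Suc n)) sums id_blinfun"
    by (simp add: g_def)
  have u_Suc: "z * u ^ Suc n = u ^ n" for n using \<open>z \<noteq> 0\<close> by (simp add: u_def)
  have left: "(\<sigma> z - T) o\<^sub>L f n = g n - g (Suc n)" for n
  proof -
    have "\<sigma> z o\<^sub>L f n = g n"
      unfolding f_def g_def by (simp only: u_Suc flip: scalar_op_mult blinfun_compose_assoc)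
    moreover have "T o\<^sub>L f n = g (Suc n)"
      unfolding f_def g_def op_power.simps
      by (simp only: scalar_op_commute[OF T_J] flip: blinfun_compose_assoc)
    ultimately show ?thesis by (simp add: blinfun_compose_simps)
  qed
  have right: "f n o\<^sub>L (\<sigma> z - T) = (\<sigma> z - T) o\<^sub>L f n" for n
  proof -
    have C: "(\<sigma> z - T) o\<^sub>L T = T o\<^sub>L (\<sigma> z - T)" "(\<sigma> z - T) o\<^sub>L J = J o\<^sub>L (\<sigma> z - T)"
      using scalar_op_commute[OF T_J] scalar_op_commute[of J] T_J by (simp_all add: blinfun_compose_simps)
    show ?thesis
      unfolding f_def
      by (simp only: blinfun_compose_assoc op_power_commute[OF C(1), symmetric])
        (simp only: scalar_op_commute[OF C(2)] flip: blinfun_compose_assoc)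
  qed
  have "(\<sigma> z - T) o\<^sub>L suminf f = id_blinfun"
    using bounded_linear.sums[OF bounded_linear_compose_left f, of "\<sigma> z - T"] tel
    unfolding left by (rule sums_unique2)
  moreover have "suminf f o\<^sub>L (\<sigma> z - T) = id_blinfun"
    using bounded_linear.sums[OF bounded_linear_compose_right f, of "\<sigma> z - T"] tel
    unfolding right left by (rule sums_unique2)
  ultimately show ?thesis unfolding spectrum_def by blast
qed

locale hyperbolic_operator = complex_structure J s
  for J :: "'a::banach \<Rightarrow>\<^sub>L 'a" and s :: "complex \<Rightarrow> 'a \<Rightarrow> 'a" +
  fixes T :: "'a \<Rightarrow>\<^sub>L 'a"
  assumes T_J: "T o\<^sub>L J = J o\<^sub>L T"
    and hyperbolic: "spectrum s T \<inter> {z. Re z = 0} = {}"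
begin

section \<open>The rectangle around the left part of the spectrum\<close>

abbreviation Res :: "complex \<Rightarrow> ('a \<Rightarrow>\<^sub>L 'a)" where "Res \<equiv> resolvent s T"

definition r :: real where "r = norm T + 1"

lemma r_pos: "r > 0"
  by (simp add: r_def add_nonneg_pos)

definition "a1 = Complex (- r) (- r)"
definition "a2 = Complex 0 (- r)"
definition "a3 = Complex 0 r"
definition "a4 = Complex (- r) r"

definition outer :: "complex set" where
  "outer = closed_segment a3 a4 \<union> closed_segment a4 a1 \<union> closed_segment a1 a2"

definition contour :: "complex set" where
  "contour = outer \<union> closed_segment a2 a3"

text \<open>The three edges off the axis lie outside the disc of radius norm T, so both z and - z
  are regular points there. They also avoid the nonnegative real axis, which makes
  \<open>Ln (- z)\<close> a holomorphic branch along them.\<close>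

lemma outer_props:
  assumes "z \<in> outer"
  shows "r \<le> cmod z" "- z \<notin> \<real>\<^sub>\<le>\<^sub>0" "Re z \<le> 0"
proof -
  have *: "\<exists>u. 0 \<le> u \<and> u \<le> 1 \<and>
      (Re z = (1 - u) * 0 + u * - r \<and> Im z = r \<or> Re z = - r \<or> Im z = - r \<and> Re z = (1 - u) * - r + u * 0)"
    using assms unfolding outer_def in_segment Un_iff a1_def a2_def a3_def a4_def
    by (auto simp: complex_eq_iff algebra_simps)
  then obtain u where "0 \<le> u" "u \<le> 1" and
    "Re z = (1 - u) * 0 + u * - r \<and> Im z = r \<or> Re z = - r \<or> Im z = - r \<and> Re z = (1 - u) * - r + u * 0"
    by metis
  then have u: "0 \<le> u" "u \<le> 1"
    "Re z = - (u * r) \<and> Im z = r \<or> Re z = - r \<or> Im z = - r \<and> Re z = - ((1 - u) * r)"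
    by auto
  have "r \<le> \<bar>Re z\<bar> \<or> r \<le> \<bar>Im z\<bar>" using u r_pos by auto
  then show "r \<le> cmod z"
    using abs_Re_le_cmod[of z] abs_Im_le_cmod[of z] by linarith
  show "Re z \<le> 0" using u r_pos by (auto simp: mult_nonneg_nonneg)
  show "- z \<notin> \<real>\<^sub>\<le>\<^sub>0" using u r_pos by (auto simp: complex_nonpos_Reals_iff)
qed

lemma axis_props: "z \<in> closed_segment a2 a3 \<Longrightarrow> Re z = 0"
  unfolding in_segment a2_def a3_def by auto

lemma contour_Re: "z \<in> contour \<Longrightarrow> Re z \<le> 0"
  unfolding contour_def using outer_props axis_props by fastforce

lemma outer_resolvent: "z \<in> outer \<Longrightarrow> z \<in> - spectrum s T"
  using outer_props(1)[of z] not_in_spectrum_of_norm_less[OF T_J, of z] by (simp add: r_def)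

lemma outer_resolvent_minus: "z \<in> outer \<Longrightarrow> - z \<in> - spectrum s T"
  using outer_props(1)[of z] not_in_spectrum_of_norm_less[OF T_J, of "- z"] by (simp add: r_def)

lemma axis_resolvent: "Re z = 0 \<Longrightarrow> z \<in> - spectrum s T"
  using hyperbolic by auto

lemma contour_resolvent: "contour \<subseteq> - spectrum s T"
  unfolding contour_def using outer_resolvent axis_props axis_resolvent by fast

lemma contour_edges:
  "closed_segment a1 a2 \<subseteq> contour" "closed_segment a2 a3 \<subseteq> contour"
  "closed_segment a3 a4 \<subseteq> contour" "closed_segment a4 a1 \<subseteq> contour"
  by (auto simp: contour_def outer_def)

lemma outer_edges:
  "closed_segment a1 a2 \<subseteq> outer" "closed_segment a3 a4 \<subseteq> outer" "closed_segment a4 a1 \<subseteq> outer"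
  by (auto simp: outer_def)

definition arc :: "(complex \<Rightarrow> ('a \<Rightarrow>\<^sub>L 'a)) \<Rightarrow> ('a \<Rightarrow>\<^sub>L 'a)" where
  "arc F = edge a3 a4 F + edge a4 a1 F + edge a1 a2 F"

definition loop :: "(complex \<Rightarrow> ('a \<Rightarrow>\<^sub>L 'a)) \<Rightarrow> ('a \<Rightarrow>\<^sub>L 'a)" where
  "loop F = arc F + edge a2 a3 F"

definition len :: real where
  "len = cmod (a4 - a3) + cmod (a1 - a4) + cmod (a2 - a1) + cmod (a3 - a2)"

lemma arc_cong: "(\<And>z. z \<in> outer \<Longrightarrow> F z = G z) \<Longrightarrow> arc F = arc G"
  unfolding arc_def using outer_edges by (auto intro!: arg_cong2[where f = plus] edge_cong)

lemma loop_cong: "(\<And>z. z \<in> contour \<Longrightarrow> F z = G z) \<Longrightarrow> loop F = loop G"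
  unfolding loop_def using contour_edges(2)
  by (auto intro!: arg_cong2[where f = plus] edge_cong arc_cong simp: contour_def)

lemma arc_add:
  assumes "continuous_on outer F" "continuous_on outer G"
  shows "arc (\<lambda>z. F z + G z) = arc F + arc G"
  unfolding arc_def
  by (simp add: edge_add[OF continuous_on_subset[OF assms(1)] continuous_on_subset[OF assms(2)]] outer_edges)

lemma loop_add:
  assumes "continuous_on contour F" "continuous_on contour G"
  shows "loop (\<lambda>z. F z + G z) = loop F + loop G"
  unfolding loop_def arc_def
  by (simp add: edge_add[OF continuous_on_subset[OF assms(1)] continuous_on_subset[OF assms(2)]] contour_edges)

lemma arc_scaleR: "arc (\<lambda>z. c *\<^sub>R F z) = c *\<^sub>R arc F"
  unfolding arc_def by (simp add: edge_scaleR scaleR_add_right)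

lemma loop_scaleR: "loop (\<lambda>z. c *\<^sub>R F z) = c *\<^sub>R loop F"
  unfolding loop_def arc_def by (simp add: edge_scaleR scaleR_add_right)

lemma loop_minus: "loop (\<lambda>z. - F z) = - loop F"
  unfolding loop_def arc_def by (simp add: edge_minus)

lemma loop_compose_left:
  assumes "continuous_on contour F" "C o\<^sub>L J = J o\<^sub>L C"
  shows "loop (\<lambda>z. C o\<^sub>L F z) = C o\<^sub>L loop F"
  unfolding loop_def arc_def
  by (simp add: edge_compose_left[OF continuous_on_subset[OF assms(1)] assms(2)] contour_edges blinfun_compose_simps)

lemma loop_compose_right:
  assumes "continuous_on contour F"
  shows "loop (\<lambda>z. F z o\<^sub>L C) = loop F o\<^sub>L C"
  unfolding loop_def arc_def
  by (simp add: edge_compose_right[OF continuous_on_subset[OF assms(1)]] contour_edges blinfun_compose_simps)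

lemma arc_compose_right:
  assumes "continuous_on outer F"
  shows "arc (\<lambda>z. F z o\<^sub>L C) = arc F o\<^sub>L C"
  unfolding arc_def
  by (simp add: edge_compose_right[OF continuous_on_subset[OF assms(1)]] outer_edges blinfun_compose_simps)

lemma norm_arc_le:
  assumes F: "continuous_on outer F" and B: "\<And>z. z \<in> outer \<Longrightarrow> norm (F z) \<le> B"
  shows "norm (arc F) \<le> \<kappa> * len * B"
proof -
  have e: "norm (edge p q F) \<le> \<kappa> * cmod (q - p) * B" if "closed_segment p q \<subseteq> outer" for p q
    using that by (intro norm_edge_le continuous_on_subset[OF F] B) auto
  \<comment> \<open>\<open>len\<close> is the length of the whole rectangle, so the missing fourth
    edge is added to the bound; this needs \<open>B\<close> to be nonnegative.\<close>
  have "0 \<le> B" using B[of a3] norm_ge_zero[of "F a3"] unfolding outer_def by (meson UnI1 ends_in_segment(1) order_trans)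
  then have "0 \<le> \<kappa> * cmod (a3 - a2) * B" using kappa_ge_1 by simp
  moreover have "norm (arc F) \<le> norm (edge a3 a4 F) + norm (edge a4 a1 F) + norm (edge a1 a2 F)"
    unfolding arc_def by norm
  ultimately show ?thesis
    using e[OF outer_edges(1)] e[OF outer_edges(2)] e[OF outer_edges(3)]
    unfolding len_def by (simp add: algebra_simps)
qed

lemma norm_loop_le:
  assumes F: "continuous_on contour F" and B: "\<And>z. z \<in> contour \<Longrightarrow> norm (F z) \<le> B"
  shows "norm (loop F) \<le> \<kappa> * len * B"
proof -
  have e: "norm (edge p q F) \<le> \<kappa> * cmod (q - p) * B" if "closed_segment p q \<subseteq> contour" for p q
    using that by (intro norm_edge_le continuous_on_subset[OF F] B) auto
  have "norm (loop F) \<le> norm (edge a3 a4 F) + norm (edge a4 a1 F) + norm (edge a1 a2 F) + norm (edge a2 a3 F)"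
    unfolding loop_def arc_def by norm
  then show ?thesis
    using e[OF contour_edges(1)] e[OF contour_edges(2)] e[OF contour_edges(3)] e[OF contour_edges(4)]
    unfolding len_def by (simp add: algebra_simps)
qed

lemma arc_cderiv:
  assumes "has_cderiv_on S G g" "outer \<subseteq> S" "continuous_on S g"
  shows "arc g = G a2 - G a3"
  unfolding arc_def using outer_edges assms(2)
  by (simp add: edge_cderiv[OF assms(1) _ assms(3)] subset_trans)

lemma loop_cderiv:
  assumes "has_cderiv_on S G g" "contour \<subseteq> S" "continuous_on S g"
  shows "loop g = 0"
  unfolding loop_def arc_def using contour_edges assms(2)
  by (simp add: edge_cderiv[OF assms(1) _ assms(3)] subset_trans)

lemma continuous_on_scalar_op: "continuous_on S f \<Longrightarrow> continuous_on S (\<lambda>z. \<sigma> (f z))"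
  by (rule bounded_linear.continuous_on[OF bounded_linear_scalar_op])

lemma continuous_on_compose_op:
  fixes f :: "'b::topological_space \<Rightarrow> 'a \<Rightarrow>\<^sub>L 'a"
  shows "continuous_on S f \<Longrightarrow> continuous_on S g \<Longrightarrow> continuous_on S (\<lambda>z. f z o\<^sub>L g z)"
  by (rule bounded_bilinear.continuous_on[OF bounded_bilinear_blinfun_compose])

lemmas continuous_on_ops = continuous_on_scalar_op continuous_on_compose_op
  continuous_on_resolvent[OF T_J] continuous_on_subset[OF continuous_on_resolvent[OF T_J] contour_resolvent]

lemma compact_contour: "compact contour"
  unfolding contour_def outer_def by (intro compact_Un compact_segment)

lemma compact_outer: "compact outer"
  unfolding outer_def by (intro compact_Un compact_segment)

lemma neg_projector_eq: "neg_projector s T = \<sigma> (1 / (2 * of_real pi * \<i>)) o\<^sub>L loop Res"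
proof -
  have "rectpath (Complex (- r) (- r)) (Complex 0 r) =
      linepath a1 a2 +++ linepath a2 a3 +++ linepath a3 a4 +++ linepath a4 a1"
    by (simp add: rectpath_def Let_def a1_def a2_def a3_def a4_def)
  then show ?thesis
    using contour_integral_four_edges[OF continuous_on_resolvent[OF T_J], of a1 a2 a3 a4]
      contour_edges contour_resolvent
    unfolding neg_projector_def Let_def loop_def arc_def r_def by (simp add: add.commute add.left_commute)
qed

lemma loop_resolvent_commute:
  assumes C: "C o\<^sub>L J = J o\<^sub>L C" "C o\<^sub>L T = T o\<^sub>L C"
  shows "C o\<^sub>L loop Res = loop Res o\<^sub>L C"
proof -
  have "loop (\<lambda>z. C o\<^sub>L Res z) = loop (\<lambda>z. Res z o\<^sub>L C)"
    using contour_resolvent resolvent_commute[OF T_J _ C] by (intro loop_cong) auto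
  then show ?thesis
    using loop_compose_left[OF _ C(1), of Res] loop_compose_right[of Res C] continuous_on_ops by simp
qed

lemma neg_projector_commute:
  assumes C: "C o\<^sub>L J = J o\<^sub>L C" "C o\<^sub>L T = T o\<^sub>L C"
  shows "C o\<^sub>L neg_projector s T = neg_projector s T o\<^sub>L C"
  unfolding neg_projector_eq
  by (metis blinfun_compose_assoc loop_resolvent_commute[OF C] scalar_op_commute[OF C(1)])

text \<open>Up to the factor 1/(2 pi i), the Dunford integral for exp (t T) composed with the Riesz
  projector.\<close>

definition semigroup_loop :: "real \<Rightarrow> ('a \<Rightarrow>\<^sub>L 'a)" where
  "semigroup_loop t = loop (\<lambda>z. \<sigma> (exp (of_real t * z)) o\<^sub>L Res z)"

lemma edge_exp_deriv:
  assumes F: "continuous_on (closed_segment p q) F"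
  shows "((\<lambda>t. edge p q (\<lambda>z. \<sigma> (exp (of_real t * z)) o\<^sub>L F z)) has_vector_derivative
    edge p q (\<lambda>z. \<sigma> (z * exp (of_real t * z)) o\<^sub>L F z)) (at t)"
proof -
  let ?l = "linepath p q"
  have Fl: "continuous_on {0..1} (\<lambda>u. F (?l u))"
    by (rule continuous_on_linepath_compose[OF F])
  have "((\<lambda>t. integral (cbox 0 1) (\<lambda>u. \<sigma> (exp (of_real t * ?l u)) o\<^sub>L F (?l u))) has_vector_derivative
      integral (cbox 0 1) (\<lambda>u. \<sigma> (?l u * exp (of_real t * ?l u)) o\<^sub>L F (?l u))) (at t within UNIV)"
  proof (rule leibniz_rule_vector_derivative)
    fix x u :: real
    have "((\<lambda>w. exp (w * ?l u)) has_field_derivative (?l u * exp (of_real x * ?l u))) (at (of_real x))"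
      by (auto intro!: derivative_eq_intros)
    then have "((\<lambda>x. exp (of_real x * ?l u)) has_vector_derivative (?l u * exp (of_real x * ?l u))) (at x)"
      by (rule has_vector_derivative_real_field)
    from has_vector_derivative_compose[OF bounded_linear.has_vector_derivative[OF bounded_linear_scalar_op this]
        has_vector_derivative_const[of "F (?l u)"]]
    show "((\<lambda>x. \<sigma> (exp (of_real x * ?l u)) o\<^sub>L F (?l u)) has_vector_derivative
        (\<sigma> (?l u * exp (of_real x * ?l u)) o\<^sub>L F (?l u))) (at x within UNIV)"
      by simp
  next
    fix x :: real
    show "(\<lambda>u. \<sigma> (exp (of_real x * ?l u)) o\<^sub>L F (?l u)) integrable_on cbox 0 1"
      using Fl by (auto intro!: integrable_continuous_real continuous_on_ops continuous_intros)
  next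
    have "continuous_on (UNIV \<times> {0..1}) (\<lambda>y :: real \<times> real. F (?l (snd y)))"
      by (rule continuous_on_compose2[OF Fl]) (auto intro!: continuous_intros)
    then show "continuous_on (UNIV \<times> cbox 0 1)
        (\<lambda>(x, u). \<sigma> (?l u * exp (of_real x * ?l u)) o\<^sub>L F (?l u))"
      unfolding split_beta linepath_def
      by (auto intro!: continuous_on_ops continuous_intros)
  qed auto
  from bounded_linear.has_vector_derivative[OF bounded_linear_compose_left this, of "\<sigma> (q - p)"]
  show ?thesis unfolding edge_def by simp
qed

text \<open>Differentiation produces a factor z, and z R(z) = id + T R(z). The identity term leaves
  the integral of exp (t z) over a closed contour, which vanishes.\<close>

lemma semigroup_loop_deriv:
  "(semigroup_loop has_vector_derivative (T o\<^sub>L semigroup_loop t)) (at t)"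
proof -
  let ?e = "\<lambda>z. exp (of_real t * z)"
  have "(semigroup_loop has_vector_derivative loop (\<lambda>z. \<sigma> (z * ?e z) o\<^sub>L Res z)) (at t)"
    unfolding semigroup_loop_def loop_def arc_def
    by (intro has_vector_derivative_add edge_exp_deriv continuous_on_subset[OF continuous_on_ops(4)] contour_edges)
  also have "loop (\<lambda>z. \<sigma> (z * ?e z) o\<^sub>L Res z) = loop (\<lambda>z. \<sigma> (?e z) + (T o\<^sub>L (\<sigma> (?e z) o\<^sub>L Res z)))"
  proof (rule loop_cong)
    fix z assume "z \<in> contour"
    then have "\<sigma> z o\<^sub>L Res z = id_blinfun + (T o\<^sub>L Res z)"
      using contour_resolvent scalar_op_resolvent[OF T_J] by blast
    then have "\<sigma> (?e z * z) o\<^sub>L Res z = \<sigma> (?e z) o\<^sub>L (id_blinfun + (T o\<^sub>L Res z))"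
      by (simp only: scalar_op_mult blinfun_compose_assoc)
    also have "\<dots> = \<sigma> (?e z) + ((\<sigma> (?e z) o\<^sub>L T) o\<^sub>L Res z)"
      by (simp add: blinfun_compose_simps blinfun_compose_assoc)
    finally show "\<sigma> (z * ?e z) o\<^sub>L Res z = \<sigma> (?e z) + (T o\<^sub>L (\<sigma> (?e z) o\<^sub>L Res z))"
      by (simp only: mult.commute[of z] blinfun_compose_assoc[symmetric] scalar_op_commute[OF T_J])
  qed
  also have "\<dots> = loop (\<lambda>z. \<sigma> (?e z)) + (T o\<^sub>L semigroup_loop t)"
    unfolding semigroup_loop_def
    by (subst loop_add, (intro continuous_on_ops continuous_intros)+,
        subst loop_compose_left[OF _ T_J], (intro continuous_on_ops continuous_intros)+) simp
  also have "loop (\<lambda>z. \<sigma> (?e z)) = 0"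
  proof (cases "t = 0")
    case True
    have "has_cderiv_on UNIV (\<lambda>z. \<sigma> z) (\<lambda>z. \<sigma> 1)"
      by (rule has_cderiv_on_scalar) (auto intro!: derivative_eq_intros)
    from loop_cderiv[OF this] show ?thesis using True by simp
  next
    case False
    have "has_cderiv_on UNIV (\<lambda>z. \<sigma> (?e z / of_real t)) (\<lambda>z. \<sigma> (?e z))"
      by (rule has_cderiv_on_scalar) (use False in \<open>auto intro!: derivative_eq_intros\<close>)
    from loop_cderiv[OF this] show ?thesis by (simp add: continuous_on_ops continuous_intros)
  qed
  finally show ?thesis by simp
qed

lemma semigroup_loop_eq:
  assumes "t \<ge> 0"
  shows "semigroup_loop t = fundamental_solution (\<lambda>_. T) t o\<^sub>L loop Res"
proof -
  have "solves (\<lambda>t Y. T o\<^sub>L Y) semigroup_loop"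
    unfolding solves_def using semigroup_loop_deriv has_vector_derivative_at_within by blast
  from fundamental_solution_unique[OF bounded_path_const this assms]
  show ?thesis by (simp add: semigroup_loop_def)
qed

text \<open>
  Integrating the derivative of \<open>exp (t z) R(z)\<close> along the closed contour trades the factor \<open>t\<close>
  for a second resolvent, so that no edge has to be moved off the imaginary axis.
\<close>

lemma scaleR_semigroup_loop:
  "t *\<^sub>R semigroup_loop t = loop (\<lambda>z. \<sigma> (exp (of_real t * z)) o\<^sub>L (Res z o\<^sub>L Res z))"
proof -
  let ?e = "\<lambda>z. exp (of_real t * z)"
  let ?g = "\<lambda>z. (\<sigma> (of_real t * ?e z) o\<^sub>L Res z) + (\<sigma> (?e z) o\<^sub>L - (Res z o\<^sub>L Res z))"
  have "has_cderiv_on (- spectrum s T) (\<lambda>z. \<sigma> (?e z) o\<^sub>L Res z) ?g"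
    by (rule has_cderiv_on_scalar_compose[OF _ has_cderiv_on_resolvent[OF T_J]])
      (auto intro!: derivative_eq_intros)
  moreover have "continuous_on (- spectrum s T) ?g"
    by (intro continuous_intros continuous_on_ops)
  ultimately have "loop ?g = 0"
    using contour_resolvent by (intro loop_cderiv)
  moreover have "?g = (\<lambda>z. t *\<^sub>R (\<sigma> (?e z) o\<^sub>L Res z) + - (\<sigma> (?e z) o\<^sub>L (Res z o\<^sub>L Res z)))"
    by (simp add: scalar_op_mult scalar_op_of_real blinfun_compose_simps)
  moreover have "loop (\<lambda>z. t *\<^sub>R (\<sigma> (?e z) o\<^sub>L Res z) + - (\<sigma> (?e z) o\<^sub>L (Res z o\<^sub>L Res z))) =
      t *\<^sub>R semigroup_loop t + - loop (\<lambda>z. \<sigma> (?e z) o\<^sub>L (Res z o\<^sub>L Res z))"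
    unfolding semigroup_loop_def
    by (subst loop_add, (intro continuous_intros continuous_on_ops)+) (simp only: loop_scaleR loop_minus)
  ultimately show ?thesis by simp
qed

text \<open>On the contour Re z is at most 0, so |exp (t z)| is at most 1, and after the exchange of
  \<open>t\<close> for a second resolvent the integrand is bounded uniformly in \<open>t\<close>.
  Hence the loop itself is O(1/t).\<close>

lemma semigroup_loop_bound: "\<exists>B. \<forall>t\<ge>0. norm (t *\<^sub>R semigroup_loop t) \<le> B"
proof -
  have "continuous_on contour (\<lambda>z. Res z o\<^sub>L Res z)" by (intro continuous_on_ops)
  then obtain b where b: "\<And>z. z \<in> contour \<Longrightarrow> norm (Res z o\<^sub>L Res z) \<le> b"
    by (rule norm_bounded_on_compact[OF compact_contour]) blast
  have "norm (t *\<^sub>R semigroup_loop t) \<le> \<kappa> * len * (\<kappa> * b)" if t: "t \<ge> 0" for t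
    unfolding scaleR_semigroup_loop
  proof (rule norm_loop_le)
    show "continuous_on contour (\<lambda>z. \<sigma> (exp (of_real t * z)) o\<^sub>L (Res z o\<^sub>L Res z))"
      by (intro continuous_intros continuous_on_ops)
    fix z assume z: "z \<in> contour"
    have "cmod (exp (of_real t * z)) \<le> 1"
      using contour_Re[OF z] t by (simp add: norm_exp_eq_Re mult_nonneg_nonpos)
    then have "norm (\<sigma> (exp (of_real t * z))) \<le> \<kappa> * 1"
      using kappa_ge_1 by (intro order_trans[OF norm_scalar_op_le] mult_left_mono) auto
    then show "norm (\<sigma> (exp (of_real t * z)) o\<^sub>L (Res z o\<^sub>L Res z)) \<le> \<kappa> * b"
      using b[OF z] kappa_ge_1
        mult_mono[of "norm (\<sigma> (exp (of_real t * z)))" \<kappa> "norm (Res z o\<^sub>L Res z)" b]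
      by (intro order_trans[OF norm_blinfun_compose[of "\<sigma> (exp (of_real t * z))"]]) auto
  qed
  then show ?thesis by blast
qed

lemma fundamental_solution_neg_projector_tendsto:
  "((\<lambda>t. fundamental_solution (\<lambda>_. T) t o\<^sub>L neg_projector s T) \<longlongrightarrow> 0) at_top"
proof -
  let ?c = "\<sigma> (1 / (2 * of_real pi * \<i>))"
  obtain B where B: "\<And>t. t \<ge> 0 \<Longrightarrow> norm (t *\<^sub>R semigroup_loop t) \<le> B"
    using semigroup_loop_bound by blast
  have "fundamental_solution (\<lambda>_. T) t o\<^sub>L neg_projector s T = ?c o\<^sub>L semigroup_loop t" if "t \<ge> 0" for t
  proof -
    have "fundamental_solution (\<lambda>_. T) t o\<^sub>L ?c = ?c o\<^sub>L fundamental_solution (\<lambda>_. T) t"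
      using fundamental_solution_intertwine[OF bounded_path_const bounded_path_const _ that, of ?c T T]
        scalar_op_commute[OF T_J] by simp
    then show ?thesis
      unfolding neg_projector_eq semigroup_loop_eq[OF that] by (simp only: flip: blinfun_compose_assoc)
  qed
  then have "norm (fundamental_solution (\<lambda>_. T) t o\<^sub>L neg_projector s T) \<le> norm ?c * B / t" if "t > 0" for t
    using order_trans[OF norm_blinfun_compose[of ?c "semigroup_loop t"]
        mult_left_mono[of "norm (semigroup_loop t)" "B / t" "norm ?c"]] B[of t] that
    by (simp add: field_simps)
  then have "\<forall>\<^sub>F t in at_top. norm (fundamental_solution (\<lambda>_. T) t o\<^sub>L neg_projector s T) \<le> norm ?c * B / t"
    using eventually_gt_at_top[of 0] by (rule eventually_mono[rotated])
  moreover have "((\<lambda>t. norm ?c * B / t) \<longlongrightarrow> 0) at_top"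
    by (intro tendsto_divide_0[OF tendsto_const] filterlim_at_top_imp_at_infinity filterlim_ident)
  ultimately show ?thesis by (rule Lim_null_comparison)
qed

section \<open>Reflection of the operator and the complementary projector\<close>

lemma in_spectrum_minus_iff: "z \<in> - spectrum s (- T) \<longleftrightarrow> - z \<in> - spectrum s T"
proof -
  have "\<sigma> z - - T = - (\<sigma> (- z) - T)" by (simp add: scalar_op_minus)
  then have eq: "\<sigma> z - - T = - 1 *\<^sub>R (\<sigma> (- z) - T)" by simp
  have "(\<exists>Y. Y o\<^sub>L (\<sigma> z - - T) = id_blinfun \<and> (\<sigma> z - - T) o\<^sub>L Y = id_blinfun) \<longleftrightarrow>
      (\<exists>Y. Y o\<^sub>L (\<sigma> (- z) - T) = id_blinfun \<and> (\<sigma> (- z) - T) o\<^sub>L Y = id_blinfun)" (is "?L = ?R")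
  proof
    assume ?L
    then obtain Y where "Y o\<^sub>L (\<sigma> z - - T) = id_blinfun" "(\<sigma> z - - T) o\<^sub>L Y = id_blinfun" by blast
    then show ?R unfolding eq by (intro exI[of _ "- Y"]) (simp add: blinfun_compose_simps)
  next
    assume ?R
    then obtain Y where "Y o\<^sub>L (\<sigma> (- z) - T) = id_blinfun" "(\<sigma> (- z) - T) o\<^sub>L Y = id_blinfun" by blast
    then show ?L unfolding eq by (intro exI[of _ "- Y"]) (simp add: blinfun_compose_simps)
  qed
  then show ?thesis by (simp add: spectrum_def)
qed

lemma minus: "hyperbolic_operator J s (- T)"
proof
  show "- T o\<^sub>L J = J o\<^sub>L - T" by (simp add: blinfun_compose_simps T_J)
  show "spectrum s (- T) \<inter> {z. Re z = 0} = {}"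
    using in_spectrum_minus_iff axis_resolvent by auto
qed

lemma resolvent_minus:
  assumes "- z \<in> - spectrum s T"
  shows "resolvent s (- T) z = - Res (- z)"
proof (rule resolvent_unique)
  show "- T o\<^sub>L J = J o\<^sub>L - T" by (simp add: blinfun_compose_simps T_J)
  show "z \<in> - spectrum s (- T)" using assms in_spectrum_minus_iff by blast
  show "(\<sigma> z - - T) o\<^sub>L - Res (- z) = id_blinfun"
    using resolvent_right[OF T_J assms] by (simp add: scalar_op_minus blinfun_compose_simps algebra_simps)
qed

text \<open>
  \<open>W\<close> is the sum of the resolvents of \<open>T\<close> and \<open>- T\<close>. Iterating \<open>W z = 2 / z + T\<^sup>2 (W z) / z\<^sup>2\<close> leaves odd
  powers of \<open>1 / z\<close>, which integrate explicitly over the outer edges, and a remainder that tends to \<open>0\<close>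
  because \<open>norm T < r\<close>. The integrals of the two resolvents along the imaginary axis cancel.
\<close>

definition W :: "complex \<Rightarrow> ('a \<Rightarrow>\<^sub>L 'a)" where "W z = Res z - Res (- z)"

lemma continuous_on_W: "continuous_on outer W"
  unfolding W_def
proof (intro continuous_on_diff)
  show "continuous_on outer Res"
    by (rule continuous_on_subset[OF continuous_on_resolvent[OF T_J]]) (use outer_resolvent in auto)
  show "continuous_on outer (\<lambda>z. Res (- z))"
    by (rule continuous_on_compose2[OF continuous_on_resolvent[OF T_J]])
      (use outer_resolvent_minus in \<open>auto intro!: continuous_intros\<close>)
qed

lemma W_eq:
  assumes z: "z \<in> outer"
  shows "W z = 2 *\<^sub>R \<sigma> (inverse z) + (\<sigma> (inverse z ^ 2) o\<^sub>L ((T o\<^sub>L T) o\<^sub>L W z))"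
proof -
  have "z \<noteq> 0" using outer_props(1)[OF z] r_pos by auto
  have p: "\<sigma> z o\<^sub>L Res z = id_blinfun + (T o\<^sub>L Res z)"
    using scalar_op_resolvent[OF T_J outer_resolvent[OF z]] .
  have m: "\<sigma> z o\<^sub>L Res (- z) = - id_blinfun - (T o\<^sub>L Res (- z))"
  proof -
    have "- (\<sigma> z o\<^sub>L Res (- z)) = id_blinfun + (T o\<^sub>L Res (- z))"
      using scalar_op_resolvent[OF T_J outer_resolvent_minus[OF z]]
      by (simp add: scalar_op_minus blinfun_compose_simps)
    from arg_cong[OF this, of uminus] show ?thesis by simp
  qed
  \<comment> \<open>The companion of \<open>W\<close> that closes the system: z W = 2 + T V and z V
    = T W. Eliminating V gives z^2 W = 2 z + T^2 W.\<close>
  let ?V = "Res z + Res (- z)"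
  have 1: "\<sigma> z o\<^sub>L W z = 2 *\<^sub>R id_blinfun + (T o\<^sub>L ?V)"
    unfolding W_def by (simp add: blinfun_compose_simps p m scaleR_2)
  have 2: "\<sigma> z o\<^sub>L ?V = T o\<^sub>L W z"
    unfolding W_def by (simp add: blinfun_compose_simps p m)
  have "\<sigma> z o\<^sub>L (\<sigma> z o\<^sub>L W z) = 2 *\<^sub>R \<sigma> z + ((\<sigma> z o\<^sub>L T) o\<^sub>L ?V)"
    unfolding 1 by (simp add: blinfun_compose_simps blinfun_compose_assoc)
  also have "(\<sigma> z o\<^sub>L T) o\<^sub>L ?V = T o\<^sub>L (\<sigma> z o\<^sub>L ?V)"
    by (simp only: scalar_op_commute[OF T_J] flip: blinfun_compose_assoc)
  also have "\<dots> = (T o\<^sub>L T) o\<^sub>L W z" unfolding 2 by (simp add: blinfun_compose_assoc)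
  finally have "\<sigma> (inverse z ^ 2) o\<^sub>L (\<sigma> z o\<^sub>L (\<sigma> z o\<^sub>L W z)) =
      \<sigma> (inverse z ^ 2) o\<^sub>L (2 *\<^sub>R \<sigma> z + ((T o\<^sub>L T) o\<^sub>L W z))" by simp
  moreover have "\<sigma> (inverse z ^ 2) o\<^sub>L (\<sigma> z o\<^sub>L (\<sigma> z o\<^sub>L W z)) = W z"
  proof -
    have "\<sigma> (inverse z ^ 2) o\<^sub>L (\<sigma> z o\<^sub>L (\<sigma> z o\<^sub>L W z)) = \<sigma> (inverse z ^ 2 * z * z) o\<^sub>L W z"
      by (simp only: scalar_op_mult blinfun_compose_assoc)
    also have "inverse z ^ 2 * z * z = 1"
      using \<open>z \<noteq> 0\<close> by (simp add: power2_eq_square mult.assoc)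
    finally show ?thesis by simp
  qed
  moreover have "\<sigma> (inverse z ^ 2) o\<^sub>L \<sigma> z = \<sigma> (inverse z)"
    using \<open>z \<noteq> 0\<close> by (simp add: power2_eq_square mult.assoc flip: scalar_op_mult)
  ultimately show ?thesis by (simp add: blinfun_compose_simps)
qed

text \<open>The remainder after n substitutions of the equation for \<open>W\<close> into itself;
  \<open>V 0\<close> is \<open>W\<close>.\<close>

definition V :: "nat \<Rightarrow> complex \<Rightarrow> ('a \<Rightarrow>\<^sub>L 'a)" where
  "V n z = \<sigma> (inverse z ^ (2 * n)) o\<^sub>L (op_power T (2 * n) o\<^sub>L W z)"

lemma V_Suc:
  assumes z: "z \<in> outer"
  shows "V n z = 2 *\<^sub>R (\<sigma> (inverse z ^ (2 * n + 1)) o\<^sub>L op_power T (2 * n)) + V (Suc n) z"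
proof -
  let ?u = "inverse z" and ?T = "op_power T (2 * n)"
  have c: "?T o\<^sub>L \<sigma> w = \<sigma> w o\<^sub>L ?T" for w
    using op_power_commute[of "\<sigma> w" T "2 * n"] scalar_op_commute[OF T_J, of w] by simp
  have d: "?T o\<^sub>L (T o\<^sub>L T) = op_power T (2 * Suc n)"
    using op_power_commute[of "T o\<^sub>L T" T "2 * n"] by (simp add: blinfun_compose_assoc)
  have "V n z = \<sigma> (?u ^ (2 * n)) o\<^sub>L (?T o\<^sub>L (2 *\<^sub>R \<sigma> ?u + (\<sigma> (?u ^ 2) o\<^sub>L ((T o\<^sub>L T) o\<^sub>L W z))))"
    unfolding V_def using W_eq[OF z] by simp
  also have "\<dots> = 2 *\<^sub>R (\<sigma> (?u ^ (2 * n)) o\<^sub>L (\<sigma> ?u o\<^sub>L ?T)) +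
      (\<sigma> (?u ^ (2 * n)) o\<^sub>L (\<sigma> (?u ^ 2) o\<^sub>L ((?T o\<^sub>L (T o\<^sub>L T)) o\<^sub>L W z)))"
    by (simp only: blinfun_compose_simps c blinfun_compose_assoc[symmetric])
  also have "\<dots> = 2 *\<^sub>R (\<sigma> (?u ^ (2 * n) * ?u) o\<^sub>L ?T) + (\<sigma> (?u ^ (2 * n) * ?u ^ 2) o\<^sub>L (op_power T (2 * Suc n) o\<^sub>L W z))"
    by (simp only: d scalar_op_mult blinfun_compose_assoc)
  also have "?u ^ (2 * n) * ?u ^ 2 = ?u ^ (2 * Suc n)" by (simp add: power_add[symmetric])
  also have "?u ^ (2 * n) * ?u = ?u ^ (2 * n + 1)" by simp
  finally show ?thesis unfolding V_def .
qed

lemma continuous_on_inverse_power: "continuous_on outer (\<lambda>z. inverse z ^ n)"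
  using outer_props(1) r_pos by (intro continuous_intros) fastforce

lemma continuous_on_V: "continuous_on outer (V n)"
  unfolding V_def by (intro continuous_on_ops continuous_on_const continuous_on_W continuous_on_inverse_power)

text \<open>\<open>Ln (- z)\<close> is an antiderivative along the outer edges. They lead from i r
  through the left half plane to - i r, so the argument of - z rises from - pi/2 to pi/2.\<close>

lemma arc_inverse: "arc (\<lambda>z. \<sigma> (inverse z)) = \<sigma> (of_real pi * \<i>)"
proof -
  let ?S = "{z. - z \<notin> \<real>\<^sub>\<le>\<^sub>0}"
  have "has_cderiv_on ?S (\<lambda>z. \<sigma> (Ln (- z))) (\<lambda>z. \<sigma> (inverse z))"
  proof (rule has_cderiv_on_scalar)
    fix z :: complex assume z: "z \<in> ?S"
    then have "((\<lambda>z. Ln (- z)) has_field_derivative inverse (- z) * (- 1)) (at z)"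
      by (intro DERIV_chain2[OF has_field_derivative_Ln]) (auto intro!: derivative_eq_intros)
    then show "((\<lambda>z. Ln (- z)) has_field_derivative inverse z) (at z)" by simp
  qed
  moreover have "continuous_on ?S (\<lambda>z. \<sigma> (inverse z))"
    by (intro continuous_on_ops continuous_intros) auto
  ultimately have "arc (\<lambda>z. \<sigma> (inverse z)) = \<sigma> (Ln (- a2)) - \<sigma> (Ln (- a3))"
    using outer_props(2) by (intro arc_cderiv) auto
  moreover have "- a2 = of_real r * \<i>" "- a3 = of_real r * - \<i>"
    by (auto simp: a2_def a3_def complex_eq_iff)
  ultimately have "arc (\<lambda>z. \<sigma> (inverse z)) = \<sigma> (Ln (of_real r * \<i>) - Ln (of_real r * - \<i>))"
    by (simp only: scalar_op_diff)
  also have "Ln (of_real r * \<i>) - Ln (of_real r * - \<i>) = of_real pi * \<i>"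
    using Ln_times_of_real[OF r_pos, of "\<i>"] Ln_times_of_real[OF r_pos, of "- \<i>"] by simp
  finally show ?thesis .
qed

text \<open>The antiderivative is even and the two end points are opposite, so its values there
  agree.\<close>

lemma arc_inverse_power:
  assumes "n > 0"
  shows "arc (\<lambda>z. \<sigma> (inverse z ^ (2 * n + 1))) = 0"
proof -
  let ?G = "\<lambda>z. - (inverse z ^ (2 * n)) / of_nat (2 * n)"
  have "has_cderiv_on (- {0}) (\<lambda>z. \<sigma> (?G z)) (\<lambda>z. \<sigma> (inverse z ^ (2 * n + 1)))"
  proof (rule has_cderiv_on_scalar)
    fix z :: complex assume z: "z \<in> - {0}"
    have "(?G has_field_derivative
        - (of_nat (2 * n) * (- (inverse z * 1 * inverse z)) * inverse z ^ (2 * n - 1)) / of_nat (2 * n)) (at z)"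
      using z by (auto intro!: derivative_eq_intros)
    moreover have "- (of_nat (2 * n) * (- (inverse z * 1 * inverse z)) * inverse z ^ (2 * n - 1)) / of_nat (2 * n) =
        inverse z ^ (2 * n + 1)"
    proof -
      obtain m where n: "n = Suc m" using assms gr0_implies_Suc by blast
      have "of_nat (2 * n) \<noteq> (0 :: complex)" using assms by simp
      moreover have "- (c * (- (u * 1 * u)) * v) / c = u * u * v" if "c \<noteq> 0" for c u v :: complex
        using that by simp
      moreover have "inverse z * inverse z * inverse z ^ (2 * n - 1) = inverse z ^ (2 * n + 1)"
        by (simp add: n)
      ultimately show ?thesis by metis
    qed
    ultimately show "(?G has_field_derivative inverse z ^ (2 * n + 1)) (at z)"
      by simp
  qed
  moreover have "continuous_on (- {0}) (\<lambda>z. \<sigma> (inverse z ^ (2 * n + 1)))"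
    by (intro continuous_on_ops continuous_intros) auto
  ultimately have "arc (\<lambda>z. \<sigma> (inverse z ^ (2 * n + 1))) = \<sigma> (?G a2) - \<sigma> (?G a3)"
    using outer_props(1) r_pos by (intro arc_cderiv) fastforce+
  moreover have "a3 = - a2" by (simp add: a2_def a3_def complex_eq_iff)
  ultimately show ?thesis by simp
qed

lemma arc_V_0: "arc (V 0) = 2 *\<^sub>R \<sigma> (of_real pi * \<i>) + arc (V 1)"
proof -
  have "arc (V 0) = arc (\<lambda>z. 2 *\<^sub>R \<sigma> (inverse z) + V 1 z)"
    using V_Suc[of _ 0] by (intro arc_cong) simp
  also have "\<dots> = 2 *\<^sub>R arc (\<lambda>z. \<sigma> (inverse z)) + arc (V 1)"
    using continuous_on_inverse_power[of 1]
    by (subst arc_add) (auto intro!: continuous_intros continuous_on_ops continuous_on_V simp: arc_scaleR)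
  finally show ?thesis by (simp add: arc_inverse)
qed

lemma arc_V_Suc:
  assumes "n > 0"
  shows "arc (V n) = arc (V (Suc n))"
proof -
  let ?T = "op_power T (2 * n)"
  have "arc (V n) = arc (\<lambda>z. 2 *\<^sub>R (\<sigma> (inverse z ^ (2 * n + 1)) o\<^sub>L ?T) + V (Suc n) z)"
    using V_Suc[of _ n] by (intro arc_cong) simp
  also have "\<dots> = 2 *\<^sub>R (arc (\<lambda>z. \<sigma> (inverse z ^ (2 * n + 1))) o\<^sub>L ?T) + arc (V (Suc n))"
    by (subst arc_add, (intro continuous_intros continuous_on_ops continuous_on_V continuous_on_inverse_power)+,
        subst arc_scaleR, subst arc_compose_right, (intro continuous_on_ops continuous_on_inverse_power)+) simp
  finally show ?thesis using arc_inverse_power[OF assms] by simp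
qed

text \<open>The integral of the remainder does not depend on n from 1 on, while its norm is bounded
  by a multiple of the n-th power of (norm T / r)^2, a number below 1 because
  \<open>r = norm T + 1\<close>.\<close>

lemma arc_V_1: "arc (V 1) = 0"
proof -
  have const: "arc (V (Suc n)) = arc (V 1)" for n
  proof (induction n)
    case (Suc n)
    then show ?case using arc_V_Suc[of "Suc n"] by simp
  qed simp
  obtain b where b: "\<And>z. z \<in> outer \<Longrightarrow> norm (W z) \<le> b"
    by (rule norm_bounded_on_compact[OF compact_outer continuous_on_W]) blast
  define q where "q = (norm T / r) ^ 2"
  have q: "0 \<le> q" "q < 1"
    unfolding q_def using r_pos by (auto simp: r_def power_less_one_iff abs_square_less_1)
  have "norm (V n z) \<le> \<kappa> * q ^ n * b" if z: "z \<in> outer" for n z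
  proof -
    have "cmod (inverse z ^ (2 * n)) \<le> inverse r ^ (2 * n)"
      using outer_props(1)[OF z] r_pos by (simp add: norm_power norm_inverse power_mono le_imp_inverse_le)
    then have 1: "norm (\<sigma> (inverse z ^ (2 * n))) \<le> \<kappa> * inverse r ^ (2 * n)"
      using kappa_ge_1 by (intro order_trans[OF norm_scalar_op_le] mult_left_mono) auto
    have 2: "norm (op_power T (2 * n) o\<^sub>L W z) \<le> norm T ^ (2 * n) * b"
      by (intro order_trans[OF norm_blinfun_compose] mult_mono norm_op_power_le b z) auto
    have "norm (V n z) \<le> (\<kappa> * inverse r ^ (2 * n)) * (norm T ^ (2 * n) * b)"
      unfolding V_def using kappa_ge_1 r_pos
      by (intro order_trans[OF norm_blinfun_compose] mult_mono 1 2) auto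
    also have "\<dots> = \<kappa> * q ^ n * b"
      by (simp add: q_def power_mult[symmetric] divide_inverse power_mult_distrib)
    finally show ?thesis .
  qed
  then have le: "norm (arc (V (Suc n))) \<le> \<kappa> * len * (\<kappa> * q ^ Suc n * b)" for n
    by (intro norm_arc_le continuous_on_V)
  have "(\<lambda>n. \<kappa> * len * (\<kappa> * q ^ Suc n * b)) \<longlonglongrightarrow> \<kappa> * len * (\<kappa> * 0 * b)"
    using q by (intro tendsto_intros LIMSEQ_Suc LIMSEQ_power_zero) auto
  moreover have "\<forall>n. norm (arc (V 1)) \<le> \<kappa> * len * (\<kappa> * q ^ Suc n * b)"
    using le const by metis
  ultimately have "norm (arc (V 1)) \<le> \<kappa> * len * (\<kappa> * 0 * b)"
    by (intro LIMSEQ_le_const) auto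
  then show ?thesis by simp
qed

text \<open>T and - T have equal norms, hence the same rectangle. The resolvent of - T at z is minus
  that of T at - z, so z -> - z turns its integral along the axis into minus that of T. What remains
  is the outer integral of \<open>W\<close>, which is 2 pi i.\<close>

lemma neg_projector_add: "neg_projector s T + neg_projector s (- T) = id_blinfun"
proof -
  interpret n: hyperbolic_operator J s "- T" by (rule minus)
  have corners: "n.a1 = a1" "n.a2 = a2" "n.a3 = a3" "n.a4 = a4" "n.r = r"
    by (simp_all add: n.a1_def n.a2_def n.a3_def n.a4_def n.r_def a1_def a2_def a3_def a4_def r_def)
  have arc_eq: "n.arc = arc" unfolding n.arc_def arc_def corners ..
  have outer_eq: "n.outer = outer" unfolding n.outer_def outer_def corners ..
  have axis: "edge a2 a3 n.Res = - edge a2 a3 Res"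
  proof -
    have "edge a2 a3 n.Res = edge a2 a3 (\<lambda>z. - Res (- z))"
      using axis_props axis_resolvent resolvent_minus by (intro edge_cong) simp
    also have "\<dots> = edge (- a2) (- a3) Res" by (simp add: edge_minus edge_negate)
    also have "\<dots> = edge a3 a2 Res" by (simp add: a2_def a3_def complex_minus)
    also have "\<dots> = - edge a2 a3 Res"
      by (rule edge_reverse) (rule continuous_on_subset[OF continuous_on_ops(4) contour_edges(2)])
    finally show ?thesis .
  qed
  have "arc Res + arc n.Res = arc (\<lambda>z. Res z + n.Res z)"
    using continuous_on_subset[OF continuous_on_ops(4)] continuous_on_subset[OF n.continuous_on_ops(4)]
    by (intro arc_add[symmetric]) (auto simp: contour_def n.contour_def outer_eq)
  also have "\<dots> = arc (V 0)"
    using outer_resolvent_minus resolvent_minus by (intro arc_cong) (simp add: V_def W_def)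
  also have "\<dots> = 2 *\<^sub>R \<sigma> (of_real pi * \<i>)"
    by (simp add: arc_V_0 arc_V_1[simplified])
  also have "\<dots> = \<sigma> (2 * of_real pi * \<i>)"
    by (simp add: scalar_op_scaleR[symmetric] scaleR_conv_of_real mult.assoc)
  finally have "loop Res + n.loop n.Res = \<sigma> (2 * of_real pi * \<i>)"
    unfolding loop_def n.loop_def arc_eq corners axis by simp
  then have "neg_projector s T + neg_projector s (- T) =
      \<sigma> (1 / (2 * of_real pi * \<i>)) o\<^sub>L \<sigma> (2 * of_real pi * \<i>)"
    unfolding neg_projector_eq n.neg_projector_eq by (simp flip: blinfun_compose_simps)
  also have "\<dots> = id_blinfun" by (simp flip: scalar_op_mult)
  finally show ?thesis .
qed

end

subsection \<open>Exponential dichotomies\<close>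

text \<open>A contour-free description of the Riesz projector. Idempotence follows from the two
  limits, which lets the notion pass to the real compression of a complex projector, where
  idempotence is not evident.\<close>

definition dichotomy :: "('a::banach \<Rightarrow>\<^sub>L 'a) \<Rightarrow> ('a \<Rightarrow>\<^sub>L 'a) \<Rightarrow> bool" where
  "dichotomy T P \<longleftrightarrow> P o\<^sub>L T = T o\<^sub>L P \<and>
     ((\<lambda>t. fundamental_solution (\<lambda>_. T) t o\<^sub>L P) \<longlongrightarrow> 0) at_top \<and>
     ((\<lambda>t. fundamental_solution (\<lambda>_. - T) t o\<^sub>L (id_blinfun - P)) \<longlongrightarrow> 0) at_top"

lemma (in hyperbolic_operator) dichotomy_neg_projector: "dichotomy T (neg_projector s T)"
proof -
  interpret n: hyperbolic_operator J s "- T" by (rule minus)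
  have "id_blinfun - neg_projector s T = neg_projector s (- T)"
    using neg_projector_add by (simp add: algebra_simps)
  then show ?thesis
    unfolding dichotomy_def
    using fundamental_solution_neg_projector_tendsto n.fundamental_solution_neg_projector_tendsto
      neg_projector_commute[OF T_J] by simp
qed

lemma fundamental_solution_const_commute:
  assumes "C o\<^sub>L T = T o\<^sub>L C" "t \<ge> 0"
  shows "C o\<^sub>L fundamental_solution (\<lambda>_. T) t = fundamental_solution (\<lambda>_. T) t o\<^sub>L C"
  using fundamental_solution_intertwine[of "\<lambda>_. T" "\<lambda>_. T"] assms by simp

lemma fundamental_solution_minus_eq:
  assumes "t \<ge> 0"
  shows "fundamental_solution (\<lambda>_. - T) t = inverse_solution (\<lambda>_. T) t"
proof (rule solves_unique[OF ode_field_compose_left[of "\<lambda>_. - T"] _ _ _ assms])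
  show "solves (\<lambda>t Y. - T o\<^sub>L Y) (inverse_solution (\<lambda>_. T))"
    unfolding solves_def
  proof (intro allI impI)
    fix s :: real assume s: "s \<ge> 0"
    have "(inverse_solution (\<lambda>_. T) has_vector_derivative - (inverse_solution (\<lambda>_. T) s o\<^sub>L T)) (at s within {0..})"
      by (rule inverse_solution_deriv) (simp_all add: s)
    moreover have "T o\<^sub>L inverse_solution (\<lambda>_. T) s = inverse_solution (\<lambda>_. T) s o\<^sub>L T"
      by (rule inverse_solution_commute) (simp_all add: s)
    ultimately show "(inverse_solution (\<lambda>_. T) has_vector_derivative (- T o\<^sub>L inverse_solution (\<lambda>_. T) s)) (at s within {0..})"
      by (simp add: blinfun_compose_simps)
  qed
qed (simp_all add: fundamental_solution_solves fundamental_solution_0 inverse_solution_0)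

lemma fundamental_solution_minus_left:
  assumes "t \<ge> 0"
  shows "fundamental_solution (\<lambda>_. - T) t o\<^sub>L fundamental_solution (\<lambda>_. T) t = id_blinfun"
  using assms by (simp add: fundamental_solution_minus_eq inverse_solution_left)

lemma fundamental_solution_minus_right:
  assumes "t \<ge> 0"
  shows "fundamental_solution (\<lambda>_. T) t o\<^sub>L fundamental_solution (\<lambda>_. - T) t = id_blinfun"
  using assms by (simp add: fundamental_solution_minus_eq inverse_solution_right)

lemma tendsto_compose_0:
  assumes "(f \<longlongrightarrow> 0) F" "(g \<longlongrightarrow> 0) F"
  shows "((\<lambda>t. f t o\<^sub>L g t) \<longlongrightarrow> 0) F"
  using bounded_bilinear.tendsto[OF bounded_bilinear_blinfun_compose assms] by simp

text \<open>P (id - P) = (exp (t T) P) (exp (- t T) (id - P)) for every t, and both factors tend to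
  0.\<close>

lemma dichotomy_idem:
  assumes "dichotomy T P"
  shows "P o\<^sub>L P = P"
proof -
  let ?X = "fundamental_solution (\<lambda>_. T)" and ?Y = "fundamental_solution (\<lambda>_. - T)"
  have PT: "P o\<^sub>L T = T o\<^sub>L P" and lim: "((\<lambda>t. ?X t o\<^sub>L P) \<longlongrightarrow> 0) at_top"
    "((\<lambda>t. ?Y t o\<^sub>L (id_blinfun - P)) \<longlongrightarrow> 0) at_top"
    using assms unfolding dichotomy_def by auto
  have "(?X t o\<^sub>L P) o\<^sub>L (?Y t o\<^sub>L (id_blinfun - P)) = P o\<^sub>L (id_blinfun - P)" if "t \<ge> 0" for t
  proof -
    have "(?X t o\<^sub>L P) o\<^sub>L (?Y t o\<^sub>L (id_blinfun - P)) = (P o\<^sub>L (?X t o\<^sub>L ?Y t)) o\<^sub>L (id_blinfun - P)"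
      by (simp only: fundamental_solution_const_commute[OF PT that, symmetric] blinfun_compose_assoc)
    then show ?thesis by (simp add: fundamental_solution_minus_right[OF that])
  qed
  then have "\<forall>\<^sub>F t in at_top. (?X t o\<^sub>L P) o\<^sub>L (?Y t o\<^sub>L (id_blinfun - P)) = P o\<^sub>L (id_blinfun - P)"
    using eventually_ge_at_top[of 0] by (rule eventually_mono[rotated])
  from tendsto_cong[THEN iffD1, OF this tendsto_compose_0[OF lim]]
  have "P o\<^sub>L (id_blinfun - P) = 0"
    using tendsto_unique[OF trivial_limit_at_top_linorder _ tendsto_const] by metis
  then show ?thesis by (simp add: blinfun_compose_simps)
qed

lemma dichotomy_compact_eq:
  assumes A: "dichotomy A P" and B: "dichotomy B Q" and AB: "A \<sim>\<^sub>K B"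
  shows "P \<sim>\<^sub>K Q"
proof -
  \<comment> \<open>Stated with one half of each dichotomy, so that it applies again to - A, - B and
    the complementary operators.\<close>
  have *: "compact_operator (P o\<^sub>L (id_blinfun - Q))"
    if P: "P o\<^sub>L A = A o\<^sub>L P" and lim: "((\<lambda>t. fundamental_solution (\<lambda>_. A) t o\<^sub>L P) \<longlongrightarrow> 0) at_top"
      "((\<lambda>t. fundamental_solution (\<lambda>_. - B) t o\<^sub>L (id_blinfun - Q)) \<longlongrightarrow> 0) at_top" and AB: "A \<sim>\<^sub>K B"
    for A B P Q :: "'a \<Rightarrow>\<^sub>L 'a"
  proof -
    let ?X = "fundamental_solution (\<lambda>_. A)" and ?Y = "fundamental_solution (\<lambda>_. - B)"
    have "((?X t o\<^sub>L P) o\<^sub>L (?Y t o\<^sub>L (id_blinfun - Q))) \<sim>\<^sub>K (P o\<^sub>L (id_blinfun - Q))" if "t \<ge> 0" for t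
    proof -
      have "?X t \<sim>\<^sub>K fundamental_solution (\<lambda>_. B) t"
        by (rule fundamental_solution_compact_eq) (use AB that in auto)
      then have "(?X t o\<^sub>L ?Y t) \<sim>\<^sub>K (fundamental_solution (\<lambda>_. B) t o\<^sub>L ?Y t)"
        by (rule compact_eq_compose) simp
      then have "(?X t o\<^sub>L ?Y t) \<sim>\<^sub>K id_blinfun"
        by (simp add: fundamental_solution_minus_right[OF that])
      then have "((P o\<^sub>L (?X t o\<^sub>L ?Y t)) o\<^sub>L (id_blinfun - Q)) \<sim>\<^sub>K ((P o\<^sub>L id_blinfun) o\<^sub>L (id_blinfun - Q))"
        by (intro compact_eq_compose compact_eq_refl)
      then show ?thesis
        by (simp add: fundamental_solution_const_commute[OF P that, symmetric] flip: blinfun_compose_assoc)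
    qed
    then have "\<forall>\<^sub>F t in at_top. ((?X t o\<^sub>L P) o\<^sub>L (?Y t o\<^sub>L (id_blinfun - Q))) \<sim>\<^sub>K (P o\<^sub>L (id_blinfun - Q))"
      using eventually_ge_at_top[of 0] by (rule eventually_mono[rotated])
    from compact_eq_tendsto[OF tendsto_compose_0[OF lim] tendsto_const _ this]
    have "0 \<sim>\<^sub>K (P o\<^sub>L (id_blinfun - Q))" by simp
    from compact_eq_sym[OF this] show ?thesis by (simp add: compact_eq_0_iff)
  qed
  have 1: "compact_operator (P o\<^sub>L (id_blinfun - Q))"
    using A B AB unfolding dichotomy_def by (intro *[of P A B Q]) auto
  have m: "- A \<sim>\<^sub>K - B"
    using compact_eq_diff[OF compact_eq_refl[of 0] AB] by simp
  \<comment> \<open>By reflection (id - P) Q is compact, and P - Q = P (id - Q) - (id - P)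
    Q.\<close>
  have "compact_operator ((id_blinfun - P) o\<^sub>L (id_blinfun - (id_blinfun - Q)))"
    using A B m unfolding dichotomy_def
    by (intro *[of "id_blinfun - P" "- A" "- B" "id_blinfun - Q"]) (auto simp: blinfun_compose_simps)
  from compact_operator_diff[OF 1 this] show ?thesis
    by (simp add: compact_eq_def blinfun_compose_simps)
qed

subsection \<open>The discrete Lyapunov--Perron iteration\<close>

text \<open>
  A sequence with \<open>x (Suc n) = M n (x n)\<close> satisfies
  \<open>x n = \<theta> (M (n - 1) (x (n - 1))) + (id - \<theta> - N \<circ> M n) (x n) + N (x (Suc n))\<close>, where \<open>N\<close> inverts
  the unperturbed map on the kernel of \<open>\<theta>\<close>. The right hand side is a contraction.
\<close>

definition lp_map ::
    "('a::banach \<Rightarrow>\<^sub>L 'a) \<Rightarrow> (nat \<Rightarrow> ('a \<Rightarrow>\<^sub>L 'a)) \<Rightarrow> ('a \<Rightarrow>\<^sub>L 'a) \<Rightarrow> (nat \<Rightarrow> ('a \<Rightarrow>\<^sub>L 'a)) \<Rightarrow> nat \<Rightarrow> ('a \<Rightarrow>\<^sub>L 'a)" where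
  "lp_map \<theta> M N Y n = (case n of 0 \<Rightarrow> \<theta> | Suc m \<Rightarrow> (\<theta> o\<^sub>L M m) o\<^sub>L Y m) +
     (((id_blinfun - \<theta> - (N o\<^sub>L M n)) o\<^sub>L Y n) + (N o\<^sub>L Y (Suc n)))"

primrec lp_iter ::
    "('a::banach \<Rightarrow>\<^sub>L 'a) \<Rightarrow> (nat \<Rightarrow> ('a \<Rightarrow>\<^sub>L 'a)) \<Rightarrow> ('a \<Rightarrow>\<^sub>L 'a) \<Rightarrow> nat \<Rightarrow> nat \<Rightarrow> ('a \<Rightarrow>\<^sub>L 'a)" where
  "lp_iter \<theta> M N 0 = (\<lambda>n. 0)"
| "lp_iter \<theta> M N (Suc k) = lp_map \<theta> M N (lp_iter \<theta> M N k)"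

definition lp_projector ::
    "('a::banach \<Rightarrow>\<^sub>L 'a) \<Rightarrow> (nat \<Rightarrow> ('a \<Rightarrow>\<^sub>L 'a)) \<Rightarrow> ('a \<Rightarrow>\<^sub>L 'a) \<Rightarrow> ('a \<Rightarrow>\<^sub>L 'a)" where
  "lp_projector \<theta> M N = lim (\<lambda>k. lp_iter \<theta> M N k 0)"

text \<open>The three coefficients of the iteration are bounded by 1/4 each, giving the contraction
  factor 3/4. \<open>H\<close> plays the unperturbed map, which undoes \<open>N\<close> on the
  kernel of \<theta>.\<close>

locale lyapunov_perron =
  fixes \<theta> :: "'a::banach \<Rightarrow>\<^sub>L 'a" and M :: "nat \<Rightarrow> ('a \<Rightarrow>\<^sub>L 'a)" and N H :: "'a \<Rightarrow>\<^sub>L 'a"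
  assumes idem: "\<theta> o\<^sub>L \<theta> = \<theta>" and \<theta>_N: "\<theta> o\<^sub>L N = 0" and H_N: "H o\<^sub>L N = id_blinfun - \<theta>"
    and norms: "\<And>n. norm (\<theta> o\<^sub>L M n) \<le> 1/4" "\<And>n. norm (id_blinfun - \<theta> - (N o\<^sub>L M n)) \<le> 1/4" "norm N \<le> 1/4"
begin

lemma norm_apply_le:
  assumes "norm (f :: 'a \<Rightarrow>\<^sub>L 'a) \<le> 1/4" "norm x \<le> C"
  shows "norm (blinfun_apply f x) \<le> C / 4"
proof -
  have "norm f * norm x \<le> 1/4 * C"
    using assms order_trans[OF norm_ge_zero assms(2)] by (intro mult_mono) auto
  then show ?thesis using norm_blinfun[of f x] by simp
qed

lemma norm_compose_le:
  assumes "norm (f :: 'a \<Rightarrow>\<^sub>L 'a) \<le> 1/4" "norm (g :: 'a \<Rightarrow>\<^sub>L 'a) \<le> C"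
  shows "norm (f o\<^sub>L g) \<le> C / 4"
proof -
  have "norm f * norm g \<le> 1/4 * C"
    using assms order_trans[OF norm_ge_zero assms(2)] by (intro mult_mono) auto
  then show ?thesis using norm_blinfun_compose[of f g] by simp
qed

text \<open>The orbit is a bounded fixed point of the homogeneous version of the contraction, so its
  norm is at most (3/4)^k C for every k.\<close>

lemma bounded_orbit_unique:
  assumes orbit: "\<And>n. x (Suc n) = blinfun_apply (M n) (x n)"
    and init: "blinfun_apply \<theta> (x 0) = 0" and bound: "\<And>n. norm (x n) \<le> C"
  shows "x n = 0"
proof -
  have eq: "x n = (case n of 0 \<Rightarrow> 0 | Suc m \<Rightarrow> blinfun_apply (\<theta> o\<^sub>L M m) (x m)) +
      (blinfun_apply (id_blinfun - \<theta> - (N o\<^sub>L M n)) (x n) + blinfun_apply N (x (Suc n)))" for n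
    using orbit[of n] orbit[of "n - 1"] init
    by (cases n) (simp_all add: blinfun.bilinear_simps)
  have le: "norm (x n) \<le> (3/4)^k * C" for k n
  proof (induction k arbitrary: n)
    case (Suc k)
    let ?c = "(3/4)^k * C"
    have "norm (case n of 0 \<Rightarrow> 0 | Suc m \<Rightarrow> blinfun_apply (\<theta> o\<^sub>L M m) (x m)) \<le> ?c / 4"
      using norm_apply_le[OF norms(1) Suc] order_trans[OF norm_ge_zero Suc[of 0]]
      by (cases n) (simp_all del: blinfun_apply_blinfun_compose)
    then have "norm (x n) \<le> ?c / 4 + (?c / 4 + ?c / 4)"
      by (subst eq) (intro norm_triangle_mono norm_apply_le[OF norms(2) Suc] norm_apply_le[OF norms(3) Suc])
    then show ?case by (simp add: algebra_simps)
  qed (simp add: bound)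
  have "(\<lambda>k. (3/4)^k * C) \<longlonglongrightarrow> 0 * C"
    by (intro tendsto_mult tendsto_const LIMSEQ_power_zero) simp
  then have "norm (x n) \<le> 0 * C"
    by (rule LIMSEQ_le_const) (use le in auto)
  then show ?thesis by simp
qed

abbreviation "it \<equiv> lp_iter \<theta> M N"

lemma lp_map_diff_le:
  assumes "\<And>n. norm (Y n - Z n) \<le> C"
  shows "norm (lp_map \<theta> M N Y n - lp_map \<theta> M N Z n) \<le> 3/4 * C"
proof -
  have "lp_map \<theta> M N Y n - lp_map \<theta> M N Z n =
      (case n of 0 \<Rightarrow> 0 | Suc m \<Rightarrow> (\<theta> o\<^sub>L M m) o\<^sub>L (Y m - Z m)) +
      (((id_blinfun - \<theta> - (N o\<^sub>L M n)) o\<^sub>L (Y n - Z n)) + (N o\<^sub>L (Y (Suc n) - Z (Suc n))))"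
    unfolding lp_map_def
    by (cases n) (simp_all add: bounded_bilinear.diff_right[OF bounded_bilinear_blinfun_compose])
  also have "norm \<dots> \<le> C / 4 + (C / 4 + C / 4)"
  proof (intro norm_triangle_mono norm_compose_le[OF norms(2) assms] norm_compose_le[OF norms(3) assms])
    show "norm (case n of 0 \<Rightarrow> 0 | Suc m \<Rightarrow> (\<theta> o\<^sub>L M m) o\<^sub>L (Y m - Z m)) \<le> C / 4"
      using norm_compose_le[OF norms(1) assms] order_trans[OF norm_ge_zero assms[of 0]]
      by (cases n) simp_all
  qed
  finally show ?thesis by simp
qed

lemma it_step: "norm (it (Suc k) n - it k n) \<le> norm \<theta> * (3/4)^k"
proof (induction k arbitrary: n)
  case 0
  then show ?case by (cases n) (simp_all add: lp_map_def)
next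
  case (Suc k)
  have "norm (it (Suc (Suc k)) n - it (Suc k) n) \<le> 3/4 * (norm \<theta> * (3/4)^k)"
    using lp_map_diff_le[of "it (Suc k)" "it k", OF Suc] by simp
  then show ?case by simp
qed

lemma it_bound: "norm (it k n) \<le> 4 * norm \<theta>"
proof -
  have "norm (it k n) \<le> norm \<theta> * (\<Sum>i<k. (3/4)^i)" for k
  proof (induction k)
    case (Suc k)
    then show ?case
      using norm_triangle_sub[of "it (Suc k) n" "it k n"] it_step[of k n]
      by (simp add: algebra_simps)
  qed simp
  also have "norm \<theta> * (\<Sum>i<k. (3/4::real)^i) \<le> norm \<theta> * 4"
    by (intro mult_left_mono) (simp_all add: sum_gp_strict)
  finally show ?thesis by simp
qed

definition Y :: "nat \<Rightarrow> ('a \<Rightarrow>\<^sub>L 'a)" where "Y n = lim (\<lambda>k. it k n)"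

lemma it_tendsto: "(\<lambda>k. it k n) \<longlonglongrightarrow> Y n"
proof -
  have "summable (\<lambda>k. it (Suc k) n - it k n)"
  proof (rule summable_comparison_test')
    show "summable (\<lambda>k. norm \<theta> * (3/4)^k)" by (intro summable_mult summable_geometric) simp
    show "norm (it (Suc k) n - it k n) \<le> norm \<theta> * (3/4)^k" for k by (rule it_step)
  qed
  from summable_LIMSEQ[OF this]
  have "convergent (\<lambda>k. \<Sum>i<k. it (Suc i) n - it i n)"
    by (rule convergentI)
  moreover have "(\<Sum>i<k. it (Suc i) n - it i n) = it k n" for k
    by (subst sum_lessThan_telescope) simp
  ultimately show ?thesis
    unfolding Y_def by (simp add: convergent_LIMSEQ_iff)
qed

lemma Y_0: "lp_projector \<theta> M N = Y 0"
  by (simp add: lp_projector_def Y_def)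

lemma Y_bound: "norm (Y n) \<le> 4 * norm \<theta>"
  by (rule LIMSEQ_le_const2[OF tendsto_norm[OF it_tendsto]]) (simp add: it_bound)

lemma Y_fixed: "Y n = lp_map \<theta> M N Y n"
proof (rule LIMSEQ_unique)
  show "(\<lambda>k. it (Suc k) n) \<longlonglongrightarrow> Y n"
    by (rule LIMSEQ_Suc[OF it_tendsto])
  show "(\<lambda>k. it (Suc k) n) \<longlonglongrightarrow> lp_map \<theta> M N Y n"
    unfolding lp_iter.simps lp_map_def
    by (cases n) (auto intro!: tendsto_add bounded_bilinear.tendsto[OF bounded_bilinear_blinfun_compose] it_tendsto tendsto_const)
qed

lemma \<theta>_Y: "\<theta> o\<^sub>L Y n = (case n of 0 \<Rightarrow> \<theta> | Suc m \<Rightarrow> (\<theta> o\<^sub>L M m) o\<^sub>L Y m)"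
proof -
  have "\<theta> o\<^sub>L (id_blinfun - \<theta> - (N o\<^sub>L M n)) = 0"
    by (simp add: blinfun_compose_simps idem \<theta>_N flip: blinfun_compose_assoc)
  then have "\<theta> o\<^sub>L ((id_blinfun - \<theta> - (N o\<^sub>L M n)) o\<^sub>L X) = 0" "\<theta> o\<^sub>L (N o\<^sub>L X) = 0"
    for X :: "'a \<Rightarrow>\<^sub>L 'a"
    using \<theta>_N by (simp_all flip: blinfun_compose_assoc)
  then have "\<theta> o\<^sub>L lp_map \<theta> M N Y n = \<theta> o\<^sub>L (case n of 0 \<Rightarrow> \<theta> | Suc m \<Rightarrow> (\<theta> o\<^sub>L M m) o\<^sub>L Y m)"
    unfolding lp_map_def bounded_bilinear.add_right[OF bounded_bilinear_blinfun_compose] by simp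
  also have "\<dots> = (case n of 0 \<Rightarrow> \<theta> | Suc m \<Rightarrow> (\<theta> o\<^sub>L M m) o\<^sub>L Y m)"
    by (cases n) (simp_all add: idem flip: blinfun_compose_assoc)
  finally show ?thesis using Y_fixed[of n] by simp
qed

text \<open>For the defect D = Y(n+1) - M Y(n) the fixed point equation only says N D = 0; applying
  \<open>H\<close> gives (id - \<theta>) D = 0. The component \<theta> D vanishes by
  \<open>\<theta>_Y\<close>.\<close>

lemma Y_Suc: "Y (Suc n) = M n o\<^sub>L Y n"
proof -
  have "Y n = (\<theta> o\<^sub>L Y n) + (((id_blinfun - \<theta> - (N o\<^sub>L M n)) o\<^sub>L Y n) + (N o\<^sub>L Y (Suc n)))"
    using Y_fixed[of n] unfolding \<theta>_Y lp_map_def by simp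
  then have "N o\<^sub>L (Y (Suc n) - (M n o\<^sub>L Y n)) = 0"
    by (simp add: blinfun_compose_simps blinfun_compose_assoc algebra_simps)
  then have "(H o\<^sub>L N) o\<^sub>L (Y (Suc n) - (M n o\<^sub>L Y n)) = 0"
    by (simp add: blinfun_compose_assoc)
  moreover have "\<theta> o\<^sub>L (Y (Suc n) - (M n o\<^sub>L Y n)) = 0"
    using \<theta>_Y[of "Suc n"] by (simp add: blinfun_compose_simps blinfun_compose_assoc)
  ultimately show ?thesis
    unfolding H_N by (simp add: blinfun_compose_simps)
qed

lemma \<theta>_Y_0: "\<theta> o\<^sub>L Y 0 = \<theta>"
  using \<theta>_Y[of 0] by simp

text \<open>The orbit Y(n) (v - \<theta> v) is bounded and starts with \<theta>-component 0, so it
  vanishes. Hence Y(0) is a projector with the kernel of \<theta>.\<close>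

lemma Y_0_\<theta>: "Y 0 o\<^sub>L \<theta> = Y 0"
proof (rule blinfun_eqI)
  fix v
  have "blinfun_apply (Y n) (v - blinfun_apply \<theta> v) = 0" for n
  proof (rule bounded_orbit_unique[where x = "\<lambda>n. blinfun_apply (Y n) (v - blinfun_apply \<theta> v)"])
    show "blinfun_apply (Y (Suc n)) (v - blinfun_apply \<theta> v) =
        blinfun_apply (M n) (blinfun_apply (Y n) (v - blinfun_apply \<theta> v))" for n
      by (simp add: Y_Suc)
    have "blinfun_apply (\<theta> o\<^sub>L Y 0) (v - blinfun_apply \<theta> v) = blinfun_apply (\<theta> - (\<theta> o\<^sub>L \<theta>)) v"
      unfolding \<theta>_Y_0 by (simp add: blinfun.bilinear_simps)
    then show "blinfun_apply \<theta> (blinfun_apply (Y 0) (v - blinfun_apply \<theta> v)) = 0"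
      by (simp add: idem)
    show "norm (blinfun_apply (Y n) (v - blinfun_apply \<theta> v)) \<le> 4 * norm \<theta> * norm (v - blinfun_apply \<theta> v)" for n
      by (rule order_trans[OF norm_blinfun mult_right_mono[OF Y_bound norm_ge_zero]])
  qed
  from this[of 0] show "blinfun_apply (Y 0 o\<^sub>L \<theta>) v = blinfun_apply (Y 0) v"
    by (simp add: blinfun.bilinear_simps)
qed

end

text \<open>Each iterate is a polynomial expression in the data, so congruence modulo compact
  operators is inherited; closedness of the compact operators then carries it to the limit.\<close>

lemma lp_iter_compact_eq:
  assumes "\<theta> \<sim>\<^sub>K \<theta>'" "\<And>n. M n \<sim>\<^sub>K M' n" "N \<sim>\<^sub>K N'"
  shows "lp_iter \<theta> M N k n \<sim>\<^sub>K lp_iter \<theta>' M' N' k n"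
proof (induction k arbitrary: n)
  case (Suc k)
  show ?case
    unfolding lp_iter.simps lp_map_def
    by (cases n) (simp_all add: compact_eq_add compact_eq_diff compact_eq_compose assms Suc)
qed simp

text \<open>For \<open>C\<close> a multiplication by a scalar, this is the source of scalar
  linearity of the limiting projector.\<close>

lemma lp_iter_commute:
  assumes "C o\<^sub>L \<theta> = \<theta> o\<^sub>L C" "\<And>n. C o\<^sub>L M n = M n o\<^sub>L C" "C o\<^sub>L N = N o\<^sub>L C"
  shows "C o\<^sub>L lp_iter \<theta> M N k n = lp_iter \<theta> M N k n o\<^sub>L C"
proof (induction k arbitrary: n)
  case (Suc k)
  have comp: "C o\<^sub>L (X o\<^sub>L Y) = (X o\<^sub>L Y) o\<^sub>L C"
    if "C o\<^sub>L X = X o\<^sub>L C" "C o\<^sub>L Y = Y o\<^sub>L C" for X Y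
    using that by (metis blinfun_compose_assoc)
  have diff: "C o\<^sub>L (X - Y) = (X - Y) o\<^sub>L C" and add: "C o\<^sub>L (X + Y) = (X + Y) o\<^sub>L C"
    if "C o\<^sub>L X = X o\<^sub>L C" "C o\<^sub>L Y = Y o\<^sub>L C" for X Y
    using that by (simp_all add: blinfun_compose_simps)
  have "C o\<^sub>L id_blinfun = id_blinfun o\<^sub>L C" by simp
  note rules = add diff comp assms Suc this
  show ?case
    unfolding lp_iter.simps lp_map_def
    by (cases n) (auto intro!: rules)
qed simp

text \<open>
  Iterating with the doubled maps \<open>2 M\<close> yields orbits of \<open>M\<close> that decay geometrically.
\<close>

definition stable_projector ::
    "('a::banach \<Rightarrow>\<^sub>L 'a) \<Rightarrow> (nat \<Rightarrow> ('a \<Rightarrow>\<^sub>L 'a)) \<Rightarrow> ('a \<Rightarrow>\<^sub>L 'a) \<Rightarrow> ('a \<Rightarrow>\<^sub>L 'a)" where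
  "stable_projector \<theta> M N = lp_projector \<theta> (\<lambda>n. 2 *\<^sub>R M n) ((1/2) *\<^sub>R N)"

locale stable_iteration =
  fixes \<theta> :: "'a::banach \<Rightarrow>\<^sub>L 'a" and M :: "nat \<Rightarrow> ('a \<Rightarrow>\<^sub>L 'a)" and N H :: "'a \<Rightarrow>\<^sub>L 'a"
  assumes idem: "\<theta> o\<^sub>L \<theta> = \<theta>" and \<theta>_N: "\<theta> o\<^sub>L N = 0" and H_N: "H o\<^sub>L N = id_blinfun - \<theta>"
    and norms: "\<And>n. norm (\<theta> o\<^sub>L M n) \<le> 1/8" "\<And>n. norm (id_blinfun - \<theta> - (N o\<^sub>L M n)) \<le> 1/4" "norm N \<le> 1/4"

sublocale stable_iteration \<subseteq> single: lyapunov_perron \<theta> M N H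
proof
  show "norm (\<theta> o\<^sub>L M n) \<le> 1/4" for n using norms(1)[of n] by simp
qed (use idem \<theta>_N H_N norms in auto)

text \<open>Halving \<open>N\<close> while doubling the maps leaves N M unchanged, so only the first
  coefficient grows, from 1/8 to 1/4. The undoubled instance supplies uniqueness, the doubled one
  the decaying orbits.\<close>

sublocale stable_iteration \<subseteq> double: lyapunov_perron \<theta> "\<lambda>n. 2 *\<^sub>R M n" "(1/2) *\<^sub>R N" "2 *\<^sub>R H"
proof
  show "norm (\<theta> o\<^sub>L (2 *\<^sub>R M n)) \<le> 1/4" for n using norms(1)[of n] by (simp add: blinfun_compose_simps)
  show "norm ((1/2) *\<^sub>R N) \<le> 1/4" using norms(3) norm_ge_zero[of N] by simp
qed (use idem \<theta>_N H_N norms in \<open>auto simp: blinfun_compose_simps\<close>)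

context stable_iteration
begin

abbreviation "P \<equiv> stable_projector \<theta> M N"

lemma P_eq: "P = double.Y 0"
  unfolding stable_projector_def by (rule double.Y_0)

lemma \<theta>_P: "\<theta> o\<^sub>L P = \<theta>"
  unfolding P_eq by (rule double.\<theta>_Y_0)

lemma P_\<theta>: "P o\<^sub>L \<theta> = P"
  unfolding P_eq by (rule double.Y_0_\<theta>)

text \<open>The orbit y(n) = 2^-n Y(n) x(0) of \<open>M\<close> starts at P x(0) and tends to 0. If
  x tends to 0 as well, x - y is a bounded orbit of \<open>M\<close> with initial \<theta>-component
  0, hence zero.\<close>

lemma orbit_tendsto_iff:
  assumes orbit: "\<And>n. x (Suc n) = blinfun_apply (M n) (x n)"
  shows "x \<longlonglongrightarrow> 0 \<longleftrightarrow> blinfun_apply P (x 0) = x 0"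
proof -
  let ?y = "\<lambda>n. (1/2)^n *\<^sub>R blinfun_apply (double.Y n) (x 0)"
  have y_Suc: "?y (Suc n) = blinfun_apply (M n) (?y n)" for n
    by (simp add: double.Y_Suc blinfun.bilinear_simps)
  let ?B = "4 * norm \<theta> * norm (x 0)"
  have Y_le: "norm (blinfun_apply (double.Y n) (x 0)) \<le> ?B" for n
    by (rule order_trans[OF norm_blinfun mult_right_mono[OF double.Y_bound norm_ge_zero]])
  have y_le: "norm (?y n) \<le> (1/2)^n * ?B" for n
    using mult_left_mono[OF Y_le[of n], of "(1/2)^n"] by simp
  have y_lim: "?y \<longlonglongrightarrow> 0"
  proof (rule Lim_null_comparison)
    have "(\<lambda>n. (1/2)^n * ?B) \<longlonglongrightarrow> 0 * ?B"
      by (intro tendsto_mult tendsto_const LIMSEQ_power_zero) simp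
    then show "(\<lambda>n. (1/2)^n * ?B) \<longlonglongrightarrow> 0" by simp
  qed (intro always_eventually allI y_le)
  show ?thesis
  proof
    assume "x \<longlonglongrightarrow> 0"
    then have lim: "(\<lambda>n. x n - ?y n) \<longlonglongrightarrow> 0"
      using tendsto_diff[OF \<open>x \<longlonglongrightarrow> 0\<close> y_lim] by simp
    then obtain C where C: "\<And>n. norm (x n - ?y n) \<le> C"
      using convergent_imp_Bseq[OF convergentI[OF lim]] unfolding Bseq_def by blast
    have "x n - ?y n = 0" for n
    proof (rule single.bounded_orbit_unique[where x = "\<lambda>n. x n - ?y n"])
      show "x (Suc n) - ?y (Suc n) = blinfun_apply (M n) (x n - ?y n)" for n
        unfolding y_Suc orbit by (simp add: blinfun.diff_right)
      have "blinfun_apply (\<theta> o\<^sub>L P) (x 0) = blinfun_apply \<theta> (x 0)" by (simp only: \<theta>_P)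
      then show "blinfun_apply \<theta> (x 0 - ?y 0) = 0"
        by (simp add: P_eq blinfun.diff_right)
    qed (rule C)
    from this[of 0] show "blinfun_apply P (x 0) = x 0" by (simp add: P_eq)
  next
    assume P: "blinfun_apply P (x 0) = x 0"
    have "x n = ?y n" for n
    proof (induction n)
      case 0 then show ?case using P by (simp add: P_eq)
    next
      case (Suc n) then show ?case unfolding y_Suc orbit by simp
    qed
    then have "x = ?y" by blast
    then show "x \<longlonglongrightarrow> 0" using y_lim by simp
  qed
qed

text \<open>P and \<theta> have the same kernel, so (P - \<theta>)^2 = 0 and \<open>U\<close> is a
  shear with inverse \<open>U'\<close>. It moves the range of \<theta> onto that of P because U
  \<theta> = P.\<close>

definition "U = id_blinfun + P - \<theta>"
definition "U' = id_blinfun - P + \<theta>"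

lemma P_P: "P o\<^sub>L P = P"
  by (metis P_\<theta> \<theta>_P blinfun_compose_assoc)

lemma U_U': "U o\<^sub>L U' = id_blinfun" and U'_U: "U' o\<^sub>L U = id_blinfun"
  unfolding U_def U'_def by (simp_all add: blinfun_compose_simps P_P \<theta>_P P_\<theta> idem)

lemma range_P_eq: "{x. blinfun_apply P x = x} = blinfun_apply U ` range (blinfun_apply \<theta>)"
proof -
  have U_\<theta>: "U o\<^sub>L \<theta> = P"
    unfolding U_def by (simp add: blinfun_compose_simps P_\<theta> idem)
  have "{x. blinfun_apply P x = x} = range (blinfun_apply P)"
    using P_P by (auto simp: image_iff) (metis blinfun_apply_blinfun_compose)+
  also have "\<dots> = range (blinfun_apply (U o\<^sub>L \<theta>))" by (simp only: U_\<theta>)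
  also have "\<dots> = blinfun_apply U ` range (blinfun_apply \<theta>)" by (auto simp: image_iff)
  finally show ?thesis .
qed

end

lemma stable_projector_compact_eq:
  assumes "stable_iteration \<theta> M N H" "stable_iteration \<theta>' M' N' H'"
    and "\<theta> \<sim>\<^sub>K \<theta>'" "\<And>n. M n \<sim>\<^sub>K M' n" "N \<sim>\<^sub>K N'"
  shows "stable_projector \<theta> M N \<sim>\<^sub>K stable_projector \<theta>' M' N'"
proof -
  interpret A: stable_iteration \<theta> M N H by fact
  interpret B: stable_iteration \<theta>' M' N' H' by fact
  have scale: "r *\<^sub>R S \<sim>\<^sub>K r *\<^sub>R S'" if "S \<sim>\<^sub>K S'" for r and S S' :: "'a \<Rightarrow>\<^sub>L 'a"
    using compact_operator_scaleR that unfolding compact_eq_def by (metis scaleR_diff_right)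
  show ?thesis
    unfolding A.P_eq B.P_eq
    by (rule compact_eq_tendsto[OF A.double.it_tendsto B.double.it_tendsto])
      (auto intro!: always_eventually lp_iter_compact_eq scale assms)
qed

lemma stable_projector_commute:
  assumes "stable_iteration \<theta> M N H"
    and "C o\<^sub>L \<theta> = \<theta> o\<^sub>L C" "\<And>n. C o\<^sub>L M n = M n o\<^sub>L C" "C o\<^sub>L N = N o\<^sub>L C"
  shows "C o\<^sub>L stable_projector \<theta> M N = stable_projector \<theta> M N o\<^sub>L C"
proof -
  interpret A: stable_iteration \<theta> M N H by fact
  have eq: "C o\<^sub>L A.double.it k 0 = A.double.it k 0 o\<^sub>L C" for k
    by (rule lp_iter_commute) (simp_all add: assms blinfun_compose_simps)
  have "(\<lambda>k. C o\<^sub>L A.double.it k 0) \<longlonglongrightarrow> (C o\<^sub>L A.double.Y 0)"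
    by (intro bounded_bilinear.tendsto[OF bounded_bilinear_blinfun_compose] A.double.it_tendsto tendsto_const)
  moreover have "(\<lambda>k. C o\<^sub>L A.double.it k 0) \<longlonglongrightarrow> (A.double.Y 0 o\<^sub>L C)"
    unfolding eq
    by (intro bounded_bilinear.tendsto[OF bounded_bilinear_blinfun_compose] A.double.it_tendsto tendsto_const)
  ultimately show ?thesis
    unfolding A.P_eq by (rule LIMSEQ_unique)
qed

subsection \<open>The stable space of an asymptotically hyperbolic path\<close>

definition sampled :: "(real \<Rightarrow> ('a::banach \<Rightarrow>\<^sub>L 'a)) \<Rightarrow> real \<Rightarrow> real \<Rightarrow> nat \<Rightarrow> ('a \<Rightarrow>\<^sub>L 'a)" where
  "sampled A \<tau> T n = evolution A (T + real n * \<tau>) \<tau>"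

definition unstable_inverse :: "('a::banach \<Rightarrow>\<^sub>L 'a) \<Rightarrow> ('a \<Rightarrow>\<^sub>L 'a) \<Rightarrow> real \<Rightarrow> ('a \<Rightarrow>\<^sub>L 'a)" where
  "unstable_inverse A0 \<theta> \<tau> = fundamental_solution (\<lambda>_. - A0) \<tau> o\<^sub>L (id_blinfun - \<theta>)"

text \<open>The step \<tau> is taken long enough for the unperturbed coefficients to be small; for
  that fixed \<tau>, the starting time is late enough for every sampled propagator to be close to
  exp (\<tau> A0). The closeness required depends on \<tau>, hence the nested quantifiers.\<close>

lemma eventually_stable_iteration:
  assumes A: "bounded_path A" and lim: "(A \<longlongrightarrow> A0) at_top" and dich: "dichotomy A0 \<theta>"
  shows "\<forall>\<^sub>F \<tau> in at_top. \<forall>\<^sub>F T in at_top.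
    stable_iteration \<theta> (sampled A \<tau> T) (unstable_inverse A0 \<theta> \<tau>) (fundamental_solution (\<lambda>_. A0) \<tau>)"
proof -
  let ?X = "fundamental_solution (\<lambda>_. A0)" and ?Y = "fundamental_solution (\<lambda>_. - A0)"
  let ?N = "unstable_inverse A0 \<theta>"
  have \<theta>: "\<theta> o\<^sub>L A0 = A0 o\<^sub>L \<theta>" "((\<lambda>t. ?X t o\<^sub>L \<theta>) \<longlongrightarrow> 0) at_top" "(?N \<longlongrightarrow> 0) at_top"
    using dich unfolding dichotomy_def unstable_inverse_def by auto
  have idem: "\<theta> o\<^sub>L \<theta> = \<theta>" by (rule dichotomy_idem[OF dich])
  obtain a0 where "\<forall>t\<ge>0. norm (A t) \<le> a0" using A unfolding bounded_path_def by auto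
  then obtain a where a: "a > 0" "\<And>t. t \<ge> 0 \<Longrightarrow> norm (A t) \<le> a" "norm A0 \<le> a"
  proof (intro that[of "\<bar>a0\<bar> + norm A0 + 1"])
    fix t :: real assume "t \<ge> 0"
    then have "norm (A t) \<le> \<bar>a0\<bar>" using \<open>\<forall>t\<ge>0. norm (A t) \<le> a0\<close> by (meson abs_ge_self order_trans)
    then show "norm (A t) \<le> \<bar>a0\<bar> + norm A0 + 1" using norm_ge_zero[of A0] by linarith
  qed (simp_all add: add_nonneg_pos)
  have small: "\<forall>\<^sub>F t in at_top. norm (f t) < e" if "(f \<longlongrightarrow> 0) at_top" "e > 0" for f :: "real \<Rightarrow> 'a \<Rightarrow>\<^sub>L 'a" and e
    using tendstoD[OF that] by (simp add: dist_norm)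
  have e: "1/16 > (0::real)" "1/4 > (0::real)" by simp_all
  show ?thesis
    using eventually_ge_at_top[of 0] small[OF \<theta>(2) e(1)] small[OF \<theta>(3) e(2)]
  proof eventually_elim
    case (elim \<tau>)
    \<comment> \<open>\<open>c\<close> dominates both operators that are multiplied with the
      propagator error.\<close>
    define c where "c = norm \<theta> + norm (?N \<tau>) + 1"
    define K where "K = 4 * \<tau> * exp (2 * a * \<tau>) * exp (2 * a * \<tau>) + 1"
    have cK: "c > 0" "K > 0" using elim by (simp_all add: c_def K_def add_nonneg_pos)
    \<comment> \<open>Chosen so that the propagator error over one step is at most 1/(16 c). Then
      \<theta> M is bounded by 1/16 + 1/16 and id - \<theta> - N M by 1/16.\<close>
    define \<delta> where "\<delta> = 1 / (16 * c * K)"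
    have \<delta>: "\<delta> > 0" using cK by (simp add: \<delta>_def)
    obtain T0 where T0: "\<And>t. t \<ge> T0 \<Longrightarrow> norm (A t - A0) < \<delta>"
      using tendstoD[OF lim \<delta>] unfolding eventually_at_top_linorder dist_norm by blast
    show "\<forall>\<^sub>F T in at_top. stable_iteration \<theta> (sampled A \<tau> T) (?N \<tau>) (?X \<tau>)"
      using eventually_ge_at_top[of "max 0 T0"]
    proof eventually_elim
      case (elim T)
      have close: "norm (sampled A \<tau> T n - ?X \<tau>) \<le> 1 / (16 * c)" for n
      proof -
        have t: "T + real n * \<tau> \<ge> 0" "T + real n * \<tau> \<ge> T0"
          using elim \<open>0 \<le> \<tau>\<close> by (auto intro: add_nonneg_nonneg add_increasing2)
        have "norm (evolution A (T + real n * \<tau>) \<tau> - ?X \<tau>) \<le>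
            \<delta> * (4 * \<tau> * exp (2 * a * \<tau>) * exp (2 * a * \<tau>))"
          by (rule evolution_close[OF A a t(1) \<open>0 \<le> \<tau>\<close>]) (use T0 t in \<open>auto intro: less_imp_le\<close>)
        also have "\<dots> \<le> \<delta> * K" using \<delta> by (intro mult_left_mono) (auto simp: K_def)
        also have "\<dots> = 1 / (16 * c)" using cK by (simp add: \<delta>_def)
        finally show ?thesis by (simp add: sampled_def)
      qed
      have X\<theta>: "\<theta> o\<^sub>L ?X \<tau> = ?X \<tau> o\<^sub>L \<theta>"
        by (rule fundamental_solution_const_commute[OF \<theta>(1) \<open>0 \<le> \<tau>\<close>])
      have Y\<theta>: "\<theta> o\<^sub>L ?Y \<tau> = ?Y \<tau> o\<^sub>L \<theta>"
        by (rule fundamental_solution_const_commute[OF _ \<open>0 \<le> \<tau>\<close>]) (simp add: \<theta>(1) blinfun_compose_simps)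
      have NX: "?N \<tau> o\<^sub>L ?X \<tau> = id_blinfun - \<theta>"
      proof -
        have "?N \<tau> o\<^sub>L ?X \<tau> = ?Y \<tau> o\<^sub>L (?X \<tau> o\<^sub>L (id_blinfun - \<theta>))"
          unfolding unstable_inverse_def by (simp add: blinfun_compose_simps blinfun_compose_assoc X\<theta>)
        then show ?thesis
          by (simp add: fundamental_solution_minus_left[OF \<open>0 \<le> \<tau>\<close>] flip: blinfun_compose_assoc)
      qed
      show ?case
      proof
        show "\<theta> o\<^sub>L ?N \<tau> = 0"
          unfolding unstable_inverse_def
          by (simp add: Y\<theta> flip: blinfun_compose_assoc) (simp add: blinfun_compose_simps blinfun_compose_assoc idem)
        show "?X \<tau> o\<^sub>L ?N \<tau> = id_blinfun - \<theta>"
          unfolding unstable_inverse_def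
          by (simp add: fundamental_solution_minus_right[OF \<open>0 \<le> \<tau>\<close>] flip: blinfun_compose_assoc)
        show "norm (?N \<tau>) \<le> 1/4" using \<open>norm (?N \<tau>) < 1/4\<close> by simp
        show "norm (\<theta> o\<^sub>L sampled A \<tau> T n) \<le> 1/8" for n
        proof -
          have "norm (\<theta> o\<^sub>L (sampled A \<tau> T n - ?X \<tau>)) \<le> c * (1 / (16 * c))"
            by (rule order_trans[OF norm_blinfun_compose mult_mono[OF _ close]]) (use cK in \<open>auto simp: c_def\<close>)
          also have "\<dots> = 1/16" using cK by simp
          finally have "norm (\<theta> o\<^sub>L (sampled A \<tau> T n - ?X \<tau>)) \<le> 1/16" .
          moreover have "\<theta> o\<^sub>L sampled A \<tau> T n = (\<theta> o\<^sub>L (sampled A \<tau> T n - ?X \<tau>)) + (?X \<tau> o\<^sub>L \<theta>)"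
            by (simp add: blinfun_compose_simps X\<theta>)
          ultimately show ?thesis
            using norm_triangle_ineq[of "\<theta> o\<^sub>L (sampled A \<tau> T n - ?X \<tau>)" "?X \<tau> o\<^sub>L \<theta>"]
              \<open>norm (?X \<tau> o\<^sub>L \<theta>) < 1/16\<close> by simp
        qed
        show "norm (id_blinfun - \<theta> - (?N \<tau> o\<^sub>L sampled A \<tau> T n)) \<le> 1/4" for n
        proof -
          have "id_blinfun - \<theta> - (?N \<tau> o\<^sub>L sampled A \<tau> T n) = - (?N \<tau> o\<^sub>L (sampled A \<tau> T n - ?X \<tau>))"
            by (simp add: blinfun_compose_simps NX)
          moreover have "norm (?N \<tau> o\<^sub>L (sampled A \<tau> T n - ?X \<tau>)) \<le> c * (1 / (16 * c))"
            by (rule order_trans[OF norm_blinfun_compose mult_mono[OF _ close]]) (use cK in \<open>auto simp: c_def\<close>)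
          ultimately show ?thesis using cK by simp
        qed
      qed (rule idem)
    qed
  qed
qed

lemma evolution_fundamental_solution:
  assumes "bounded_path A" "t0 \<ge> 0"
  shows "evolution A t0 t o\<^sub>L fundamental_solution A t0 = fundamental_solution A (t0 + t)"
  unfolding evolution_def by (simp add: blinfun_compose_assoc inverse_solution_left assms)

text \<open>Between two samples a solution grows at most by the factor 2 exp (2 a \<tau>), so decay
  along the samples forces decay in continuous time.\<close>

lemma stable_space_iff_sampled:
  assumes A: "bounded_path A" and \<tau>: "\<tau> > 0" and T: "T \<ge> 0"
  shows "x \<in> stable_space A \<longleftrightarrow> (\<lambda>n. blinfun_apply (fundamental_solution A (T + real n * \<tau>)) x) \<longlonglongrightarrow> 0"
    (is "_ \<longleftrightarrow> ?y \<longlonglongrightarrow> 0")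
proof
  assume "x \<in> stable_space A"
  then have lim: "((\<lambda>t. blinfun_apply (fundamental_solution A t) x) \<longlongrightarrow> 0) at_top"
    by (simp add: stable_space_def)
  have "filterlim (\<lambda>n. T + real n * \<tau>) at_top sequentially"
    by (intro filterlim_tendsto_add_at_top[OF tendsto_const] filterlim_at_top_mult_tendsto_pos[OF tendsto_const \<tau>]
        filterlim_real_sequentially)
  from filterlim_compose[OF lim this] show "?y \<longlonglongrightarrow> 0" .
next
  assume y: "?y \<longlonglongrightarrow> 0"
  \<comment> \<open>The index of the last sampling time that does not exceed
    \<open>t\<close>.\<close>
  define n where "n = (\<lambda>t. nat \<lfloor>(t - T) / \<tau>\<rfloor>)"
  obtain a0 where a0: "\<forall>t\<ge>0. norm (A t) \<le> a0" using A unfolding bounded_path_def by auto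
  define a where "a = \<bar>a0\<bar> + 1"
  have a: "a > 0" "\<And>t. t \<ge> 0 \<Longrightarrow> norm (A t) \<le> a" using a0 by (fastforce simp: a_def)+
  have le: "norm (blinfun_apply (fundamental_solution A t) x) \<le> 2 * exp (2 * a * \<tau>) * norm (?y (n t))"
    if t: "t \<ge> T" for t
  proof -
    define t0 where "t0 = T + real (n t) * \<tau>"
    have fl: "real (n t) \<le> (t - T) / \<tau>" "(t - T) / \<tau> < real (n t) + 1"
      using t \<tau> unfolding n_def by (simp_all add: floor_le_iff)
    then have t0: "t0 \<le> t" "t < t0 + \<tau>" "t0 \<ge> 0"
      using \<tau> T unfolding t0_def by (simp_all add: field_simps)
    have "norm (evolution A t0 (t - t0)) \<le> 2 * exp (2 * a * (t - t0))"
      by (rule norm_evolution_le[OF A a]) (use t0 in auto)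
    also have "\<dots> \<le> 2 * exp (2 * a * \<tau>)" using t0 a by simp
    finally have "norm (blinfun_apply (evolution A t0 (t - t0)) (?y (n t))) \<le> 2 * exp (2 * a * \<tau>) * norm (?y (n t))"
      by (intro order_trans[OF norm_blinfun mult_right_mono]) auto
    moreover have "blinfun_apply (evolution A t0 (t - t0)) (?y (n t)) = blinfun_apply (fundamental_solution A t) x"
      using evolution_fundamental_solution[OF A t0(3), of "t - t0"]
      unfolding t0_def[symmetric] by (metis add_diff_cancel_left' blinfun_apply_blinfun_compose diff_add_cancel add.commute)
    ultimately show ?thesis by simp
  qed
  have "filterlim n sequentially at_top"
    unfolding filterlim_at_top
  proof
    fix Z
    show "\<forall>\<^sub>F t in at_top. Z \<le> n t"
      using eventually_ge_at_top[of "T + real Z * \<tau>"]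
    proof eventually_elim
      case (elim t)
      then have "real Z \<le> (t - T) / \<tau>" using \<tau> by (simp add: field_simps)
      then show ?case unfolding n_def by (rule le_nat_floor)
    qed
  qed
  from filterlim_compose[OF y this] have "((\<lambda>t. ?y (n t)) \<longlongrightarrow> 0) at_top" .
  then have "((\<lambda>t. 2 * exp (2 * a * \<tau>) * norm (?y (n t))) \<longlongrightarrow> 0) at_top"
    by (intro tendsto_mult_right_zero tendsto_norm_zero)
  moreover have "\<forall>\<^sub>F t in at_top. norm (blinfun_apply (fundamental_solution A t) x) \<le> 2 * exp (2 * a * \<tau>) * norm (?y (n t))"
    using eventually_ge_at_top[of T] by (rule eventually_mono) (rule le)
  ultimately show "x \<in> stable_space A"
    unfolding stable_space_def mem_Collect_eq by (rule Lim_null_comparison[rotated])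
qed

definition stable_iso ::
    "(real \<Rightarrow> ('a::banach \<Rightarrow>\<^sub>L 'a)) \<Rightarrow> ('a \<Rightarrow>\<^sub>L 'a) \<Rightarrow> ('a \<Rightarrow>\<^sub>L 'a) \<Rightarrow> real \<Rightarrow> real \<Rightarrow> ('a \<Rightarrow>\<^sub>L 'a)" where
  "stable_iso A A0 \<theta> \<tau> T = inverse_solution A T o\<^sub>L
     (id_blinfun + stable_projector \<theta> (sampled A \<tau> T) (unstable_inverse A0 \<theta> \<tau>) - \<theta>)"

lemma stable_iso:
  assumes A: "bounded_path A" and \<tau>: "\<tau> > 0" and T: "T \<ge> 0"
    and "stable_iteration \<theta> (sampled A \<tau> T) (unstable_inverse A0 \<theta> \<tau>) H"
  shows "\<exists>V. stable_iso A A0 \<theta> \<tau> T o\<^sub>L V = id_blinfun \<and> V o\<^sub>L stable_iso A A0 \<theta> \<tau> T = id_blinfun"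
    and "stable_space A = blinfun_apply (stable_iso A A0 \<theta> \<tau> T) ` range (blinfun_apply \<theta>)"
proof -
  interpret stable_iteration \<theta> "sampled A \<tau> T" "unstable_inverse A0 \<theta> \<tau>" H by fact
  let ?X = "fundamental_solution A T" and ?Z = "inverse_solution A T"
  have iso: "stable_iso A A0 \<theta> \<tau> T = ?Z o\<^sub>L U"
    by (simp add: stable_iso_def U_def)
  have XZ: "?X o\<^sub>L ?Z = id_blinfun" "?Z o\<^sub>L ?X = id_blinfun"
    by (simp_all add: inverse_solution_left inverse_solution_right A T)
  have "(?Z o\<^sub>L U) o\<^sub>L (U' o\<^sub>L ?X) = ?Z o\<^sub>L ((U o\<^sub>L U') o\<^sub>L ?X)"
    "(U' o\<^sub>L ?X) o\<^sub>L (?Z o\<^sub>L U) = U' o\<^sub>L ((?X o\<^sub>L ?Z) o\<^sub>L U)"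
    by (simp_all only: blinfun_compose_assoc)
  then show "\<exists>V. stable_iso A A0 \<theta> \<tau> T o\<^sub>L V = id_blinfun \<and> V o\<^sub>L stable_iso A A0 \<theta> \<tau> T = id_blinfun"
    unfolding iso by (intro exI[of _ "U' o\<^sub>L ?X"]) (simp add: U_U' U'_U XZ)
  \<comment> \<open>The samples of the solution through \<open>x\<close> form an orbit of the
    sampled propagators starting at X(T) x, so decay becomes a fixed point condition on X(T)
    x.\<close>
  have "x \<in> stable_space A \<longleftrightarrow> blinfun_apply P (blinfun_apply ?X x) = blinfun_apply ?X x" for x
  proof -
    define y where "y = (\<lambda>n. blinfun_apply (fundamental_solution A (T + real n * \<tau>)) x)"
    have "y (Suc n) = blinfun_apply (sampled A \<tau> T n) (y n)" for n
    proof -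
      have t: "T + real n * \<tau> \<ge> 0" using T \<tau> by simp
      have "y (Suc n) = blinfun_apply (fundamental_solution A ((T + real n * \<tau>) + \<tau>)) x"
        by (simp add: y_def algebra_simps)
      then show ?thesis
        by (simp add: sampled_def y_def flip: evolution_fundamental_solution[OF A t])
    qed
    from orbit_tendsto_iff[OF this] show ?thesis
      unfolding stable_space_iff_sampled[OF A \<tau> T] y_def by simp
  qed
  then have "stable_space A = {x. blinfun_apply ?X x \<in> {y. blinfun_apply P y = y}}" by auto
  also have "\<dots> = blinfun_apply ?Z ` {y. blinfun_apply P y = y}"
    using XZ by (auto simp: image_iff) (metis blinfun_apply_blinfun_compose blinfun_apply_id_blinfun)+
  also have "\<dots> = blinfun_apply (stable_iso A A0 \<theta> \<tau> T) ` range (blinfun_apply \<theta>)"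
    unfolding range_P_eq iso by (auto simp: image_iff)
  finally show "stable_space A = blinfun_apply (stable_iso A A0 \<theta> \<tau> T) ` range (blinfun_apply \<theta>)" .
qed

lemma stable_iso_compact_eq:
  assumes A: "bounded_path A" and B: "bounded_path B" and \<tau>: "\<tau> > 0" and T: "T \<ge> 0"
    and iA: "stable_iteration \<theta> (sampled A \<tau> T) (unstable_inverse A0 \<theta> \<tau>) H"
    and iB: "stable_iteration \<theta>' (sampled B \<tau> T) (unstable_inverse B0 \<theta>' \<tau>) H'"
    and AB: "\<And>t. t \<ge> 0 \<Longrightarrow> A t \<sim>\<^sub>K B t" and AB0: "A0 \<sim>\<^sub>K B0" and \<theta>: "\<theta> \<sim>\<^sub>K \<theta>'"
  shows "stable_iso A A0 \<theta> \<tau> T \<sim>\<^sub>K stable_iso B B0 \<theta>' \<tau> T"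
proof -
  note X = fundamental_solution_compact_eq[OF B A AB]
  have "- A0 \<sim>\<^sub>K - B0"
    using compact_eq_diff[OF compact_eq_refl[of 0] AB0] by simp
  then have "unstable_inverse A0 \<theta> \<tau> \<sim>\<^sub>K unstable_inverse B0 \<theta>' \<tau>"
    unfolding unstable_inverse_def
    by (intro compact_eq_compose compact_eq_diff \<theta> compact_eq_refl fundamental_solution_compact_eq(1))
      (use \<tau> in auto)
  moreover have "sampled A \<tau> T n \<sim>\<^sub>K sampled B \<tau> T n" for n
    unfolding sampled_def evolution_def using \<tau> T by (intro compact_eq_compose X) auto
  ultimately show ?thesis
    unfolding stable_iso_def
    by (intro compact_eq_compose compact_eq_diff compact_eq_add \<theta> compact_eq_refl X(2) T
        stable_projector_compact_eq[OF iA iB])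
qed

lemma stable_iso_commute:
  assumes A: "bounded_path A" and \<tau>: "\<tau> > 0" and T: "T \<ge> 0"
    and iA: "stable_iteration \<theta> (sampled A \<tau> T) (unstable_inverse A0 \<theta> \<tau>) H"
    and C: "\<And>t. t \<ge> 0 \<Longrightarrow> C o\<^sub>L A t = A t o\<^sub>L C" "C o\<^sub>L A0 = A0 o\<^sub>L C" "C o\<^sub>L \<theta> = \<theta> o\<^sub>L C"
  shows "C o\<^sub>L stable_iso A A0 \<theta> \<tau> T = stable_iso A A0 \<theta> \<tau> T o\<^sub>L C"
proof -
  have comp: "C o\<^sub>L (X o\<^sub>L Y) = (X o\<^sub>L Y) o\<^sub>L C"
    if "C o\<^sub>L X = X o\<^sub>L C" "C o\<^sub>L Y = Y o\<^sub>L C" for X Y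
    using that by (metis blinfun_compose_assoc)
  have X: "C o\<^sub>L fundamental_solution A t = fundamental_solution A t o\<^sub>L C"
    "C o\<^sub>L inverse_solution A t = inverse_solution A t o\<^sub>L C" if "t \<ge> 0" for t
    using fundamental_solution_intertwine[OF A A C(1) that] inverse_solution_commute[OF A C(1) that] by simp_all
  have "C o\<^sub>L (id_blinfun - \<theta>) = (id_blinfun - \<theta>) o\<^sub>L C" by (simp add: blinfun_compose_simps C)
  then have N: "C o\<^sub>L unstable_inverse A0 \<theta> \<tau> = unstable_inverse A0 \<theta> \<tau> o\<^sub>L C"
    unfolding unstable_inverse_def using \<tau> C(2)
    by (intro comp fundamental_solution_const_commute) (auto simp: blinfun_compose_simps)
  have "C o\<^sub>L sampled A \<tau> T n = sampled A \<tau> T n o\<^sub>L C" for n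
    unfolding sampled_def evolution_def using \<tau> T by (intro comp X) auto
  from stable_projector_commute[OF iA C(3) this N]
  have "C o\<^sub>L (id_blinfun + stable_projector \<theta> (sampled A \<tau> T) (unstable_inverse A0 \<theta> \<tau>) - \<theta>) =
      (id_blinfun + stable_projector \<theta> (sampled A \<tau> T) (unstable_inverse A0 \<theta> \<tau>) - \<theta>) o\<^sub>L C"
    by (simp add: blinfun_compose_simps C(3))
  then show ?thesis
    unfolding stable_iso_def using X(2)[OF T] by (intro comp)
qed

subsection \<open>The index of a linear map\<close>

locale scaling = vector_space scale
  for scale :: "'k::field \<Rightarrow> 'b::ab_group_add \<Rightarrow> 'b"
begin

text \<open>\<open>dim\<close> is 0 for infinite-dimensional spaces, so finiteness has to be carried
  separately.\<close>

definition finite_dim :: "'b set \<Rightarrow> bool" where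
  "finite_dim V \<longleftrightarrow> (\<exists>B. finite B \<and> V \<subseteq> span B)"

definition direct_sum :: "'b set \<Rightarrow> 'b set \<Rightarrow> 'b set \<Rightarrow> bool" where
  "direct_sum A B Y \<longleftrightarrow> subspace A \<and> subspace B \<and> A \<inter> B = {0} \<and> {a + b |a b. a \<in> A \<and> b \<in> B} = Y"

text \<open>Linearity on a set only, because components along a direct sum are determined only on
  that sum.\<close>

definition lin_on :: "'b set \<Rightarrow> ('b \<Rightarrow> 'b) \<Rightarrow> bool" where
  "lin_on V f \<longleftrightarrow> (\<forall>x\<in>V. \<forall>y\<in>V. f (x + y) = f x + f y) \<and> (\<forall>c. \<forall>x\<in>V. f (scale c x) = scale c (f x))"

lemma finite_dim_subset: "finite_dim V \<Longrightarrow> W \<subseteq> V \<Longrightarrow> finite_dim W"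
  unfolding finite_dim_def by blast

lemma lin_on_subset: "lin_on V f \<Longrightarrow> W \<subseteq> V \<Longrightarrow> lin_on W f"
  unfolding lin_on_def by blast

lemma lin_on_zero: "lin_on V f \<Longrightarrow> 0 \<in> V \<Longrightarrow> f 0 = 0"
  unfolding lin_on_def by (metis add_cancel_right_left)

lemma lin_on_diff:
  assumes f: "lin_on V f" and V: "subspace V" and xy: "x \<in> V" "y \<in> V"
  shows "f (x - y) = f x - f y"
proof -
  have "x - y \<in> V" using V xy by (rule subspace_diff)
  then have "f ((x - y) + y) = f (x - y) + f y" using f xy unfolding lin_on_def by blast
  then show ?thesis by simp
qed

lemma lin_on_inj:
  assumes f: "lin_on V f" and V: "subspace V" and "\<And>x. x \<in> V \<Longrightarrow> f x = 0 \<Longrightarrow> x = 0"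
  shows "inj_on f V"
proof (rule inj_onI)
  fix x y assume xy: "x \<in> V" "y \<in> V" "f x = f y"
  then have "f (x - y) = 0" using lin_on_diff[OF f V] by simp
  then show "x = y" using assms(3)[of "x - y"] subspace_diff[OF V xy(1,2)] by simp
qed

lemma lin_on_subspace_image:
  assumes f: "lin_on V f" and V: "subspace V"
  shows "subspace (f ` V)"
  unfolding subspace_def
proof (intro conjI ballI allI)
  show "0 \<in> f ` V" using lin_on_zero[OF f] subspace_0[OF V] by (metis imageI)
  fix x assume "x \<in> f ` V"
  then obtain v where v: "v \<in> V" "x = f v" by blast
  show "scale c x \<in> f ` V" for c
    using f v subspace_scale[OF V v(1)] unfolding lin_on_def by (metis imageI)
  fix y assume "y \<in> f ` V"
  then obtain w where w: "w \<in> V" "y = f w" by blast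
  show "x + y \<in> f ` V"
    using f v w subspace_add[OF V v(1) w(1)] unfolding lin_on_def by (metis imageI)
qed

lemma lin_on_subspace_kernel:
  assumes f: "lin_on V f" and V: "subspace V"
  shows "subspace {x \<in> V. f x = 0}"
  unfolding subspace_def
  using f V lin_on_zero[OF f subspace_0[OF V]]
  by (auto simp: lin_on_def subspace_0 subspace_add subspace_scale)

text \<open>A purely algebraic projection, without continuity. It supplies complements and extends
  maps from \<open>V\<close> to the whole space.\<close>

lemma projection_exists:
  assumes "subspace V"
  obtains g where "lin_on UNIV g" "range g \<subseteq> V" "\<And>v. v \<in> V \<Longrightarrow> g v = v"
proof -
  interpret p: vector_space_pair scale scale by unfold_locales
  have "Vector_Spaces.linear scale scale id"
    by (simp add: Vector_Spaces.linear_iff vector_space_axioms)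
  from p.linear_exists_left_inverse_on[OF this assms] obtain g
    where "g ` UNIV \<subseteq> V" "Vector_Spaces.linear scale scale g" "\<forall>v\<in>V. g (id v) = v" by auto
  then show ?thesis by (intro that[of g]) (auto simp: lin_on_def Vector_Spaces.linear_iff)
qed

lemma finite_dim_basis:
  assumes "subspace V" "finite_dim V"
  obtains B where "finite B" "B \<subseteq> V" "independent B" "span B = V" "card B = dim V"
proof -
  obtain B where B: "B \<subseteq> V" "independent B" "V \<subseteq> span B" "card B = dim V"
    by (rule basis_exists)
  obtain F where "finite F" "V \<subseteq> span F" using assms(2) unfolding finite_dim_def by blast
  then have "finite B" using independent_span_bound[of F B] B by blast
  moreover have "span B = V" using B span_minimal[OF B(1) assms(1)] by blast
  ultimately show ?thesis using that B by blast
qed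

text \<open>Composing \<open>f\<close> with a projection onto \<open>V\<close> makes it linear
  everywhere, so that bases can be transported.\<close>

lemma lin_on_image_dim:
  assumes V: "subspace V" and f: "lin_on V f" and inj: "inj_on f V"
  shows "dim (f ` V) = dim V" and "finite_dim (f ` V) \<longleftrightarrow> finite_dim V"
proof -
  obtain g where g: "lin_on UNIV g" "range g \<subseteq> V" "\<And>v. v \<in> V \<Longrightarrow> g v = v"
    using projection_exists[OF V] by metis
  define h where "h = f \<circ> g"
  interpret p: vector_space_pair scale scale by unfold_locales
  have "lin_on UNIV h"
    using f g(1,2) unfolding lin_on_def h_def by (auto simp: image_subset_iff)
  then have h: "Vector_Spaces.linear scale scale h"
    by (simp add: Vector_Spaces.linear_iff vector_space_axioms lin_on_def)
  have hV: "h ` V = f ` V" and injh: "inj_on h V"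
    using g(3) inj by (auto simp: h_def inj_on_def)
  obtain B where B: "B \<subseteq> V" "independent B" "V \<subseteq> span B"
    by (rule maximal_independent_subset)
  have spB: "span B = V" using B span_minimal[OF B(1) V] by blast
  have iB: "independent (h ` B)"
    by (rule p.linear_independent_injective_image[OF h B(2)]) (simp add: spB injh)
  have sp: "span (h ` B) = h ` V"
    using p.linear_span_image[OF h, of B] by (simp add: spB)
  have card: "card (h ` B) = card B" and fin: "finite (h ` B) \<longleftrightarrow> finite B"
    using inj_on_subset[OF injh B(1)] by (auto simp: card_image finite_image_iff)
  have "dim (h ` V) = card (h ` B)"
    by (rule dim_unique[of "h ` B"]) (use B iB sp in auto)
  moreover have "dim V = card B"
    by (rule dim_unique[of B]) (use B in auto)
  ultimately show "dim (f ` V) = dim V" using hV card by simp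
  show "finite_dim (f ` V) \<longleftrightarrow> finite_dim V"
  proof
    assume "finite_dim (f ` V)"
    then obtain F where "finite F" "h ` V \<subseteq> span F" unfolding finite_dim_def hV by blast
    then have "finite (h ` B)" using independent_span_bound[of F "h ` B"] iB B(1) by blast
    then show "finite_dim V" unfolding finite_dim_def using fin B(3) by blast
  next
    assume "finite_dim V"
    then obtain F where "finite F" "V \<subseteq> span F" unfolding finite_dim_def by blast
    then have "finite B" using independent_span_bound[of F B] B by blast
    then show "finite_dim (f ` V)" unfolding finite_dim_def using fin sp hV by blast
  qed
qed

lemma direct_sum_dim:
  assumes ds: "direct_sum A B Y" and fA: "finite_dim A" and fB: "finite_dim B"
  shows "dim Y = dim A + dim B" and "finite_dim Y"
proof -
  have AB: "subspace A" "subspace B" "A \<inter> B = {0}" "Y = {a + b |a b. a \<in> A \<and> b \<in> B}"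
    using ds unfolding direct_sum_def by auto
  obtain BA where BA: "finite BA" "BA \<subseteq> A" "independent BA" "span BA = A" "card BA = dim A"
    by (rule finite_dim_basis[OF AB(1) fA])
  obtain BB where BB: "finite BB" "BB \<subseteq> B" "independent BB" "span BB = B" "card BB = dim B"
    by (rule finite_dim_basis[OF AB(2) fB])
  have "0 \<notin> BA" using BA(3) dependent_zero by metis
  moreover have "BA \<inter> BB \<subseteq> {0}"
    using Int_mono[OF BA(2) BB(2)] unfolding AB(3) .
  ultimately have disj: "BA \<inter> BB = {}" by auto
  have "independent (BA \<union> BB)"
  proof (rule independent_if_scalars_zero)
    fix f x assume sum: "(\<Sum>x\<in>BA \<union> BB. scale (f x) x) = 0" and x: "x \<in> BA \<union> BB"
    let ?a = "\<Sum>x\<in>BA. scale (f x) x" and ?b = "\<Sum>x\<in>BB. scale (f x) x"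
    have ab: "?a + ?b = 0" using sum unfolding sum.union_disjoint[OF BA(1) BB(1) disj] .
    have a: "?a \<in> A" by (intro subspace_sum[OF AB(1)] subspace_scale[OF AB(1)]) (use BA in auto)
    have b: "?b \<in> B" by (intro subspace_sum[OF AB(2)] subspace_scale[OF AB(2)]) (use BB in auto)
    have "?a = - ?b" using ab by (simp add: eq_neg_iff_add_eq_0)
    then have "?a \<in> B" using subspace_neg[OF AB(2) b] by simp
    then have "?a \<in> {0}" using a unfolding AB(3)[symmetric] by simp
    then have "?a = 0" by simp
    moreover from this have "?b = 0" using ab by simp
    ultimately show "f x = 0"
      using independentD[OF BA(3,1) order_refl, of f x] independentD[OF BB(3,1) order_refl, of f x] x by auto
  qed (use BA BB in auto)
  moreover have "BA \<union> BB \<subseteq> Y"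
    unfolding AB(4) using BA(2) BB(2) subspace_0[OF AB(1)] subspace_0[OF AB(2)]
    by (auto intro: exI[of _ 0]) (metis add.right_neutral subsetD, metis add.left_neutral subsetD)
  moreover have Y: "Y \<subseteq> span (BA \<union> BB)"
    unfolding AB(4) span_Un BA(4) BB(4) by blast
  moreover have "card (BA \<union> BB) = dim A + dim B"
    using card_Un_disjoint[OF BA(1) BB(1) disj] BA(5) BB(5) by simp
  ultimately show "dim Y = dim A + dim B" by (intro dim_unique)
  show "finite_dim Y" unfolding finite_dim_def using Y BA(1) BB(1) by blast
qed

lemma direct_sum_exists:
  assumes "subspace R" "subspace Y" "R \<subseteq> Y"
  obtains C where "direct_sum C R Y"
proof -
  obtain g where g: "lin_on UNIV g" "range g \<subseteq> R" "\<And>v. v \<in> R \<Longrightarrow> g v = v"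
    using projection_exists[OF assms(1)] by metis
  let ?C = "{y \<in> Y. g y = 0}"
  have "subspace ?C"
    by (rule lin_on_subspace_kernel[OF lin_on_subset[OF g(1) subset_UNIV] assms(2)])
  moreover have "?C \<inter> R = {0}"
    using g(3) subspace_0[OF assms(1)] subspace_0[OF assms(2)] by force
  moreover have "{c + r |c r. c \<in> ?C \<and> r \<in> R} = Y"
  proof (intro equalityI subsetI)
    fix y assume y: "y \<in> Y"
    have gy: "g y \<in> R" using g(2) by blast
    have "y - g y \<in> Y" using y gy assms(3) subspace_diff[OF assms(2)] by blast
    moreover have "g (y - g y) = 0"
      using lin_on_diff[OF g(1) subspace_UNIV] g(3)[OF gy] by simp
    ultimately have "y - g y \<in> ?C" by simp
    then show "y \<in> {c + r |c r. c \<in> ?C \<and> r \<in> R}"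
      using gy by (intro CollectI exI[of _ "y - g y"] exI[of _ "g y"]) simp
  next
    fix y assume "y \<in> {c + r |c r. c \<in> ?C \<and> r \<in> R}"
    then show "y \<in> Y" using assms(3) subspace_add[OF assms(2)] by blast
  qed
  ultimately show ?thesis using that[of ?C] assms(1) unfolding direct_sum_def by blast
qed

lemma direct_sum_commute: "direct_sum A B Y \<Longrightarrow> direct_sum B A Y"
  unfolding direct_sum_def by (auto simp: add.commute Int_commute) (metis add.commute)+

lemma direct_sum_subspace:
  assumes "direct_sum A B Y"
  shows "subspace Y"
  using assms subspace_sums unfolding direct_sum_def by blast

lemma direct_sum_subset:
  assumes "direct_sum A B Y"
  shows "A \<subseteq> Y" "B \<subseteq> Y"
proof -
  have AB: "subspace A" "subspace B" "Y = {a + b |a b. a \<in> A \<and> b \<in> B}"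
    using assms unfolding direct_sum_def by auto
  show "A \<subseteq> Y" unfolding AB(3) using subspace_0[OF AB(2)] by force
  show "B \<subseteq> Y" unfolding AB(3) using subspace_0[OF AB(1)] by force
qed

definition component :: "'b set \<Rightarrow> 'b set \<Rightarrow> 'b \<Rightarrow> 'b" where
  "component A B y = (SOME a. a \<in> A \<and> y - a \<in> B)"

lemma component:
  assumes ds: "direct_sum A B Y" and y: "y \<in> Y"
  shows "component A B y \<in> A" "y - component A B y \<in> B"
    and "a \<in> A \<Longrightarrow> y - a \<in> B \<Longrightarrow> component A B y = a"
proof -
  have AB: "subspace A" "subspace B" "A \<inter> B = {0}" "Y = {a + b |a b. a \<in> A \<and> b \<in> B}"
    using ds unfolding direct_sum_def by auto
  obtain a' b' where "a' \<in> A" "b' \<in> B" "y = a' + b'" using y unfolding AB(4) by blast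
  then have "\<exists>a. a \<in> A \<and> y - a \<in> B" by (intro exI[of _ a']) simp
  from someI_ex[OF this] show c: "component A B y \<in> A" "y - component A B y \<in> B"
    unfolding component_def by auto
  assume a: "a \<in> A" "y - a \<in> B"
  have "component A B y - a \<in> A" using subspace_diff[OF AB(1) c(1) a(1)] .
  moreover have "component A B y - a \<in> B" using subspace_diff[OF AB(2) a(2) c(2)] by simp
  ultimately have "component A B y - a \<in> {0}" unfolding AB(3)[symmetric] by (rule IntI)
  then show "component A B y = a" by simp
qed

lemma lin_on_component:
  assumes ds: "direct_sum A B Y"
  shows "lin_on Y (component A B)"
proof -
  have AB: "subspace A" "subspace B" using ds unfolding direct_sum_def by auto
  note Y = direct_sum_subspace[OF ds]
  show ?thesis
    unfolding lin_on_def
  proof (intro conjI ballI allI)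
    fix x y assume xy: "x \<in> Y" "y \<in> Y"
    note cx = component(1,2)[OF ds xy(1)] and cy = component(1,2)[OF ds xy(2)]
    have "(x + y) - (component A B x + component A B y) \<in> B"
      using subspace_add[OF AB(2) cx(2) cy(2)] by (simp add: algebra_simps)
    then show "component A B (x + y) = component A B x + component A B y"
      by (intro component(3)[OF ds subspace_add[OF Y xy]] subspace_add[OF AB(1)] cx cy)
  next
    fix c x assume x: "x \<in> Y"
    note cx = component(1,2)[OF ds x]
    have "scale c x - scale c (component A B x) \<in> B"
      using subspace_scale[OF AB(2) cx(2), of c] by (simp add: scale_right_diff_distrib)
    then show "component A B (scale c x) = scale c (component A B x)"
      by (intro component(3)[OF ds subspace_scale[OF Y x]] subspace_scale[OF AB(1)] cx)
  qed
qed

text \<open>Both complements represent the quotient: the \<open>D\<close>-component along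
  \<open>R\<close> maps \<open>C\<close> bijectively onto \<open>D\<close>.\<close>

lemma complement_dim_unique:
  assumes C: "direct_sum C R Y" and D: "direct_sum D R Y"
  shows "dim C = dim D"
proof -
  have sub: "subspace C" "subspace R" "subspace D" "C \<inter> R = {0}" "D \<inter> R = {0}"
    using C D unfolding direct_sum_def by auto
  let ?f = "component D R"
  have CY: "C \<subseteq> Y" "D \<subseteq> Y" using direct_sum_subset C D by blast+
  have lin: "lin_on C ?f" by (rule lin_on_subset[OF lin_on_component[OF D] CY(1)])
  have "inj_on ?f C"
  proof (rule lin_on_inj[OF lin sub(1)])
    fix c assume c: "c \<in> C" "?f c = 0"
    then have "c \<in> R" using component(2)[OF D, of c] CY by auto
    then show "c = 0" using c sub(4) by blast
  qed
  moreover have "?f ` C = D"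
  proof (intro equalityI subsetI)
    fix d assume d: "d \<in> D"
    let ?c = "component C R d"
    have c: "?c \<in> C" "d - ?c \<in> R" using component(1,2)[OF C, of d] d CY by auto
    have "?c - d \<in> R" using subspace_neg[OF sub(2) c(2)] by simp
    then have "?f ?c = d" using component(3)[OF D, of ?c d] c d CY by auto
    then show "d \<in> ?f ` C" using c by (metis imageI)
  qed (use component(1)[OF D] CY in auto)
  ultimately show ?thesis using lin_on_image_dim(1)[OF sub(1) lin] by simp
qed

text \<open>Removes the choice operator: any complement at hand computes the codimension.\<close>

lemma codim_in_eq:
  assumes "direct_sum C R Y"
  shows "codim_in scale Y R = dim C"
proof -
  have R: "subspace R" using assms unfolding direct_sum_def by auto
  let ?P = "\<lambda>C. subspace C \<and> C \<inter> R = {0} \<and> {c + r |c r. c \<in> C \<and> r \<in> R} = Y"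
  have "?P C" using assms unfolding direct_sum_def by auto
  then have "?P (SOME C. ?P C)" by (rule someI[of ?P])
  then have "direct_sum (SOME C. ?P C) R Y" using R unfolding direct_sum_def by auto
  from complement_dim_unique[OF this assms] show ?thesis unfolding codim_in_def .
qed

lemma rank_nullity:
  assumes V: "subspace V" and f: "lin_on V f"
    and "finite_dim {x \<in> V. f x = 0}" "finite_dim (f ` V)"
  shows "dim V = dim {x \<in> V. f x = 0} + dim (f ` V)" and "finite_dim V"
proof -
  let ?K = "{x \<in> V. f x = 0}"
  have K: "subspace ?K" by (rule lin_on_subspace_kernel[OF f V])
  obtain C where C: "direct_sum C ?K V" using direct_sum_exists[OF K V] by blast
  have CV: "C \<subseteq> V" and sC: "subspace C" "C \<inter> ?K = {0}" using direct_sum_subset[OF C] C unfolding direct_sum_def by auto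
  have lin: "lin_on C f" by (rule lin_on_subset[OF f CV])
  have inj: "inj_on f C" by (rule lin_on_inj[OF lin sC(1)]) (use sC CV in auto)
  have "f ` C = f ` V"
  proof (intro equalityI subsetI)
    fix y assume "y \<in> f ` V"
    then obtain v where v: "v \<in> V" "y = f v" by blast
    let ?c = "component C ?K v"
    have c: "?c \<in> C" "v - ?c \<in> ?K" using component(1,2)[OF C v(1)] by auto
    then have "f v = f ?c" using lin_on_diff[OF f V v(1)] CV by auto
    then show "y \<in> f ` C" using v c by blast
  qed (use CV in auto)
  note d = lin_on_image_dim[OF sC(1) lin inj, unfolded this]
  have fC: "finite_dim C" using d(2) assms(4) by blast
  show "dim V = dim ?K + dim (f ` V)" using direct_sum_dim(1)[OF C fC assms(3)] d(1) by simp
  show "finite_dim V" using direct_sum_dim(2)[OF C fC assms(3)] .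
qed

lemma finite_dim_image:
  assumes V: "subspace V" and f: "lin_on V f" and "finite_dim V"
  shows "finite_dim (f ` V)"
proof -
  obtain B where B: "finite B" "B \<subseteq> V" "span B = V"
    using finite_dim_basis[OF V assms(3)] by metis
  obtain g where g: "lin_on UNIV g" "range g \<subseteq> V" "\<And>v. v \<in> V \<Longrightarrow> g v = v"
    using projection_exists[OF V] by metis
  interpret p: vector_space_pair scale scale by unfold_locales
  have "lin_on UNIV (f \<circ> g)"
    using f g(1,2) unfolding lin_on_def by (auto simp: image_subset_iff)
  then have h: "Vector_Spaces.linear scale scale (f \<circ> g)"
    by (simp add: Vector_Spaces.linear_iff vector_space_axioms lin_on_def)
  have "f ` V = (f \<circ> g) ` V" using g(3) by (auto simp: image_iff)
  also have "\<dots> = span ((f \<circ> g) ` B)" using p.linear_span_image[OF h, of B] B by simp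
  finally show ?thesis unfolding finite_dim_def using B(1) by blast
qed

section \<open>Fredholm maps and additivity of the index\<close>

definition fredholm :: "'b set \<Rightarrow> 'b set \<Rightarrow> ('b \<Rightarrow> 'b) \<Rightarrow> bool" where
  "fredholm X Y T \<longleftrightarrow> finite_dim {x \<in> X. T x = 0} \<and> (\<exists>C. finite_dim C \<and> direct_sum C (T ` X) Y)"

text \<open>Unlike in the definition of the index, \<open>T\<close> need not vanish on the complement \<open>N\<close>.\<close>

lemma fredholm_index_eq:
  assumes T: "lin_on X T" "T ` X \<subseteq> Y" and X0: "direct_sum X0 N X" and inj: "inj_on T X0"
    and C: "direct_sum C (T ` X0) Y" and fin: "finite_dim N" "finite_dim C"
  shows "fredholm X Y T" and "fredholm_index scale X Y T = int (dim N) - int (dim C)"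
proof -
  note sX = direct_sum_subspace[OF X0] and sY = direct_sum_subspace[OF C]
  note X0X = direct_sum_subset[OF X0] and CY = direct_sum_subset[OF C]
  have sub: "subspace X0" "subspace N" "X0 \<inter> N = {0}" "subspace C" "subspace (T ` X0)" "C \<inter> T ` X0 = {0}"
    using X0 C unfolding direct_sum_def by auto
  have T0: "T 0 = 0" by (rule lin_on_zero[OF T(1) subspace_0[OF sX]])
  \<comment> \<open>The map from \<open>N\<close> to \<open>C\<close> that \<open>T\<close> induces.
    The kernel of \<open>T\<close> is isomorphic to that of \<phi>, and a complement of the range of
    \<phi> in \<open>C\<close> is one of the range of \<open>T\<close> in \<open>Y\<close>, so
    rank-nullity for \<phi> gives the index.\<close>
  define \<phi> where "\<phi> = (\<lambda>n. component C (T ` X0) (T n))"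
  have \<phi>: "\<phi> n \<in> C" "T n - \<phi> n \<in> T ` X0" if "n \<in> X" for n
    using component(1,2)[OF C, of "T n"] that T(2) unfolding \<phi>_def by auto
  have \<phi>_eq: "\<phi> n = c" if "n \<in> X" "c \<in> C" "T n - c \<in> T ` X0" for n c
    using component(3)[OF C, of "T n" c] that T(2) unfolding \<phi>_def by auto
  have lin\<phi>: "lin_on N \<phi>"
    using lin_on_component[OF C] T X0X(2) subspace_add[OF sX] unfolding lin_on_def \<phi>_def
    by (simp add: image_subset_iff subset_iff)
  let ?K = "{n \<in> N. \<phi> n = 0}" and ?Z = "{x \<in> X. T x = 0}"
  have fK: "finite_dim ?K" by (rule finite_dim_subset[OF fin(1)]) auto
  have \<phi>N: "\<phi> ` N \<subseteq> C" using \<phi> X0X by auto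
  have f\<phi>N: "finite_dim (\<phi> ` N)" by (rule finite_dim_subset[OF fin(2) \<phi>N])
  have sZ: "subspace ?Z" by (rule lin_on_subspace_kernel[OF T(1) sX])
  let ?f = "component N X0"
  note X0' = direct_sum_commute[OF X0]
  have linZ: "lin_on ?Z ?f" by (rule lin_on_subset[OF lin_on_component[OF X0']]) auto
  have injZ: "inj_on ?f ?Z"
  proof (rule lin_on_inj[OF linZ sZ])
    fix z assume z: "z \<in> ?Z" "?f z = 0"
    then have "z \<in> X0" using component(2)[OF X0', of z] by auto
    then show "z = 0" using z T0 inj_onD[OF inj, of z 0] subspace_0[OF sub(1)] by simp
  qed
  have imZ: "?f ` ?Z = ?K"
  proof (intro equalityI subsetI)
    fix n assume "n \<in> ?f ` ?Z"
    then obtain z where z: "z \<in> X" "T z = 0" "n = ?f z" by blast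
    have n: "n \<in> N" "z - n \<in> X0" using component(1,2)[OF X0' z(1)] z(3) by auto
    have "T (n - z) = T n" using lin_on_diff[OF T(1) sX _ z(1)] n X0X z(2) by auto
    moreover have "n - z \<in> X0" using subspace_neg[OF sub(1) n(2)] by simp
    ultimately have "T n - 0 \<in> T ` X0" by (metis diff_zero imageI)
    then have "\<phi> n = 0" using \<phi>_eq[of n 0] n X0X subspace_0[OF sub(4)] by blast
    then show "n \<in> ?K" using n by simp
  next
    fix n assume "n \<in> ?K"
    then have n: "n \<in> N" "\<phi> n = 0" "n \<in> X" using X0X by auto
    then obtain x where x: "x \<in> X0" "T n = T x" using \<phi>(2)[of n] by auto
    then have xX: "x \<in> X" using X0X by auto
    have "T (n - x) = 0" using lin_on_diff[OF T(1) sX n(3) xX] x by simp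
    moreover have nx: "n - x \<in> X" using subspace_diff[OF sX n(3) xX] .
    moreover have "?f (n - x) = n"
      using component(3)[OF X0' nx n(1)] subspace_neg[OF sub(1) x(1)] by simp
    ultimately show "n \<in> ?f ` ?Z" by (metis (mono_tags, lifting) CollectI imageI)
  qed
  note dZ = lin_on_image_dim[OF sZ linZ injZ, unfolded imZ]
  have fZ: "finite_dim ?Z" using dZ(2) fK by blast
  have s\<phi>N: "subspace (\<phi> ` N)" by (rule lin_on_subspace_image[OF lin\<phi> sub(2)])
  obtain C1 where C1: "direct_sum C1 (\<phi> ` N) C" using direct_sum_exists[OF s\<phi>N sub(4) \<phi>N] by blast
  have C1C: "C1 \<subseteq> C" using direct_sum_subset[OF C1] by blast
  have sC1: "subspace C1" "C1 \<inter> \<phi> ` N = {0}" "C = {a + b |a b. a \<in> C1 \<and> b \<in> \<phi> ` N}"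
    using C1 unfolding direct_sum_def by auto
  have fC1: "finite_dim C1" by (rule finite_dim_subset[OF fin(2) C1C])
  have sTX: "subspace (T ` X)" by (rule lin_on_subspace_image[OF T(1) sX])
  have TX: "\<exists>x0\<in>X0. \<exists>n\<in>N. T x = T x0 + T n" if "x \<in> X" for x
  proof -
    have "?f x \<in> N" "x - ?f x \<in> X0" using component(1,2)[OF X0' that] by auto
    moreover from this have "T ((x - ?f x) + ?f x) = T (x - ?f x) + T (?f x)"
      using T(1) X0X unfolding lin_on_def by blast
    ultimately show ?thesis by auto
  qed
  have ds: "direct_sum C1 (T ` X) Y"
    unfolding direct_sum_def
  proof (intro conjI)
    show "C1 \<inter> T ` X = {0}"
    proof (intro equalityI subsetI)
      fix c assume c: "c \<in> C1 \<inter> T ` X"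
      then obtain x0 n where xn: "x0 \<in> X0" "n \<in> N" "c = T x0 + T n" using TX by blast
      have "T n - c = T (0 - x0)"
        using xn lin_on_diff[OF T(1) sX subspace_0[OF sX], of x0] X0X T0 by auto
      then have "T n - c \<in> T ` X0" using subspace_neg[OF sub(1) xn(1)] by auto
      then have "\<phi> n = c" using \<phi>_eq[of n c] xn X0X c C1C by blast
      then have "c \<in> \<phi> ` N" using xn by blast
      then show "c \<in> {0}" using c sC1(2) by blast
    qed (use subspace_0[OF sC1(1)] subspace_0[OF sTX] in auto)
    show "{c + r |c r. c \<in> C1 \<and> r \<in> T ` X} = Y"
    proof (intro equalityI subsetI)
      fix y assume "y \<in> Y"
      note c = component(1,2)[OF C this]
      obtain c1 n where cn: "c1 \<in> C1" "n \<in> N" "component C (T ` X0) y = c1 + \<phi> n" using c(1) sC1(3) by blast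
      obtain x0 where x0: "x0 \<in> X0" "y - component C (T ` X0) y = T x0" using c(2) by blast
      have nX: "n \<in> X" and x0X: "x0 \<in> X" using cn(2) x0(1) X0X by auto
      obtain x1 where x1: "x1 \<in> X0" "T n - \<phi> n = T x1" using \<phi>(2)[OF nX] by blast
      have x1X: "x1 \<in> X" using x1 X0X by auto
      have "y = c1 + (T n - T x1 + T x0)" using cn(3) x0(2) x1(2) by (simp add: algebra_simps)
      also have "T n - T x1 + T x0 = T (n - x1) + T x0" using lin_on_diff[OF T(1) sX nX x1X] by simp
      also have "\<dots> = T (n - x1 + x0)"
        using T(1) subspace_diff[OF sX nX x1X] x0X unfolding lin_on_def by simp
      finally have "y = c1 + T (n - x1 + x0)" .
      moreover have "n - x1 + x0 \<in> X" using subspace_add[OF sX subspace_diff[OF sX nX x1X] x0X] .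
      ultimately show "y \<in> {c + r |c r. c \<in> C1 \<and> r \<in> T ` X}" using cn(1) by blast
    next
      fix y assume "y \<in> {c + r |c r. c \<in> C1 \<and> r \<in> T ` X}"
      then show "y \<in> Y" using C1C CY(1) T(2) subspace_add[OF sY] by blast
    qed
  qed (use sC1 sTX in auto)
  show "fredholm X Y T" unfolding fredholm_def using fZ ds fC1 by blast
  have "dim N = dim ?K + dim (\<phi> ` N)" by (rule rank_nullity(1)[OF sub(2) lin\<phi> fK f\<phi>N])
  moreover have "dim C = dim C1 + dim (\<phi> ` N)" by (rule direct_sum_dim(1)[OF C1 fC1 f\<phi>N])
  ultimately show "fredholm_index scale X Y T = int (dim N) - int (dim C)"
    unfolding fredholm_index_def codim_in_eq[OF ds] using dZ(1) by simp
qed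

text \<open>Let \<open>X0\<close> complement N = ker (T S), \<open>D\<close> complement S X0 in Y,
  and \<open>C\<close> complement the range of T S. Then the indices of S, T and T S are dim N - dim
  D, dim D - dim C and dim N - dim C. Since S need not vanish on N, the flexible index formula is
  essential.\<close>

lemma fredholm_index_compose:
  assumes X: "subspace X" and Y: "subspace Y" and S: "lin_on X S" "S ` X \<subseteq> Y" and T: "lin_on Y T" "T ` Y \<subseteq> Z"
    and TS: "fredholm X Z (T \<circ> S)" and fT: "finite_dim {y \<in> Y. T y = 0}"
  shows "fredholm_index scale X Z (T \<circ> S) = fredholm_index scale X Y S + fredholm_index scale Y Z T"
proof -
  let ?N = "{x \<in> X. (T \<circ> S) x = 0}"
  have lin: "lin_on X (T \<circ> S)" using S T(1) unfolding lin_on_def by (auto simp: image_subset_iff)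
  have im: "(T \<circ> S) ` X \<subseteq> Z" using S(2) T(2) by auto
  have sN: "subspace ?N" by (rule lin_on_subspace_kernel[OF lin X])
  obtain C where C: "finite_dim C" "direct_sum C ((T \<circ> S) ` X) Z" and fN: "finite_dim ?N"
    using TS unfolding fredholm_def by blast
  obtain X0 where X0: "direct_sum X0 ?N X" using direct_sum_exists[OF sN X] by blast
  have sX0: "subspace X0" "X0 \<inter> ?N = {0}" and X0X: "X0 \<subseteq> X"
    using X0 direct_sum_subset[OF X0] unfolding direct_sum_def by auto
  have T0: "T 0 = 0" by (rule lin_on_zero[OF T(1) subspace_0[OF Y]])
  have inj: "inj_on (T \<circ> S) X0"
    by (rule lin_on_inj[OF lin_on_subset[OF lin X0X] sX0(1)]) (use sX0 X0X in auto)
  then have injS: "inj_on S X0" by (rule inj_on_imageI2)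
  have injT: "inj_on T (S ` X0)" using inj by (rule inj_on_imageI)
  have im0: "(T \<circ> S) ` X0 = (T \<circ> S) ` X"
  proof (intro equalityI subsetI)
    fix z assume "z \<in> (T \<circ> S) ` X"
    then obtain x where x: "x \<in> X" "z = (T \<circ> S) x" by blast
    let ?c = "component X0 ?N x"
    have c: "?c \<in> X0" "x - ?c \<in> ?N" using component(1,2)[OF X0 x(1)] by auto
    then have "(T \<circ> S) x = (T \<circ> S) ?c" using lin_on_diff[OF lin X x(1)] X0X by auto
    then show "z \<in> (T \<circ> S) ` X0" using x c by blast
  qed (use X0X in auto)
  have SX0Y: "S ` X0 \<subseteq> Y" using S(2) X0X by auto
  have sSX0: "subspace (S ` X0)" by (rule lin_on_subspace_image[OF lin_on_subset[OF S(1) X0X] sX0(1)])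
  obtain D where D: "direct_sum D (S ` X0) Y" using direct_sum_exists[OF sSX0 Y SX0Y] by blast
  have sD: "subspace D" "D \<inter> S ` X0 = {0}" and DY: "D \<subseteq> Y"
    using D direct_sum_subset[OF D] unfolding direct_sum_def by auto
  \<comment> \<open>Taking the \<open>C\<close>-component of \<open>T\<close> maps \<open>D\<close>
    into the finite-dimensional \<open>C\<close>, and its kernel lies in the
    \<open>D\<close>-component of ker T.\<close>
  have fD: "finite_dim D"
  proof (rule rank_nullity(2)[OF sD(1)])
    let ?\<psi> = "\<lambda>d. component C ((T \<circ> S) ` X) (T d)"
    let ?K = "{d \<in> D. ?\<psi> d = 0}" and ?Z = "{y \<in> Y. T y = 0}"
    show lin\<psi>: "lin_on D ?\<psi>"
      using lin_on_component[OF C(2)] T DY unfolding lin_on_def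
      by (simp add: image_subset_iff subset_iff)
    show "finite_dim (?\<psi> ` D)"
      by (rule finite_dim_subset[OF C(1)]) (use component(1)[OF C(2)] T(2) DY in auto)
    have sZ: "subspace ?Z" by (rule lin_on_subspace_kernel[OF T(1) Y])
    have fZ': "finite_dim (component D (S ` X0) ` ?Z)"
      by (rule finite_dim_image[OF sZ lin_on_subset[OF lin_on_component[OF D]] fT]) auto
    show "finite_dim ?K"
    proof (rule finite_dim_subset[OF fZ'], rule subsetI)
      fix d assume "d \<in> ?K"
      then have d: "d \<in> D" "?\<psi> d = 0" "d \<in> Y" using DY by auto
      then have "T d \<in> (T \<circ> S) ` X0"
        using component(2)[OF C(2), of "T d"] T(2) im0 by auto
      then obtain x where x: "x \<in> X0" "T d = T (S x)" by auto
      then have SxY: "S x \<in> Y" using SX0Y by auto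
      have "T (d - S x) = 0" using lin_on_diff[OF T(1) Y d(3) SxY] x by simp
      moreover have dY: "d - S x \<in> Y" using subspace_diff[OF Y d(3) SxY] .
      moreover have "- S x \<in> S ` X0" using subspace_neg[OF sSX0] x by blast
      then have "component D (S ` X0) (d - S x) = d" using component(3)[OF D dY d(1)] by simp
      ultimately show "d \<in> component D (S ` X0) ` ?Z" by (metis (mono_tags, lifting) CollectI imageI)
    qed
  qed
  have C': "direct_sum C (T ` (S ` X0)) Z" using C(2) im0 by (simp add: image_comp)
  have "fredholm_index scale X Y S = int (dim ?N) - int (dim D)"
    by (rule fredholm_index_eq(2)[OF S X0 injS D fN fD])
  moreover have "fredholm_index scale Y Z T = int (dim D) - int (dim C)"
    by (rule fredholm_index_eq(2)[OF T direct_sum_commute[OF D] injT C' fD C(1)])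
  moreover have "fredholm_index scale X Z (T \<circ> S) = int (dim ?N) - int (dim C)"
    by (rule fredholm_index_eq(2)[OF lin im X0 inj _ fN C(1)]) (use C(2) im0 in simp)
  ultimately show ?thesis by simp
qed

end

subsection \<open>Riesz theory of compact perturbations of the identity\<close>

text \<open>Choose m within twice the distance of y from \<open>M\<close>; normalising y - m leaves
  distance at least 1/2. The point m is exposed because a later argument needs the vector y - m
  itself.\<close>

lemma almost_orthogonal_point:
  fixes y :: "'a::real_normed_vector"
  assumes M: "subspace M" "closed M" and y: "y \<notin> M"
  obtains m where "m \<in> M" "y \<noteq> m"
    "\<And>m'. m' \<in> M \<Longrightarrow> 1/2 \<le> norm ((1 / norm (y - m)) *\<^sub>R (y - m) - m')"
proof -
  have ne: "M \<noteq> {}" using subspace_0[OF M(1)] by blast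
  have d: "infdist y M > 0" using infdist_pos_not_in_closed[OF M(2) ne y] .
  have "\<exists>m\<in>M. dist y m < 2 * infdist y M"
  proof (rule ccontr)
    assume "\<not> (\<exists>m\<in>M. dist y m < 2 * infdist y M)"
    then have "2 * infdist y M \<le> (INF a\<in>M. dist y a)"
      using ne by (intro cINF_greatest) auto
    then show False using d infdist_notempty[OF ne, of y] by simp
  qed
  then obtain m where m: "m \<in> M" "dist y m < 2 * infdist y M" by blast
  define r where "r = norm (y - m)"
  have r: "r > 0" using m(1) y by (auto simp: r_def)
  have "1/2 \<le> norm ((1 / r) *\<^sub>R (y - m) - m')" if m': "m' \<in> M" for m'
  proof -
    have "m + r *\<^sub>R m' \<in> M" using M(1) m(1) m' by (simp add: subspace_add subspace_scale)
    then have "infdist y M \<le> norm (y - (m + r *\<^sub>R m'))"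
      using infdist_le by (metis dist_norm)
    also have "y - (m + r *\<^sub>R m') = r *\<^sub>R ((1 / r) *\<^sub>R (y - m) - m')"
      using r by (simp add: algebra_simps)
    also have "norm \<dots> = r * norm ((1 / r) *\<^sub>R (y - m) - m')" using r by simp
    finally have "infdist y M \<le> r * norm ((1 / r) *\<^sub>R (y - m) - m')" .
    moreover have "r < 2 * infdist y M" using m(2) by (simp add: r_def dist_norm)
    ultimately have "r * (1/2) < r * norm ((1 / r) *\<^sub>R (y - m) - m')" by simp
    then show ?thesis using r by simp
  qed
  then show ?thesis using that[of m] m(1) y unfolding r_def by blast
qed

lemma riesz_lemma:
  fixes M :: "'a::real_normed_vector set"
  assumes "subspace M" "closed M" "subspace L" "M \<subset> L"
  obtains x where "x \<in> L" "norm x = 1" "\<And>m. m \<in> M \<Longrightarrow> 1/2 \<le> norm (x - m)"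
proof -
  obtain y where y: "y \<in> L" "y \<notin> M" using assms(4) by blast
  obtain m where m: "m \<in> M" "y \<noteq> m"
    "\<And>m'. m' \<in> M \<Longrightarrow> 1/2 \<le> norm ((1 / norm (y - m)) *\<^sub>R (y - m) - m')"
    using almost_orthogonal_point[OF assms(1,2) y(2)] by metis
  show ?thesis
  proof (rule that)
    have "m \<in> L" using m(1) assms(4) by blast
    then show "(1 / norm (y - m)) *\<^sub>R (y - m) \<in> L"
      using assms(3) y(1) by (simp add: subspace_diff subspace_scale)
    show "norm ((1 / norm (y - m)) *\<^sub>R (y - m)) = 1" using m(2) by simp
  qed (rule m(3))
qed

lemma compact_operator_convergent_subsequence:
  fixes K :: "'a::real_normed_vector \<Rightarrow>\<^sub>L 'b::banach" and x :: "nat \<Rightarrow> 'a"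
  assumes "compact_operator K" "\<And>n. norm (x n) \<le> 1"
  shows "\<exists>r l. strict_mono r \<and> (\<lambda>n. blinfun_apply K (x (r n))) \<longlonglongrightarrow> l"
proof -
  have "seq_compact (closure (blinfun_apply K ` cball 0 1))"
    using assms(1) unfolding compact_operator_def by (simp add: compact_eq_seq_compact_metric)
  moreover have "\<forall>n. blinfun_apply K (x n) \<in> closure (blinfun_apply K ` cball 0 1)"
    using assms(2) by (intro allI subsetD[OF closure_subset] imageI) simp
  ultimately obtain l r where "strict_mono r" "((\<lambda>n. blinfun_apply K (x n)) \<circ> r) \<longlonglongrightarrow> l"
    using seq_compactE[of _ "\<lambda>n. blinfun_apply K (x n)"] by metis
  then show ?thesis by (auto simp: o_def)
qed

lemma compact_operator_not_separated:
  fixes K :: "'a::real_normed_vector \<Rightarrow>\<^sub>L 'b::banach" and x :: "nat \<Rightarrow> 'a"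
  assumes "compact_operator K" "\<And>n. norm (x n) \<le> 1"
    and sep: "\<And>m n :: nat. m < n \<Longrightarrow> 1/2 \<le> norm (blinfun_apply K (x n) - blinfun_apply K (x m))"
  shows False
proof -
  obtain r l where r: "strict_mono r" "(\<lambda>n. blinfun_apply K (x (r n))) \<longlonglongrightarrow> l"
    using compact_operator_convergent_subsequence[of K x] assms(1,2) by blast
  have "Cauchy (\<lambda>n. blinfun_apply K (x (r n)))" using r(2) by (rule LIMSEQ_imp_Cauchy)
  from metric_CauchyD[OF this, of "1/2"] obtain N
    where N: "\<forall>m\<ge>N. \<forall>n\<ge>N. dist (blinfun_apply K (x (r m))) (blinfun_apply K (x (r n))) < 1/2" by auto
  have "r N < r (Suc N)" using r(1) by (simp add: strict_mono_Suc_iff)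
  from sep[OF this] N[rule_format, of "Suc N" N] show False by (simp add: dist_norm)
qed

text \<open>The distance d of \<open>v\<close> from \<open>M\<close> controls the coefficient of
  \<open>v\<close>: |c| d is at most norm (m + c v). Coefficients of a convergent sequence are
  therefore Cauchy.\<close>

lemma closed_span_insert:
  fixes v :: "'a::banach"
  assumes M: "subspace M" "closed M"
  shows "closed {x. \<exists>k. x - k *\<^sub>R v \<in> M}"
proof (cases "v \<in> M")
  case True
  have "x - k *\<^sub>R v \<in> M \<longleftrightarrow> x \<in> M" for x k
    using subspace_scale[OF M(1) True, of k] subspace_add[OF M(1), of "x - k *\<^sub>R v" "k *\<^sub>R v"]
      subspace_diff[OF M(1), of x "k *\<^sub>R v"] by auto
  then show ?thesis using M(2) by simp
next
  case False
  have ne: "M \<noteq> {}" using subspace_0[OF M(1)] by blast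
  define d where "d = infdist v M"
  have d: "d > 0" using infdist_pos_not_in_closed[OF M(2) ne False] by (simp add: d_def)
  have lower: "\<bar>c\<bar> * d \<le> norm (m + c *\<^sub>R v)" if "m \<in> M" for m c
  proof (cases "c = 0")
    case False
    have "(- 1 / c) *\<^sub>R m \<in> M" by (rule subspace_scale[OF M(1) that])
    then have "d \<le> norm (v - (- 1 / c) *\<^sub>R m)" unfolding d_def using infdist_le by (metis dist_norm)
    then have "\<bar>c\<bar> * d \<le> norm (c *\<^sub>R (v - (- 1 / c) *\<^sub>R m))"
      by (simp only: norm_scaleR) (simp add: mult_left_mono)
    also have "c *\<^sub>R (v - (- 1 / c) *\<^sub>R m) = m + c *\<^sub>R v" using False by (simp add: algebra_simps)
    finally show ?thesis .
  qed simp
  show ?thesis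
    unfolding closed_sequential_limits
  proof (intro allI impI)
    fix y l assume yl: "(\<forall>n. y n \<in> {x. \<exists>k. x - k *\<^sub>R v \<in> M}) \<and> y \<longlonglongrightarrow> l"
    then obtain c where c: "\<And>n. y n - c n *\<^sub>R v \<in> M" by (simp only: mem_Collect_eq) metis
    have "Cauchy c"
      unfolding Cauchy_def
    proof (intro allI impI)
      fix e :: real assume "e > 0"
      have "Cauchy y" using yl LIMSEQ_imp_Cauchy by blast
      moreover have "e * d > 0" using \<open>e > 0\<close> d by simp
      ultimately obtain N where N: "\<And>m n. m \<ge> N \<Longrightarrow> n \<ge> N \<Longrightarrow> dist (y m) (y n) < e * d"
        unfolding Cauchy_def by metis
      have "dist (c m) (c n) < e" if "m \<ge> N" "n \<ge> N" for m n
      proof -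
        have "\<bar>c m - c n\<bar> * d \<le> norm (((y m - c m *\<^sub>R v) - (y n - c n *\<^sub>R v)) + (c m - c n) *\<^sub>R v)"
          by (rule lower) (rule subspace_diff[OF M(1) c c])
        also have "\<dots> = dist (y m) (y n)" by (simp add: dist_norm algebra_simps)
        also have "\<dots> < e * d" using N that by blast
        finally show ?thesis using d by (simp add: dist_real_def)
      qed
      then show "\<exists>M. \<forall>m\<ge>M. \<forall>n\<ge>M. dist (c m) (c n) < e" by blast
    qed
    then obtain k where k: "c \<longlonglongrightarrow> k" unfolding Cauchy_convergent_iff convergent_def by blast
    have "(\<lambda>n. y n - c n *\<^sub>R v) \<longlonglongrightarrow> l - k *\<^sub>R v"
      using yl k by (intro tendsto_intros) auto
    then have "l - k *\<^sub>R v \<in> M" by (rule closed_sequentially[OF M(2) c])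
    then show "l \<in> {x. \<exists>k. x - k *\<^sub>R v \<in> M}" by blast
  qed
qed

lemma closed_span_finite:
  fixes B :: "'a::banach set"
  assumes "finite B"
  shows "closed (span B)"
  using assms
proof (induction B)
  case (insert v B)
  have "span (insert v B) = {x. \<exists>k. x - k *\<^sub>R v \<in> span B}"
    by (auto simp: span_breakdown_eq)
  then show ?case using closed_span_insert[OF subspace_span insert.IH] by simp
qed simp

context
  fixes T :: "'a::banach \<Rightarrow>\<^sub>L 'a"
  assumes T: "T \<sim>\<^sub>K id_blinfun"
begin

text \<open>With K = T - id and unit vectors x(n) in M(n+1) at distance 1/2 from M(n), K x(n) - K
  x(m) equals - x(n) up to a vector of M(n) for m < n. So the values of the compact K would stay 1/2
  apart.\<close>

lemma no_increasing_chain: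
  assumes M: "\<And>n. subspace (M n)" "\<And>n. closed (M n)" "\<And>n. M n \<subset> M (Suc n)"
    and TM: "\<And>n x. x \<in> M (Suc n) \<Longrightarrow> blinfun_apply T x \<in> M n"
  shows False
proof -
  have "\<exists>x. x \<in> M (Suc n) \<and> norm x = 1 \<and> (\<forall>m\<in>M n. 1/2 \<le> norm (x - m))" for n
    using riesz_lemma[OF M(1) M(2) M(1) M(3), of n] by metis
  then obtain x where x: "\<And>n. x n \<in> M (Suc n)" "\<And>n. norm (x n) = 1"
    "\<And>n m. m \<in> M n \<Longrightarrow> 1/2 \<le> norm (x n - m)" by metis
  have mono: "m \<le> n \<Longrightarrow> M m \<subseteq> M n" for m n
    by (rule lift_Suc_mono_le) (use M(3) in auto)
  show False
  proof (rule compact_operator_not_separated)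
    show "compact_operator (T - id_blinfun)" using T by (simp add: compact_eq_def)
    show "norm (x n) \<le> 1" for n by (simp add: x)
    fix m n :: nat assume mn: "m < n"
    have "x m \<in> M n" using mono[of "Suc m" n] mn x(1) by auto
    moreover have "blinfun_apply T (x m) \<in> M n" using mono[of m n] TM[OF x(1)] mn by auto
    ultimately have "blinfun_apply T (x n) - blinfun_apply T (x m) + x m \<in> M n"
      using TM[OF x(1)] M(1) by (intro subspace_add subspace_diff) auto
    from x(3)[OF this]
    show "1/2 \<le> norm (blinfun_apply (T - id_blinfun) (x n) - blinfun_apply (T - id_blinfun) (x m))"
      by (subst norm_minus_commute) (simp add: blinfun.diff_left algebra_simps)
  qed
qed

lemma no_decreasing_chain:
  assumes M: "\<And>n. subspace (M n)" "\<And>n. closed (M n)" "\<And>n. M (Suc n) \<subset> M n"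
    and TM: "\<And>n x. x \<in> M n \<Longrightarrow> blinfun_apply T x \<in> M (Suc n)"
  shows False
proof -
  have "\<exists>x. x \<in> M n \<and> norm x = 1 \<and> (\<forall>m\<in>M (Suc n). 1/2 \<le> norm (x - m))" for n
    using riesz_lemma[OF M(1) M(2) M(1) M(3), of n] by metis
  then obtain x where x: "\<And>n. x n \<in> M n" "\<And>n. norm (x n) = 1"
    "\<And>n m. m \<in> M (Suc n) \<Longrightarrow> 1/2 \<le> norm (x n - m)" by metis
  have mono: "m \<le> n \<Longrightarrow> M n \<subseteq> M m" for m n
    by (rule lift_Suc_antimono_le) (use M(3) in auto)
  show False
  proof (rule compact_operator_not_separated)
    show "compact_operator (T - id_blinfun)" using T by (simp add: compact_eq_def)
    show "norm (x n) \<le> 1" for n by (simp add: x)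
    fix m n :: nat assume mn: "m < n"
    have "x n \<in> M (Suc m)" using mono[of "Suc m" n] mn x(1) by auto
    moreover have "blinfun_apply T (x n) \<in> M (Suc m)" using mono[of "Suc m" "Suc n"] TM[OF x(1)] mn by auto
    ultimately have "blinfun_apply T (x m) - blinfun_apply T (x n) + x n \<in> M (Suc m)"
      using TM[OF x(1)] M(1) by (intro subspace_add subspace_diff) auto
    from x(3)[OF this]
    show "1/2 \<le> norm (blinfun_apply (T - id_blinfun) (x n) - blinfun_apply (T - id_blinfun) (x m))"
      by (simp add: blinfun.diff_left algebra_simps)
  qed
qed

lemma kernel_finite_span:
  assumes Z: "\<And>x. x \<in> Z \<Longrightarrow> blinfun_apply T x = 0"
  shows "\<exists>B. finite B \<and> Z \<subseteq> span B"
proof (rule ccontr)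
  assume "\<not> ?thesis"
  then have nex: "\<And>B. finite B \<Longrightarrow> \<exists>z\<in>Z. z \<notin> span B" by blast
  have "\<exists>f. \<forall>n. (finite (f n) \<and> f n \<subseteq> Z) \<and> (f n \<subseteq> f (Suc n) \<and> (\<exists>z\<in>f (Suc n). z \<notin> span (f n)))"
  proof (rule dependent_nat_choice)
    show "\<exists>x. finite x \<and> x \<subseteq> Z" by blast
    fix B and n :: nat assume B: "finite B \<and> B \<subseteq> Z"
    then obtain z where "z \<in> Z" "z \<notin> span B" using nex by blast
    then show "\<exists>C. (finite C \<and> C \<subseteq> Z) \<and> (B \<subseteq> C \<and> (\<exists>z\<in>C. z \<notin> span B))"
      using B by (intro exI[of _ "insert z B"]) auto
  qed
  then obtain f where f: "\<And>n. finite (f n)" "\<And>n. f n \<subseteq> Z" "\<And>n. f n \<subseteq> f (Suc n)"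
    "\<And>n. \<exists>z\<in>f (Suc n). z \<notin> span (f n)" by metis
  show False
  proof (rule no_increasing_chain[of "\<lambda>n. span (f n)"])
    show "span (f n) \<subset> span (f (Suc n))" for n
      using f(3,4)[of n] span_mono[OF f(3)] span_base by blast
    fix n x assume x: "x \<in> span (f (Suc n))"
    have "span (f (Suc n)) \<subseteq> {x. blinfun_apply T x = 0}"
      using f(2) Z by (intro span_minimal) (auto simp: subspace_def blinfun.bilinear_simps)
    then have "blinfun_apply T x = 0" using x by blast
    then show "blinfun_apply T x \<in> span (f n)" by (simp add: span_zero)
  qed (auto intro: closed_span_finite f)
qed

text \<open>Otherwise there are unit vectors at distance at least 1/2 from the kernel whose images
  tend to 0. Compactness of T - id makes a subsequence converge, and its limit lies in the
  kernel.\<close>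

lemma bounded_below_modulo_kernel:
  assumes X: "subspace X" "closed X"
  shows "\<exists>c. \<forall>x\<in>X. \<exists>z\<in>X. blinfun_apply T z = 0 \<and> norm (x - z) \<le> c * norm (blinfun_apply T x)"
proof (rule ccontr)
  let ?Z = "X \<inter> {z. blinfun_apply T z = 0}"
  assume "\<not> ?thesis"
  then have "\<forall>c. \<exists>x\<in>X. \<forall>z\<in>?Z. c * norm (blinfun_apply T x) < norm (x - z)"
    unfolding not_ex not_all not_le by (simp add: Ball_def Bex_def not_le) blast
  then have "\<forall>n. \<exists>x\<in>X. \<forall>z\<in>?Z. real (Suc n) * norm (blinfun_apply T x) < norm (x - z)" by blast
  then obtain x where x: "\<And>n. x n \<in> X"
    "\<And>n z. z \<in> ?Z \<Longrightarrow> real (Suc n) * norm (blinfun_apply T (x n)) < norm (x n - z)" by metis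
  have Z: "subspace ?Z" "closed ?Z"
  proof -
    have "subspace {z. blinfun_apply T z = 0}" by (auto simp: subspace_def blinfun.bilinear_simps)
    then show "subspace ?Z" using X(1) by (rule subspace_inter[rotated])
    show "closed ?Z" by (intro closed_Int X(2) closed_Collect_eq continuous_intros)
  qed
  have "x n \<notin> ?Z" for n using x(2)[of "x n" n] by auto
  then have "\<exists>z. z \<in> ?Z \<and> x n \<noteq> z \<and> (\<forall>z'\<in>?Z. 1/2 \<le> norm ((1 / norm (x n - z)) *\<^sub>R (x n - z) - z'))" for n
    using almost_orthogonal_point[OF Z, of "x n"] by metis
  then obtain z where z: "\<And>n. z n \<in> ?Z" "\<And>n. x n \<noteq> z n"
    "\<And>n z'. z' \<in> ?Z \<Longrightarrow> 1/2 \<le> norm ((1 / norm (x n - z n)) *\<^sub>R (x n - z n) - z')" by metis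
  define u where "u = (\<lambda>n. (1 / norm (x n - z n)) *\<^sub>R (x n - z n))"
  have u_norm: "norm (u n) = 1" for n using z(2)[of n] by (simp add: u_def)
  have uX: "u n \<in> X" for n
    unfolding u_def using x(1) z(1) X(1) by (intro subspace_scale subspace_diff) auto
  have Tu: "norm (blinfun_apply T (u n)) \<le> inverse (real (Suc n))" for n
  proof -
    have r: "norm (x n - z n) > 0" using z(2)[of n] by simp
    have "blinfun_apply T (z n) = 0" using z(1)[of n] by simp
    then have "norm (blinfun_apply T (u n)) = norm (blinfun_apply T (x n)) / norm (x n - z n)"
      by (simp add: u_def blinfun.bilinear_simps)
    also have "\<dots> \<le> inverse (real (Suc n))"
      using x(2)[OF z(1), of n n] r by (simp add: field_simps)
    finally show ?thesis .
  qed
  have "(\<lambda>n. blinfun_apply T (u n)) \<longlonglongrightarrow> 0"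
    by (rule Lim_null_comparison[OF _ LIMSEQ_inverse_real_of_nat]) (intro always_eventually allI Tu)
  moreover obtain r l where r: "strict_mono r" "(\<lambda>n. blinfun_apply (T - id_blinfun) (u (r n))) \<longlonglongrightarrow> l"
    using compact_operator_convergent_subsequence[of "T - id_blinfun" u] T
    unfolding compact_eq_def by (auto simp: u_norm)
  ultimately have Tur: "(\<lambda>n. blinfun_apply T (u (r n))) \<longlonglongrightarrow> 0"
    using LIMSEQ_subseq_LIMSEQ[of _ 0 r] by (simp add: o_def)
  from tendsto_diff[OF this r(2)] have ul: "(\<lambda>n. u (r n)) \<longlonglongrightarrow> - l"
    by (simp add: blinfun.diff_left)
  then have "- l \<in> X" by (rule closed_sequentially[OF X(2) uX])
  moreover have "blinfun_apply T (- l) = 0"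
    using LIMSEQ_unique[OF blinfun.tendsto[OF tendsto_const ul] Tur] .
  ultimately have "- l \<in> ?Z" by simp
  then have "1/2 \<le> norm (u (r n) - - l)" for n using z(3) unfolding u_def by blast
  moreover have "(\<lambda>n. norm (u (r n) - - l)) \<longlonglongrightarrow> norm (- l - - l)"
    by (intro tendsto_intros ul)
  ultimately have "1/2 \<le> norm (- l - - l)" by (intro LIMSEQ_le_const) auto
  then show False by simp
qed

text \<open>Preimages can be chosen with norm controlled by their images, so a convergent sequence
  in the range has bounded preimages; compactness of T - id extracts a convergent subsequence of
  them.\<close>

lemma closed_range_on:
  assumes X: "subspace X" "closed X"
  shows "closed (blinfun_apply T ` X)"
  unfolding closed_sequential_limits
proof (intro allI impI)
  fix y l assume yl: "(\<forall>n. y n \<in> blinfun_apply T ` X) \<and> y \<longlonglongrightarrow> l"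
  obtain c where c: "\<And>x. x \<in> X \<Longrightarrow> \<exists>z\<in>X. blinfun_apply T z = 0 \<and> norm (x - z) \<le> c * norm (blinfun_apply T x)"
    using bounded_below_modulo_kernel[OF X] by blast
  have "\<exists>w\<in>X. blinfun_apply T w = y n \<and> norm w \<le> c * norm (y n)" for n
  proof -
    obtain x where x: "x \<in> X" "y n = blinfun_apply T x" using yl by blast
    then obtain z where "z \<in> X" "blinfun_apply T z = 0" "norm (x - z) \<le> c * norm (blinfun_apply T x)"
      using c by blast
    then show ?thesis
      using x subspace_diff[OF X(1)] by (intro bexI[of _ "x - z"]) (auto simp: blinfun.diff_right)
  qed
  then obtain w where w: "\<And>n. w n \<in> X" "\<And>n. blinfun_apply T (w n) = y n" "\<And>n. norm (w n) \<le> c * norm (y n)"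
    by metis
  obtain C where C: "\<And>n. norm (y n) \<le> C"
    using convergent_imp_Bseq[OF convergentI[OF conjunct2[OF yl]]] unfolding Bseq_def by blast
  \<comment> \<open>A positive bound for the preimages, by which they are scaled into the unit
    ball.\<close>
  define b where "b = \<bar>c\<bar> * C + 1"
  have "norm (w n) \<le> \<bar>c\<bar> * C" for n
  proof -
    have "c * norm (y n) \<le> \<bar>c\<bar> * norm (y n)" by (intro mult_right_mono) auto
    also have "\<dots> \<le> \<bar>c\<bar> * C" using C by (intro mult_left_mono) auto
    finally show ?thesis using w(3)[of n] by simp
  qed
  then have b: "b > 0" "\<And>n. norm (w n) \<le> b"
    unfolding b_def using order_trans[OF norm_ge_zero[of "w 0"]] by (fastforce intro: add_nonneg_pos add_increasing2)+
  obtain r k where r: "strict_mono r" "(\<lambda>n. blinfun_apply (T - id_blinfun) ((1 / b) *\<^sub>R w (r n))) \<longlonglongrightarrow> k"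
    using compact_operator_convergent_subsequence[of "T - id_blinfun" "\<lambda>n. (1 / b) *\<^sub>R w n"] T b
    unfolding compact_eq_def by (auto simp: divide_simps)
  from tendsto_scaleR[OF tendsto_const r(2), of b]
  have k: "(\<lambda>n. y (r n) - w (r n)) \<longlonglongrightarrow> b *\<^sub>R k"
    using b(1) by (simp add: blinfun.bilinear_simps w(2) scaleR_diff_right)
  have "(\<lambda>n. y (r n)) \<longlonglongrightarrow> l"
    using LIMSEQ_subseq_LIMSEQ[OF conjunct2[OF yl] r(1)] by (simp add: o_def)
  note yr = this
  from tendsto_diff[OF yr k] have wl: "(\<lambda>n. w (r n)) \<longlonglongrightarrow> l - b *\<^sub>R k" by simp
  then have "l - b *\<^sub>R k \<in> X" by (rule closed_sequentially[OF X(2) w(1)])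
  moreover have "blinfun_apply T (l - b *\<^sub>R k) = l"
    by (rule LIMSEQ_unique[OF blinfun.tendsto[OF tendsto_const wl]]) (simp add: w(2) yr)
  ultimately show "l \<in> blinfun_apply T ` X" by (metis imageI)
qed

end

section \<open>Powers of T and the Riesz decomposition\<close>

lemma op_power_compact_eq:
  assumes "T \<sim>\<^sub>K id_blinfun"
  shows "op_power T n \<sim>\<^sub>K id_blinfun"
proof (induction n)
  case (Suc n)
  then show ?case using compact_eq_compose[OF assms Suc] by simp
qed simp

lemma op_power_add: "op_power T (m + n) = op_power T m o\<^sub>L op_power T n"
  by (induction m) (simp_all add: blinfun_compose_assoc)

lemma op_power_Suc_right: "op_power T (Suc n) = op_power T n o\<^sub>L T"
  using op_power_commute[of T T n] by simp

text \<open>Covers both real scalars and complex scalars that extend the real ones.\<close>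

locale bounded_scaling = scaling s
  for s :: "'k::field \<Rightarrow> 'a::banach \<Rightarrow> 'a" +
  assumes real_scalar: "\<exists>c. \<forall>x. s c x = r *\<^sub>R x"
    and bounded: "bounded_linear (s c)"
begin

lemma real_subspace:
  assumes "subspace V"
  shows "real_vector.subspace V"
  unfolding real_vector.subspace_def
proof (intro conjI ballI allI)
  show "0 \<in> V" using assms by (rule subspace_0)
  show "x + y \<in> V" if "x \<in> V" "y \<in> V" for x y using assms that by (rule subspace_add)
  fix r x assume "x \<in> V"
  obtain c where "\<forall>x. s c x = r *\<^sub>R x" using real_scalar by blast
  then show "r *\<^sub>R x \<in> V" using subspace_scale[OF assms \<open>x \<in> V\<close>, of c] by simp
qed

lemma finite_dim_of_real_span:
  assumes "finite B" "V \<subseteq> real_vector.span B"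
  shows "finite_dim V"
proof -
  have "real_vector.span B \<subseteq> span B"
    by (intro real_vector.span_minimal real_subspace span_superset subspace_span)
  then show ?thesis unfolding finite_dim_def using assms by blast
qed

lemma lin_on_of_scalar_linear: "scalar_linear s T \<Longrightarrow> lin_on V (blinfun_apply T)"
  unfolding scalar_linear_def lin_on_def by (simp add: blinfun.add_right)

lemma scalar_linear_compose: "scalar_linear s S \<Longrightarrow> scalar_linear s T \<Longrightarrow> scalar_linear s (S o\<^sub>L T)"
  and scalar_linear_add: "scalar_linear s S \<Longrightarrow> scalar_linear s T \<Longrightarrow> scalar_linear s (S + T)"
  and scalar_linear_diff: "scalar_linear s S \<Longrightarrow> scalar_linear s T \<Longrightarrow> scalar_linear s (S - T)"
  and scalar_linear_id: "scalar_linear s id_blinfun"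
  unfolding scalar_linear_def
  by (simp_all add: blinfun.bilinear_simps scale_right_distrib scale_right_diff_distrib)

lemma scalar_linear_op_power: "scalar_linear s T \<Longrightarrow> scalar_linear s (op_power T n)"
  by (induction n) (simp_all add: scalar_linear_id scalar_linear_compose)

text \<open>Kernels and ranges of the powers of T stabilise, because a strict chain contradicts
  compactness. From then on X is the direct sum of the stable range, on which T is bijective, and
  the finite-dimensional stable kernel.\<close>

lemma index_id_plus_compact:
  assumes T: "T \<sim>\<^sub>K id_blinfun" "scalar_linear s T"
    and X: "subspace X" "closed X" and TX: "blinfun_apply T ` X \<subseteq> X"
  shows "fredholm X X (blinfun_apply T)" and "fredholm_index s X X (blinfun_apply T) = 0"
proof -
  define p where "p = (\<lambda>n. blinfun_apply (op_power T n))"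
  define N where "N = (\<lambda>n. {x \<in> X. p n x = 0})"
  define R where "R = (\<lambda>n. p n ` X)"
  have p_0: "p 0 x = x" and p_Suc: "p (Suc n) x = blinfun_apply T (p n x)"
    and p_add: "p (m + n) x = p m (p n x)" for m n x
    by (simp_all add: p_def op_power_add)
  have p_Suc': "p (Suc n) x = p n (blinfun_apply T x)" for n x
    unfolding p_def op_power_Suc_right by simp
  have p_zero: "p n 0 = 0" for n by (simp add: p_def)
  have pX: "x \<in> X \<Longrightarrow> p n x \<in> X" for n x
    by (induction n) (use TX in \<open>auto simp: p_0 p_Suc\<close>)
  have lin: "lin_on V (p n)" for V n
    unfolding p_def by (intro lin_on_of_scalar_linear scalar_linear_op_power T)
  have sN: "subspace (N n)" and sR: "subspace (R n)" for n
    unfolding N_def R_def by (intro lin_on_subspace_kernel lin_on_subspace_image lin X)+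
  have cN: "closed (N n)" for n
  proof -
    have "N n = X \<inter> {x. p n x = 0}" by (auto simp: N_def)
    then show ?thesis unfolding p_def by (auto intro!: closed_Int X(2) closed_Collect_eq continuous_intros)
  qed
  have cR: "closed (R n)" for n
    unfolding R_def p_def by (rule closed_range_on[OF op_power_compact_eq[OF T(1)] real_subspace[OF X(1)] X(2)])
  have N_Suc: "N n \<subseteq> N (Suc n)" and TN: "x \<in> N (Suc n) \<Longrightarrow> blinfun_apply T x \<in> N n" for n x
    using TX by (auto simp: N_def p_Suc) (auto simp: N_def p_Suc simp flip: p_Suc')
  have R_Suc: "R (Suc n) \<subseteq> R n" and TR: "R (Suc n) = blinfun_apply T ` R n" for n
    using TX by (auto simp: R_def p_Suc' image_subset_iff) (auto simp: R_def p_Suc image_iff simp flip: p_Suc')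
  have "\<exists>n. N (Suc n) = N n"
  proof (rule ccontr)
    assume "\<not> ?thesis"
    then show False
      using no_increasing_chain[OF T(1), of N] real_subspace[OF sN] cN N_Suc TN by blast
  qed
  then obtain i where i: "N (Suc i) = N i" by blast
  have "\<exists>n. R (Suc n) = R n"
  proof (rule ccontr)
    assume "\<not> ?thesis"
    then show False
      using no_decreasing_chain[OF T(1), of R] real_subspace[OF sR] cR R_Suc TR by blast
  qed
  then obtain j where j: "R (Suc j) = R j" by blast
  have N_stable: "N n = N i" if "n \<ge> i" for n
    using that
  proof (induction n rule: dec_induct)
    case (step n)
    have "x \<in> N n" if x: "x \<in> N (Suc n)" for x
    proof -
      have "blinfun_apply T x \<in> N i" using TN[OF x] step.IH by simp
      then have "x \<in> N (Suc i)" using x by (simp add: N_def p_Suc')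
      then show ?thesis using i step.IH by simp
    qed
    then show ?case using N_Suc[of n] step.IH by blast
  qed simp
  have R_stable: "R n = R j" if "n \<ge> j" for n
    using that
  proof (induction n rule: dec_induct)
    case (step n)
    then show ?case using TR[of n] TR[of j] j by simp
  qed simp
  \<comment> \<open>The successor makes \<open>m\<close> positive, so that the kernel of T itself is
    contained in \<open>N m\<close>.\<close>
  define m where "m = Suc (max i j)"
  have Nm: "N (m + m) = N m" using N_stable[of m] N_stable[of "m + m"] by (simp add: m_def)
  have Rm: "R (m + m) = R m" "R (Suc m) = R m"
    using R_stable[of m] R_stable[of "m + m"] R_stable[of "Suc m"] by (simp_all add: m_def)
  have int: "x = 0" if x: "x \<in> R m" "x \<in> N m" for x
  proof -
    obtain y where y: "y \<in> X" "x = p m y" using x(1) by (auto simp: R_def)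
    then have "y \<in> N (m + m)" using x(2) by (simp add: N_def p_add)
    then have "y \<in> N m" unfolding Nm .
    then show ?thesis using y by (simp add: N_def)
  qed
  have ds: "direct_sum (R m) (N m) X"
    unfolding direct_sum_def
  proof (intro conjI sR sN)
    show "R m \<inter> N m = {0}" using int subspace_0[OF sR] subspace_0[OF sN] by blast
    show "{a + b |a b. a \<in> R m \<and> b \<in> N m} = X"
    proof (intro equalityI subsetI)
      fix x assume x: "x \<in> X"
      then have "p m x \<in> R (m + m)" unfolding Rm by (auto simp: R_def)
      then obtain y where y: "y \<in> X" "p m x = p m (p m y)" by (auto simp: R_def p_add)
      have "x - p m y \<in> X" using x pX[OF y(1)] subspace_diff[OF X(1)] by blast
      moreover have "p m (x - p m y) = 0" using y(2) by (simp add: p_def blinfun.diff_right)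
      ultimately have "x - p m y \<in> N m" by (simp add: N_def)
      moreover have "p m y \<in> R m" using y(1) by (auto simp: R_def)
      ultimately show "x \<in> {a + b |a b. a \<in> R m \<and> b \<in> N m}"
        by (intro CollectI exI[of _ "p m y"] exI[of _ "x - p m y"]) simp
    next
      fix x assume "x \<in> {a + b |a b. a \<in> R m \<and> b \<in> N m}"
      then show "x \<in> X" using pX subspace_add[OF X(1)] by (auto simp: R_def N_def)
    qed
  qed
  have N1: "x \<in> N m" if "x \<in> X" "blinfun_apply T x = 0" for x
    using that by (simp add: N_def m_def p_Suc' p_zero)
  have inj: "inj_on (blinfun_apply T) (R m)"
    by (rule lin_on_inj[OF lin_on_of_scalar_linear[OF T(2)] sR])
      (use int N1 direct_sum_subset(1)[OF ds] in blast)
  have fin: "finite_dim (N m)"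
    using kernel_finite_span[OF op_power_compact_eq[OF T(1)], of "N m" m] finite_dim_of_real_span
    by (auto simp: N_def p_def)
  \<comment> \<open>T maps the stable range onto itself, so the stable kernel complements both the
    domain and the range of the injective part, and the index is dim (N m) - dim (N m).\<close>
  have ds': "direct_sum (N m) (blinfun_apply T ` R m) X"
    using direct_sum_commute[OF ds] Rm(2) TR by simp
  note idx = fredholm_index_eq[OF lin_on_of_scalar_linear[OF T(2)] TX ds inj ds' fin fin]
  show "fredholm X X (blinfun_apply T)" by (rule idx(1))
  show "fredholm_index s X X (blinfun_apply T) = 0" using idx(2) by simp
qed

section \<open>Comparison and transport of indices\<close>

lemma fredholm_cong:
  assumes "\<And>x. x \<in> X \<Longrightarrow> f x = g x"
  shows "fredholm X Y f \<longleftrightarrow> fredholm X Y g" and "fredholm_index s X Y f = fredholm_index s X Y g"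
proof -
  have "{x \<in> X. f x = 0} = {x \<in> X. g x = 0}" "f ` X = g ` X" using assms by auto
  then show "fredholm X Y f \<longleftrightarrow> fredholm X Y g" "fredholm_index s X Y f = fredholm_index s X Y g"
    unfolding fredholm_def fredholm_index_def by simp_all
qed

text \<open>
  \<open>T1\<close>, \<open>T2\<close>, \<open>T3\<close> stand in for \<open>H \<circ> F\<close>, \<open>H \<circ> G\<close>, \<open>F \<circ> H\<close>, which are compact perturbations of
  the identity only on \<open>X\<close> and \<open>Y\<close>.
\<close>

lemma index_eq_of_common_parametrix:
  assumes X: "subspace X" "closed X" and Y: "subspace Y" "closed Y"
    and lin: "scalar_linear s F" "scalar_linear s G" "scalar_linear s H"
    and maps: "blinfun_apply F ` X \<subseteq> Y" "blinfun_apply G ` X \<subseteq> Y" "blinfun_apply H ` Y \<subseteq> X"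
    and T1: "T1 \<sim>\<^sub>K id_blinfun" "scalar_linear s T1" "\<And>x. x \<in> X \<Longrightarrow> blinfun_apply T1 x = blinfun_apply H (blinfun_apply F x)"
    and T2: "T2 \<sim>\<^sub>K id_blinfun" "scalar_linear s T2" "\<And>x. x \<in> X \<Longrightarrow> blinfun_apply T2 x = blinfun_apply H (blinfun_apply G x)"
    and T3: "T3 \<sim>\<^sub>K id_blinfun" "scalar_linear s T3" "\<And>y. y \<in> Y \<Longrightarrow> blinfun_apply T3 y = blinfun_apply F (blinfun_apply H y)"
  shows "fredholm_index s X Y (blinfun_apply F) = fredholm_index s X Y (blinfun_apply G)"
proof -
  \<comment> \<open>\<open>T3\<close> yields finiteness of the kernel of \<open>H\<close>, on which
    additivity of the index depends.\<close>
  have "fredholm Y Y (blinfun_apply T3)"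
    by (rule index_id_plus_compact(1)[OF T3(1,2) Y]) (use T3(3) maps in \<open>force simp: image_subset_iff\<close>)
  then have "fredholm Y Y (\<lambda>y. blinfun_apply F (blinfun_apply H y))"
    using fredholm_cong(1)[OF T3(3)] by simp
  then have "finite_dim {y \<in> Y. blinfun_apply F (blinfun_apply H y) = 0}"
    unfolding fredholm_def by blast
  then have fin: "finite_dim {y \<in> Y. blinfun_apply H y = 0}"
    by (rule finite_dim_subset) auto
  \<comment> \<open>H S has index 0, so S has the opposite of the index of H. This determines the
    index of F and of G alike.\<close>
  have sum: "fredholm_index s X Y (blinfun_apply S) + fredholm_index s Y X (blinfun_apply H) = 0"
    if S: "scalar_linear s S" "blinfun_apply S ` X \<subseteq> Y" and T: "T \<sim>\<^sub>K id_blinfun" "scalar_linear s T"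
      "\<And>x. x \<in> X \<Longrightarrow> blinfun_apply T x = blinfun_apply H (blinfun_apply S x)" for S T
  proof -
    have TX: "blinfun_apply T ` X \<subseteq> X" using T(3) S(2) maps(3) by auto
    have eq: "\<And>x. x \<in> X \<Longrightarrow> blinfun_apply T x = (blinfun_apply H \<circ> blinfun_apply S) x" using T(3) by simp
    have "fredholm X X (blinfun_apply H \<circ> blinfun_apply S)"
      by (rule fredholm_cong(1)[THEN iffD1, OF eq index_id_plus_compact(1)[OF T(1,2) X TX]])
    from fredholm_index_compose[OF X(1) Y(1) lin_on_of_scalar_linear[OF S(1)] S(2)
        lin_on_of_scalar_linear[OF lin(3)] maps(3) this fin]
    show ?thesis
      using index_id_plus_compact(2)[OF T(1,2) X TX]
        fredholm_cong(2)[of X "blinfun_apply T" "blinfun_apply H \<circ> blinfun_apply S" X, OF eq]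
      by (simp only:)
  qed
  show ?thesis
    using sum[OF lin(1) maps(1) T1] sum[OF lin(2) maps(2) T2] by simp
qed

lemma index_transport:
  assumes lin: "lin_on UNIV U" "lin_on UNIV V" "lin_on UNIV V'" "lin_on UNIV T"
    and inj: "inj U" and V: "\<And>x. V' (V x) = x" "\<And>x. V (V' x) = x"
    and X: "subspace X" and Y: "subspace Y" and T: "T ` U ` X \<subseteq> V ` Y"
  shows "fredholm_index s (U ` X) (V ` Y) T = fredholm_index s X Y (V' \<circ> T \<circ> U)"
proof -
  have sub: "lin_on A f" if "lin_on UNIV f" for A f by (rule lin_on_subset[OF that]) simp
  have lincomp: "lin_on UNIV (f \<circ> g)" if "lin_on UNIV f" "lin_on UNIV g" for f g
    using that by (simp add: lin_on_def)
  have lin': "lin_on UNIV (V' \<circ> T \<circ> U)" by (intro lincomp lin)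
  have V'0: "V' y = 0 \<longleftrightarrow> y = 0" for y
    using V lin_on_zero[OF lin(3)] lin_on_zero[OF lin(2)] by (metis UNIV_I)
  let ?K = "{x \<in> X. (V' \<circ> T \<circ> U) x = 0}"
  have sK: "subspace ?K" by (rule lin_on_subspace_kernel[OF sub[OF lin'] X])
  have "{y \<in> U ` X. T y = 0} = U ` ?K" using V'0 by auto
  then have ker: "dim {y \<in> U ` X. T y = 0} = dim ?K"
    using lin_on_image_dim(1)[OF sK sub[OF lin(1)] inj_on_subset[OF inj]] by simp
  let ?R = "(V' \<circ> T \<circ> U) ` X"
  have sR: "subspace ?R" by (rule lin_on_subspace_image[OF sub[OF lin'] X])
  have RY: "?R \<subseteq> Y" using T V(1) by (force simp: image_subset_iff)
  obtain C where C: "direct_sum C ?R Y" using direct_sum_exists[OF sR Y RY] by blast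
  have sC: "subspace C" using C unfolding direct_sum_def by auto
  have injV: "inj V" using V(1) by (metis injI)
  have VR: "V ` ?R = T ` U ` X" using V(2) by (force simp: image_iff)
  have "direct_sum (V ` C) (V ` ?R) (V ` Y)"
    unfolding direct_sum_def
  proof (intro conjI)
    show "subspace (V ` C)" by (rule lin_on_subspace_image[OF sub[OF lin(2)] sC])
    show "subspace (V ` ?R)" by (rule lin_on_subspace_image[OF sub[OF lin(2)] sR])
    have "V ` C \<inter> V ` ?R = V ` (C \<inter> ?R)" by (rule image_Int[OF injV, symmetric])
    then show "V ` C \<inter> V ` ?R = {0}"
      using C lin_on_zero[OF lin(2)] unfolding direct_sum_def by simp
    have "Y = {a + b |a b. a \<in> C \<and> b \<in> ?R}" using C unfolding direct_sum_def by auto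
    moreover have add: "V (a + b) = V a + V b" for a b using lin(2) unfolding lin_on_def by blast
    ultimately show "{a + b |a b. a \<in> V ` C \<and> b \<in> V ` ?R} = V ` Y"
      by (auto simp: image_iff add) (metis add)+
  qed
  then have "codim_in s (V ` Y) (T ` U ` X) = dim (V ` C)"
    unfolding VR by (rule codim_in_eq)
  also have "\<dots> = dim C" by (rule lin_on_image_dim(1)[OF sC sub[OF lin(2)] inj_on_subset[OF injV]]) simp
  also have "\<dots> = codim_in s Y ?R" by (rule codim_in_eq[OF C, symmetric])
  finally show ?thesis unfolding fredholm_index_def using ker by simp
qed

end

subsection \<open>Relative dimension under compactly perturbed isomorphisms\<close>

context bounded_scaling
begin

lemma projector_apply: "is_projector_onto s P X \<Longrightarrow> x \<in> X \<Longrightarrow> blinfun_apply P x = x"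
  unfolding is_projector_onto_def by (metis blinfun_apply_blinfun_compose rangeE)

lemma projector_range: "is_projector_onto s P X \<Longrightarrow> blinfun_apply P x \<in> X"
  unfolding is_projector_onto_def by blast

lemma projector_compose:
  assumes "is_projector_onto s P X" "is_projector_onto s Q X"
  shows "P o\<^sub>L Q = Q"
  by (rule blinfun_eqI) (simp add: projector_apply[OF assms(1) projector_range[OF assms(2)]])

lemma projector_subspace: "is_projector_onto s P X \<Longrightarrow> subspace X"
  using lin_on_subspace_image[OF lin_on_of_scalar_linear subspace_UNIV]
  unfolding is_projector_onto_def by blast

lemma projector_closed:
  assumes "is_projector_onto s P X"
  shows "closed X"
proof -
  have "X = {x. blinfun_apply P x = x}"
    using projector_apply[OF assms] projector_range[OF assms] by (metis (mono_tags, lifting) Collect_cong Collect_mem_eq)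
  then show ?thesis by (simp add: closed_Collect_eq continuous_intros)
qed

text \<open>One congruent pair of projectors suffices: P P1 = P1 and Q1 Q = Q allow (id - P1) Q1 to
  be inserted between id - P and Q, and this is congruent to (id - Q1) Q1 = 0.\<close>

lemma compact_operator_of_projectors:
  assumes P1: "is_projector_onto s P1 X" and Q1: "is_projector_onto s Q1 Y" and PQ: "P1 \<sim>\<^sub>K Q1"
    and P: "is_projector_onto s P X" and Q: "is_projector_onto s Q Y"
  shows "compact_operator ((id_blinfun - P) o\<^sub>L Q)"
proof -
  have "(id_blinfun - P) o\<^sub>L Q = ((id_blinfun - P) o\<^sub>L ((id_blinfun - P1) o\<^sub>L Q1)) o\<^sub>L Q"
    using projector_compose[OF P P1] projector_compose[OF Q1 Q]
    by (simp add: blinfun_compose_simps flip: blinfun_compose_assoc) (simp add: blinfun_compose_assoc)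
  also have "\<dots> \<sim>\<^sub>K ((id_blinfun - P) o\<^sub>L ((id_blinfun - Q1) o\<^sub>L Q1)) o\<^sub>L Q"
    by (intro compact_eq_compose compact_eq_diff compact_eq_refl PQ)
  also have "((id_blinfun - P) o\<^sub>L ((id_blinfun - Q1) o\<^sub>L Q1)) o\<^sub>L Q = 0"
    using projector_compose[OF Q1 Q1] by (simp add: blinfun_compose_simps)
  finally show ?thesis by (simp add: compact_eq_0_iff)
qed

lemma scalar_linear_inverse:
  assumes "scalar_linear s U" "U o\<^sub>L V = id_blinfun" "V o\<^sub>L U = id_blinfun"
  shows "scalar_linear s V"
proof -
  have UV: "blinfun_apply U (blinfun_apply V x) = x" "blinfun_apply V (blinfun_apply U x) = x" for x
    using assms(2,3) by (metis blinfun_apply_blinfun_compose blinfun_apply_id_blinfun)+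
  show ?thesis
    unfolding scalar_linear_def
    by (metis UV assms(1) scalar_linear_def)
qed

lemma conjugate_projector:
  assumes P: "is_projector_onto s P X" and U: "scalar_linear s U" "U o\<^sub>L U' = id_blinfun" "U' o\<^sub>L U = id_blinfun"
  shows "is_projector_onto s ((U o\<^sub>L P) o\<^sub>L U') (blinfun_apply U ` X)"
  unfolding is_projector_onto_def
proof (intro conjI)
  have P': "scalar_linear s P" "P o\<^sub>L P = P" "range (blinfun_apply P) = X"
    using P unfolding is_projector_onto_def by auto
  show "scalar_linear s ((U o\<^sub>L P) o\<^sub>L U')"
    by (intro scalar_linear_compose U P' scalar_linear_inverse[OF U])
  have "((U o\<^sub>L P) o\<^sub>L U') o\<^sub>L ((U o\<^sub>L P) o\<^sub>L U') = (U o\<^sub>L (P o\<^sub>L ((U' o\<^sub>L U) o\<^sub>L P))) o\<^sub>L U'"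
    by (simp only: blinfun_compose_assoc)
  then show "((U o\<^sub>L P) o\<^sub>L U') o\<^sub>L ((U o\<^sub>L P) o\<^sub>L U') = (U o\<^sub>L P) o\<^sub>L U'"
    by (simp add: U P')
  have "surj (blinfun_apply U')"
    using U(3) by (metis blinfun_apply_blinfun_compose blinfun_apply_id_blinfun surjI)
  moreover have "range (blinfun_apply ((U o\<^sub>L P) o\<^sub>L U')) = blinfun_apply U ` blinfun_apply P ` range (blinfun_apply U')"
    by (simp add: image_image)
  ultimately have "range (blinfun_apply ((U o\<^sub>L P) o\<^sub>L U')) = blinfun_apply U ` blinfun_apply P ` UNIV"
    by simp
  then show "range (blinfun_apply ((U o\<^sub>L P) o\<^sub>L U')) = blinfun_apply U ` X"
    using P'(3) by simp
qed

lemma relative_dim_isomorphic_image: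
  assumes P: "is_projector_onto s P X" and Q: "is_projector_onto s Q Y" and PQ: "P \<sim>\<^sub>K Q"
    and U: "scalar_linear s U" "U o\<^sub>L U' = id_blinfun" "U' o\<^sub>L U = id_blinfun"
    and V: "scalar_linear s V" "V o\<^sub>L V' = id_blinfun" "V' o\<^sub>L V = id_blinfun" and UV: "U \<sim>\<^sub>K V"
  shows "compact_perturbation s (blinfun_apply U ` X) (blinfun_apply V ` Y)"
    and "relative_dim s (blinfun_apply U ` X) (blinfun_apply V ` Y) = relative_dim s X Y"
proof -
  let ?UX = "blinfun_apply U ` X" and ?VY = "blinfun_apply V ` Y"
  note P1 = conjugate_projector[OF P U] and Q1 = conjugate_projector[OF Q V]
  have P1Q1: "((U o\<^sub>L P) o\<^sub>L U') \<sim>\<^sub>K ((V o\<^sub>L Q) o\<^sub>L V')"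
    by (intro compact_eq_compose UV PQ compact_eq_inverse[OF U(2,3) V(2,3) UV])
  show "compact_perturbation s ?UX ?VY"
    unfolding compact_perturbation_def
    using P1 Q1 compact_operator_of_projectors[OF P1 Q1 P1Q1]
      compact_operator_of_projectors[OF Q1 P1 compact_eq_sym[OF P1Q1]] by blast
  define F where "F = (SOME Q. is_projector_onto s Q Y)"
  define F1 where "F1 = (SOME Q. is_projector_onto s Q ?VY)"
  have F: "is_projector_onto s F Y" unfolding F_def using Q by (rule someI)
  have F1: "is_projector_onto s F1 ?VY" unfolding F1_def using Q1 by (rule someI)
  note X' = projector_subspace[OF P] projector_closed[OF P] and Y' = projector_subspace[OF Q] projector_closed[OF Q]
  have lin: "scalar_linear s P" "scalar_linear s Q" "scalar_linear s F" "scalar_linear s F1"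
    using P Q F F1 unfolding is_projector_onto_def by auto
  have U'_lin: "scalar_linear s V'" by (rule scalar_linear_inverse[OF V])
  \<comment> \<open>The projection onto V Y, pulled back to a map from X to Y. It is to have the
    same index as the projection F restricted to X.\<close>
  define G where "G = (V' o\<^sub>L F1) o\<^sub>L U"
  have G_lin: "scalar_linear s G" unfolding G_def by (intro scalar_linear_compose U V lin U'_lin)
  have VV: "blinfun_apply V (blinfun_apply V' x) = x" "blinfun_apply V' (blinfun_apply V x) = x" for x
    using V(2,3) by (metis blinfun_apply_blinfun_compose blinfun_apply_id_blinfun)+
  have injU: "inj (blinfun_apply U)"
    using U(3) by (metis blinfun_apply_blinfun_compose blinfun_apply_id_blinfun injI)
  have "fredholm_index s ?UX ?VY (blinfun_apply F1) = fredholm_index s X Y (blinfun_apply V' \<circ> blinfun_apply F1 \<circ> blinfun_apply U)"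
    by (rule index_transport[OF lin_on_of_scalar_linear[OF U(1)] lin_on_of_scalar_linear[OF V(1)]
          lin_on_of_scalar_linear[OF U'_lin] lin_on_of_scalar_linear[OF lin(4)] injU VV(2,1) X'(1) Y'(1)])
      (use projector_range[OF F1] in auto)
  also have "blinfun_apply V' \<circ> blinfun_apply F1 \<circ> blinfun_apply U = blinfun_apply G"
    by (simp add: G_def fun_eq_iff)
  also have "fredholm_index s X Y (blinfun_apply G) = fredholm_index s X Y (blinfun_apply F)"
  proof (rule index_eq_of_common_parametrix[OF X' Y' G_lin lin(3,1)])
    have GY: "blinfun_apply G x \<in> Y" for x
    proof -
      obtain y where "y \<in> Y" "blinfun_apply F1 (blinfun_apply U x) = blinfun_apply V y"
        using projector_range[OF F1, of "blinfun_apply U x"] by blast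
      then show ?thesis by (simp add: G_def VV)
    qed
    then show "blinfun_apply G ` X \<subseteq> Y" by auto
    show "blinfun_apply F ` X \<subseteq> Y" "blinfun_apply P ` Y \<subseteq> X"
      using projector_range[OF F] projector_range[OF P] by auto
    have FP: "((F - id_blinfun) o\<^sub>L P) \<sim>\<^sub>K 0"
    proof -
      have "((F - id_blinfun) o\<^sub>L P) \<sim>\<^sub>K ((F - id_blinfun) o\<^sub>L Q)"
        by (intro compact_eq_compose compact_eq_refl PQ)
      then show ?thesis using projector_compose[OF F Q] by (simp add: blinfun_compose_simps)
    qed
    have GP: "((G - id_blinfun) o\<^sub>L P) \<sim>\<^sub>K 0"
    proof -
      have "((G - id_blinfun) o\<^sub>L P) \<sim>\<^sub>K ((((V' o\<^sub>L F1) o\<^sub>L V) - id_blinfun) o\<^sub>L Q)"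
        unfolding G_def by (intro compact_eq_compose compact_eq_diff compact_eq_refl PQ UV)
      also have "(((V' o\<^sub>L F1) o\<^sub>L V) - id_blinfun) o\<^sub>L Q = 0"
      proof (rule blinfun_eqI)
        fix x
        have "blinfun_apply F1 (blinfun_apply V (blinfun_apply Q x)) = blinfun_apply V (blinfun_apply Q x)"
          by (rule projector_apply[OF F1]) (use projector_range[OF Q] in blast)
        then show "blinfun_apply ((((V' o\<^sub>L F1) o\<^sub>L V) - id_blinfun) o\<^sub>L Q) x = blinfun_apply 0 x"
          by (simp add: blinfun.bilinear_simps VV)
      qed
      finally show ?thesis .
    qed
    have PF: "((P - id_blinfun) o\<^sub>L G) \<sim>\<^sub>K 0"
    proof -
      have "(P - id_blinfun) o\<^sub>L G = ((P - id_blinfun) o\<^sub>L Q) o\<^sub>L G"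
        by (rule blinfun_eqI) (simp add: projector_apply[OF Q GY])
      also have "\<dots> \<sim>\<^sub>K (((P - id_blinfun) o\<^sub>L P) o\<^sub>L G)"
        by (intro compact_eq_compose compact_eq_refl compact_eq_sym[OF PQ])
      also have "((P - id_blinfun) o\<^sub>L P) o\<^sub>L G = 0"
        using projector_compose[OF P P] by (simp add: blinfun_compose_simps)
      finally show ?thesis .
    qed
    have add0: "(id_blinfun + S) \<sim>\<^sub>K id_blinfun" if "S \<sim>\<^sub>K 0" for S :: "'a \<Rightarrow>\<^sub>L 'a"
      using compact_eq_add[OF compact_eq_refl that, of id_blinfun] by simp
    have left0: "(C o\<^sub>L S) \<sim>\<^sub>K 0" if "S \<sim>\<^sub>K 0" for C S :: "'a \<Rightarrow>\<^sub>L 'a"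
      using compact_eq_compose[OF compact_eq_refl that, of C] by simp
    \<comment> \<open>On X, where P is the identity, this extension of P G reads x + P (G x - x) = P
      G x; on the whole space it is congruent to the identity.\<close>
    show "(id_blinfun + (P o\<^sub>L ((G - id_blinfun) o\<^sub>L P))) \<sim>\<^sub>K id_blinfun" by (intro add0 left0 GP)
    show "scalar_linear s (id_blinfun + (P o\<^sub>L ((G - id_blinfun) o\<^sub>L P)))"
      by (intro scalar_linear_add scalar_linear_compose scalar_linear_diff scalar_linear_id lin G_lin)
    show "blinfun_apply (id_blinfun + (P o\<^sub>L ((G - id_blinfun) o\<^sub>L P))) x = blinfun_apply P (blinfun_apply G x)" if "x \<in> X" for x
      using projector_apply[OF P that] by (simp add: blinfun.bilinear_simps)
    show "(id_blinfun + (P o\<^sub>L ((F - id_blinfun) o\<^sub>L P))) \<sim>\<^sub>K id_blinfun" by (intro add0 left0 FP)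
    show "scalar_linear s (id_blinfun + (P o\<^sub>L ((F - id_blinfun) o\<^sub>L P)))"
      by (intro scalar_linear_add scalar_linear_compose scalar_linear_diff scalar_linear_id lin)
    show "blinfun_apply (id_blinfun + (P o\<^sub>L ((F - id_blinfun) o\<^sub>L P))) x = blinfun_apply P (blinfun_apply F x)" if "x \<in> X" for x
      using projector_apply[OF P that] by (simp add: blinfun.bilinear_simps)
    \<comment> \<open>On Y, where Q is the identity, this is G P. Replacing Q by P and G P by P
      modulo compact operators leaves the identity.\<close>
    let ?T = "(id_blinfun - Q) + (G o\<^sub>L (P o\<^sub>L Q))"
    have GPQ: "?T \<sim>\<^sub>K id_blinfun"
    proof -
      have "?T \<sim>\<^sub>K ((id_blinfun - Q) + (G o\<^sub>L (P o\<^sub>L P)))"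
        by (intro compact_eq_add compact_eq_compose compact_eq_refl compact_eq_sym[OF PQ])
      also have "(id_blinfun - Q) + (G o\<^sub>L (P o\<^sub>L P)) = (id_blinfun + ((G - id_blinfun) o\<^sub>L P)) + (P - Q)"
        using projector_compose[OF P P] by (simp add: blinfun_compose_simps)
      also have "\<dots> \<sim>\<^sub>K (id_blinfun + (Q - Q))"
        by (intro compact_eq_add compact_eq_diff compact_eq_refl PQ add0 GP)
      finally show ?thesis by simp
    qed
    show "?T \<sim>\<^sub>K id_blinfun" by (rule GPQ)
    show "scalar_linear s ?T"
      by (intro scalar_linear_add scalar_linear_compose scalar_linear_diff scalar_linear_id lin G_lin)
    show "blinfun_apply ?T y = blinfun_apply G (blinfun_apply P y)" if "y \<in> Y" for y
      using projector_apply[OF Q that] by (simp add: blinfun.bilinear_simps)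
  qed
  finally show "relative_dim s ?UX ?VY = relative_dim s X Y"
    unfolding relative_dim_def F_def F1_def .
qed

text \<open>Linearity becomes commutation with fixed bounded operators, which survives limits and
  all constructions with fundamental solutions.\<close>

lemma scalar_linear_iff_commute: "scalar_linear s T \<longleftrightarrow> (\<forall>c. Blinfun (s c) o\<^sub>L T = T o\<^sub>L Blinfun (s c))"
proof -
  have S: "blinfun_apply (Blinfun (s c)) = s c" for c
    by (rule bounded_linear_Blinfun_apply[OF bounded])
  have "Blinfun (s c) o\<^sub>L T = T o\<^sub>L Blinfun (s c) \<longleftrightarrow>
      (\<forall>x. blinfun_apply T (s c x) = s c (blinfun_apply T x))" for c
  proof
    assume "Blinfun (s c) o\<^sub>L T = T o\<^sub>L Blinfun (s c)"
    then have "blinfun_apply (Blinfun (s c) o\<^sub>L T) x = blinfun_apply (T o\<^sub>L Blinfun (s c)) x" for x by simp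
    then show "\<forall>x. blinfun_apply T (s c x) = s c (blinfun_apply T x)" by (simp add: S)
  qed (auto intro!: blinfun_eqI simp: S)
  then show ?thesis unfolding scalar_linear_def by simp
qed

lemma scalar_linear_tendsto:
  assumes "(A \<longlongrightarrow> L) F" "F \<noteq> bot" "\<forall>\<^sub>F t in F. scalar_linear s (A t)"
  shows "scalar_linear s L"
  unfolding scalar_linear_iff_commute
proof
  fix c
  let ?S = "Blinfun (s c)"
  have 1: "((\<lambda>t. ?S o\<^sub>L A t) \<longlongrightarrow> (?S o\<^sub>L L)) F" and 2: "((\<lambda>t. A t o\<^sub>L ?S) \<longlongrightarrow> (L o\<^sub>L ?S)) F"
    by (intro bounded_bilinear.tendsto[OF bounded_bilinear_blinfun_compose] assms(1) tendsto_const)+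
  have "\<forall>\<^sub>F t in F. ?S o\<^sub>L A t = A t o\<^sub>L ?S"
    using assms(3) unfolding scalar_linear_iff_commute by (rule eventually_mono) blast
  from tendsto_cong[THEN iffD1, OF this 1] 2 show "?S o\<^sub>L L = L o\<^sub>L ?S"
    by (rule tendsto_unique[OF assms(2)])
qed

lemma stable_space_relative_dim:
  assumes A: "bounded_path A" "(A \<longlongrightarrow> A0) at_top" "\<And>t. t \<ge> 0 \<Longrightarrow> scalar_linear s (A t)"
    and B: "bounded_path B" "(B \<longlongrightarrow> B0) at_top" "\<And>t. t \<ge> 0 \<Longrightarrow> scalar_linear s (B t)"
    and P: "dichotomy A0 P" "scalar_linear s P" and Q: "dichotomy B0 Q" "scalar_linear s Q"
    and AB: "\<And>t. t \<ge> 0 \<Longrightarrow> A t \<sim>\<^sub>K B t"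
  shows "compact_perturbation s (stable_space A) (stable_space B)"
    and "relative_dim s (stable_space A) (stable_space B) =
      relative_dim s (range (blinfun_apply P)) (range (blinfun_apply Q))"
proof -
  \<comment> \<open>All conditions hold eventually, so one step \<tau>, and below one starting time
    T, serve both paths; the two isomorphisms are then built in parallel and can be
    compared.\<close>
  obtain \<tau> where \<tau>: "\<tau> > 0"
    and eA: "\<forall>\<^sub>F T in at_top. stable_iteration P (sampled A \<tau> T) (unstable_inverse A0 P \<tau>) (fundamental_solution (\<lambda>_. A0) \<tau>)"
    and eB: "\<forall>\<^sub>F T in at_top. stable_iteration Q (sampled B \<tau> T) (unstable_inverse B0 Q \<tau>) (fundamental_solution (\<lambda>_. B0) \<tau>)"
    using eventually_happens'[OF trivial_limit_at_top_linorder
        eventually_conj[OF eventually_gt_at_top[of 0]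
          eventually_conj[OF eventually_stable_iteration[OF A(1,2) P(1)] eventually_stable_iteration[OF B(1,2) Q(1)]]]]
    by blast
  obtain T where T: "T \<ge> 0"
    and iA: "stable_iteration P (sampled A \<tau> T) (unstable_inverse A0 P \<tau>) (fundamental_solution (\<lambda>_. A0) \<tau>)"
    and iB: "stable_iteration Q (sampled B \<tau> T) (unstable_inverse B0 Q \<tau>) (fundamental_solution (\<lambda>_. B0) \<tau>)"
    using eventually_happens'[OF trivial_limit_at_top_linorder
        eventually_conj[OF eventually_ge_at_top[of 0] eventually_conj[OF eA eB]]]
    by blast
  let ?U = "stable_iso A A0 P \<tau> T" and ?V = "stable_iso B B0 Q \<tau> T"
  have ev: "\<forall>\<^sub>F t in at_top. (t :: real) \<ge> 0" by (rule eventually_ge_at_top)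
  have A0: "scalar_linear s A0" and B0: "scalar_linear s B0"
    by (rule scalar_linear_tendsto[OF A(2)] scalar_linear_tendsto[OF B(2)], simp,
        rule eventually_mono[OF ev], use A(3) B(3) in blast)+
  have AB0: "A0 \<sim>\<^sub>K B0"
    by (rule compact_eq_tendsto[OF A(2) B(2)]) (use eventually_mono[OF ev] AB in auto)
  have PQ: "P \<sim>\<^sub>K Q" by (rule dichotomy_compact_eq[OF P(1) Q(1) AB0])
  have UV: "?U \<sim>\<^sub>K ?V" by (rule stable_iso_compact_eq[OF A(1) B(1) \<tau> T iA iB AB AB0 PQ])
  obtain U' where U': "?U o\<^sub>L U' = id_blinfun" "U' o\<^sub>L ?U = id_blinfun"
    using stable_iso(1)[OF A(1) \<tau> T iA] by blast
  obtain V' where V': "?V o\<^sub>L V' = id_blinfun" "V' o\<^sub>L ?V = id_blinfun"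
    using stable_iso(1)[OF B(1) \<tau> T iB] by blast
  have Ulin: "scalar_linear s ?U"
    unfolding scalar_linear_iff_commute
    by (intro allI stable_iso_commute[OF A(1) \<tau> T iA])
      (use A(3) A0 P(2) in \<open>auto simp: scalar_linear_iff_commute\<close>)
  have Vlin: "scalar_linear s ?V"
    unfolding scalar_linear_iff_commute
    by (intro allI stable_iso_commute[OF B(1) \<tau> T iB])
      (use B(3) B0 Q(2) in \<open>auto simp: scalar_linear_iff_commute\<close>)
  have "is_projector_onto s P (range (blinfun_apply P))" "is_projector_onto s Q (range (blinfun_apply Q))"
    unfolding is_projector_onto_def using P Q dichotomy_idem by auto
  from relative_dim_isomorphic_image[OF this PQ Ulin U' Vlin V' UV]
  show "compact_perturbation s (stable_space A) (stable_space B)"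
    and "relative_dim s (stable_space A) (stable_space B) =
      relative_dim s (range (blinfun_apply P)) (range (blinfun_apply Q))"
    unfolding stable_iso(2)[OF A(1) \<tau> T iA] stable_iso(2)[OF B(1) \<tau> T iB] by auto
qed

end

subsection \<open>Real and complex scalars\<close>

lemma C_h_D:
  assumes "A \<in> C_h s \<sigma>"
  shows "bounded_path A" "(A \<longlongrightarrow> limit_op A) at_top" "\<And>t. t \<ge> 0 \<Longrightarrow> scalar_linear s (A t)"
    "\<sigma> (limit_op A) \<inter> {z. Re z = 0} = {}"
proof -
  obtain L where L: "(A \<longlongrightarrow> L) at_top" "\<sigma> L \<inter> {z. Re z = 0} = {}"
    and cont: "continuous_on {0..} A" and lin: "\<forall>t\<ge>0. scalar_linear s (A t)"
    using assms unfolding C_h_def by auto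
  have "limit_op A = L" unfolding limit_op_def by (rule tendsto_Lim[OF _ L(1)]) simp
  then show "(A \<longlongrightarrow> limit_op A) at_top" "\<sigma> (limit_op A) \<inter> {z. Re z = 0} = {}" using L by auto
  show "\<And>t. t \<ge> 0 \<Longrightarrow> scalar_linear s (A t)" using lin by blast
  \<comment> \<open>Beyond \<open>t1\<close> the path stays within distance 1 of its limit; before
    that, continuity on a compact interval bounds it.\<close>
  obtain t1 where t1: "\<And>t. t \<ge> t1 \<Longrightarrow> norm (A t - L) < 1"
    using tendstoD[OF L(1), of 1] unfolding eventually_at_top_linorder dist_norm by auto
  have "continuous_on {0..t1} A" by (rule continuous_on_subset[OF cont]) auto
  then obtain b where b: "\<And>t. t \<in> {0..t1} \<Longrightarrow> norm (A t) \<le> b"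
    by (rule norm_bounded_on_compact[OF compact_Icc]) blast
  have "norm (A t) \<le> max b (norm L + 1)" if "t \<ge> 0" for t
  proof (cases "t \<le> t1")
    case False
    then show ?thesis using t1[of t] norm_triangle_sub[of "A t" L] by simp
  qed (use b[of t] that in auto)
  then show "bounded_path A" unfolding bounded_path_def using cont by blast
qed

lemma bounded_scaling_scaleR: "bounded_scaling (scaleR :: real \<Rightarrow> 'a::banach \<Rightarrow> 'a)"
  by unfold_locales (auto intro: bounded_linear_scaleR_right simp: algebra_simps)

lemma scalar_linear_scaleR: "scalar_linear scaleR T"
  unfolding scalar_linear_def by (simp add: blinfun.scaleR_right)

lemma blinfun_apply_complexify:
  "blinfun_apply (complexify T) = (\<lambda>(x, y). (blinfun_apply T x, blinfun_apply T y))"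
proof -
  have "bounded_linear (\<lambda>p. (blinfun_apply T (fst p), blinfun_apply T (snd p)))"
    by (intro bounded_linear_Pair bounded_linear_compose[OF blinfun.bounded_linear_right]
        bounded_linear_fst bounded_linear_snd)
  then have "bounded_linear (\<lambda>(x, y). (blinfun_apply T x, blinfun_apply T y))"
    by (simp add: split_beta')
  then show ?thesis unfolding complexify_def by (rule bounded_linear_Blinfun_apply)
qed

text \<open>
  The compression to the real part inherits the dichotomy, which alone forces it to be a projector.
\<close>

lemma real_dichotomy:
  fixes T :: "'a::banach \<Rightarrow>\<^sub>L 'a"
  assumes hyp: "real_spectrum T \<inter> {z. Re z = 0} = {}"
  shows "\<exists>P. dichotomy T P \<and> real_neg_space T = range (blinfun_apply P)"
proof -
  let ?s = "complexification_scaling :: complex \<Rightarrow> 'a \<times> 'a \<Rightarrow> 'a \<times> 'a"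
  let ?T = "complexify T"
  define J :: "('a \<times> 'a) \<Rightarrow>\<^sub>L ('a \<times> 'a)" where "J = Blinfun (\<lambda>p. (- snd p, fst p))"
  have J: "blinfun_apply J = (\<lambda>p. (- snd p, fst p))"
    unfolding J_def
    by (rule bounded_linear_Blinfun_apply)
      (intro bounded_linear_Pair bounded_linear_minus bounded_linear_fst bounded_linear_snd)
  interpret hyperbolic_operator J ?s ?T
  proof
    show "J o\<^sub>L J = - id_blinfun"
      by (rule blinfun_eqI) (simp add: J blinfun.bilinear_simps prod_eq_iff)
    show "?s z x = Re z *\<^sub>R x + Im z *\<^sub>R blinfun_apply J x" for z x
      by (simp add: J complexification_scaling_def split_beta prod_eq_iff)
    show "?T o\<^sub>L J = J o\<^sub>L ?T"
      by (rule blinfun_eqI) (simp add: J blinfun_apply_complexify split_beta blinfun.bilinear_simps)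
    show "spectrum ?s ?T \<inter> {z. Re z = 0} = {}" using hyp unfolding real_spectrum_def .
  qed
  let ?P = "neg_projector ?s ?T"
  define \<iota> :: "'a \<Rightarrow>\<^sub>L ('a \<times> 'a)" where "\<iota> = Blinfun (\<lambda>x. (x, 0))"
  have \<iota>: "blinfun_apply \<iota> = (\<lambda>x. (x, 0))"
    unfolding \<iota>_def
    by (rule bounded_linear_Blinfun_apply) (intro bounded_linear_Pair bounded_linear_ident bounded_linear_zero)
  let ?\<pi> = "fst_blinfun :: ('a \<times> 'a) \<Rightarrow>\<^sub>L 'a"
  define P where "P = ?\<pi> o\<^sub>L (?P o\<^sub>L \<iota>)"
  have \<pi>T: "?\<pi> o\<^sub>L ?T = T o\<^sub>L ?\<pi>" and T\<iota>: "?T o\<^sub>L \<iota> = \<iota> o\<^sub>L T" and \<pi>\<iota>: "?\<pi> o\<^sub>L \<iota> = id_blinfun"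
    by (auto intro!: blinfun_eqI simp: \<iota> blinfun_apply_complexify split_beta)
  have d: "?P o\<^sub>L ?T = ?T o\<^sub>L ?P"
    "((\<lambda>t. fundamental_solution (\<lambda>_. ?T) t o\<^sub>L ?P) \<longlongrightarrow> 0) at_top"
    "((\<lambda>t. fundamental_solution (\<lambda>_. - ?T) t o\<^sub>L (id_blinfun - ?P)) \<longlongrightarrow> 0) at_top"
    using dichotomy_neg_projector unfolding dichotomy_def by auto
  have P_T: "P o\<^sub>L T = T o\<^sub>L P"
  proof -
    have "P o\<^sub>L T = ?\<pi> o\<^sub>L (?P o\<^sub>L (\<iota> o\<^sub>L T))" by (simp only: P_def blinfun_compose_assoc)
    also have "\<dots> = ?\<pi> o\<^sub>L ((?P o\<^sub>L ?T) o\<^sub>L \<iota>)" by (simp only: T\<iota>[symmetric] blinfun_compose_assoc)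
    also have "\<dots> = (?\<pi> o\<^sub>L ?T) o\<^sub>L (?P o\<^sub>L \<iota>)" by (simp only: d(1) blinfun_compose_assoc)
    also have "\<dots> = T o\<^sub>L P" by (simp only: \<pi>T P_def blinfun_compose_assoc)
    finally show ?thesis .
  qed
  \<comment> \<open>The projection to the real part intertwines the complexified flow with the real
    one, so decay passes to the compression.\<close>
  have lim: "((\<lambda>t. fundamental_solution (\<lambda>_. S) t o\<^sub>L (?\<pi> o\<^sub>L (C o\<^sub>L \<iota>))) \<longlongrightarrow> 0) at_top"
    if S: "?\<pi> o\<^sub>L S' = S o\<^sub>L ?\<pi>" and C: "((\<lambda>t. fundamental_solution (\<lambda>_. S') t o\<^sub>L C) \<longlongrightarrow> 0) at_top"
    for S S' C
  proof -
    have 1: "((\<lambda>t. ?\<pi> o\<^sub>L ((fundamental_solution (\<lambda>_. S') t o\<^sub>L C) o\<^sub>L \<iota>)) \<longlongrightarrow> (?\<pi> o\<^sub>L (0 o\<^sub>L \<iota>))) at_top"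
      by (intro bounded_bilinear.tendsto[OF bounded_bilinear_blinfun_compose] tendsto_const C)
    have "?\<pi> o\<^sub>L ((fundamental_solution (\<lambda>_. S') t o\<^sub>L C) o\<^sub>L \<iota>) =
        fundamental_solution (\<lambda>_. S) t o\<^sub>L (?\<pi> o\<^sub>L (C o\<^sub>L \<iota>))" if "t \<ge> 0" for t
      using fundamental_solution_intertwine[OF bounded_path_const bounded_path_const S that]
      by (simp flip: blinfun_compose_assoc)
    then have "\<forall>\<^sub>F t in at_top. ?\<pi> o\<^sub>L ((fundamental_solution (\<lambda>_. S') t o\<^sub>L C) o\<^sub>L \<iota>) =
        fundamental_solution (\<lambda>_. S) t o\<^sub>L (?\<pi> o\<^sub>L (C o\<^sub>L \<iota>))"
      using eventually_ge_at_top[of 0] by (rule eventually_mono[rotated])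
    from tendsto_cong[THEN iffD1, OF this 1] show ?thesis by simp
  qed
  \<comment> \<open>As the projection undoes the inclusion, id - P is the compression of the
    complementary projector, and the same limit argument covers it.\<close>
  have "id_blinfun - P = ?\<pi> o\<^sub>L ((id_blinfun - ?P) o\<^sub>L \<iota>)"
    by (simp add: P_def blinfun_compose_simps \<pi>\<iota>)
  moreover have "?\<pi> o\<^sub>L (- ?T) = (- T) o\<^sub>L ?\<pi>" by (simp add: blinfun_compose_simps \<pi>T)
  ultimately have "dichotomy T P"
    unfolding dichotomy_def using P_T lim[OF \<pi>T d(2)] lim[OF _ d(3), of "- T"] by (simp add: P_def)
  moreover have "real_neg_space T = range (blinfun_apply P)"
    unfolding real_neg_space_def by (simp add: P_def \<iota>)
  ultimately show ?thesis by blast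
qed

lemma bounded_scaling_complex:
  fixes s :: "complex \<Rightarrow> 'a::banach \<Rightarrow> 'a"
  assumes "complex_banach_scaling s"
  shows "bounded_scaling s"
proof -
  have s: "vector_space s" "\<And>r x. s (of_real r) x = r *\<^sub>R x" "\<And>z x. norm (s z x) = norm z * norm x"
    using assms unfolding complex_banach_scaling_def by auto
  interpret vector_space s by (rule s(1))
  show ?thesis
  proof (intro bounded_scaling.intro scaling.intro bounded_scaling_axioms.intro)
    show "vector_space s" by (rule s(1))
    show "\<exists>c. \<forall>x. s c x = r *\<^sub>R x" for r using s(2) by blast
    fix c
    show "bounded_linear (s c)"
    proof (rule bounded_linear_intro)
      show "s c (r *\<^sub>R x) = r *\<^sub>R s c x" for r x
        unfolding s(2)[symmetric] by (simp add: mult.commute)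
      show "norm (s c x) \<le> norm x * norm c" for x by (simp add: s(3) mult.commute)
    qed (rule scale_right_distrib)
  qed
qed

lemma complex_dichotomy:
  fixes s :: "complex \<Rightarrow> 'a::banach \<Rightarrow> 'a"
  assumes s: "complex_banach_scaling s" and T: "scalar_linear s T" and hyp: "spectrum s T \<inter> {z. Re z = 0} = {}"
  shows "dichotomy T (neg_projector s T)" "scalar_linear s (neg_projector s T)"
proof -
  interpret bounded_scaling s by (rule bounded_scaling_complex[OF s])
  have s_real: "s (of_real r) x = r *\<^sub>R x" for r x
    using s unfolding complex_banach_scaling_def by auto
  define J where "J = Blinfun (s \<i>)"
  have J: "blinfun_apply J = s \<i>" unfolding J_def by (rule bounded_linear_Blinfun_apply[OF bounded])
  interpret hyperbolic_operator J s T
  proof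
    show "J o\<^sub>L J = - id_blinfun"
    proof (rule blinfun_eqI)
      fix x
      have "s \<i> (s \<i> x) = s (of_real (- 1)) x" by simp
      then show "blinfun_apply (J o\<^sub>L J) x = blinfun_apply (- id_blinfun) x"
        unfolding s_real by (simp add: J blinfun.bilinear_simps)
    qed
    show "s z x = Re z *\<^sub>R x + Im z *\<^sub>R blinfun_apply J x" for z x
    proof -
      have "s z x = s (of_real (Re z) + of_real (Im z) * \<i>) x"
        by (metis complex_eq mult.commute)
      then show ?thesis
        unfolding scale_left_distrib scale_scale[symmetric] s_real J .
    qed
    show "T o\<^sub>L J = J o\<^sub>L T"
      by (rule blinfun_eqI) (use T in \<open>simp add: J scalar_linear_def\<close>)
  qed (rule hyp)
  show "dichotomy T (neg_projector s T)" by (rule dichotomy_neg_projector)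
  \<comment> \<open>Every scalar acts as a real combination of the identity and \<open>J\<close>, so
    commuting with \<open>J\<close> amounts to complex linearity.\<close>
  have "J o\<^sub>L neg_projector s T = neg_projector s T o\<^sub>L J"
    by (rule neg_projector_commute) (simp_all add: T_J)
  then have "blinfun_apply (neg_projector s T) (blinfun_apply J x) = blinfun_apply J (blinfun_apply (neg_projector s T) x)" for x
    by (metis blinfun_apply_blinfun_compose)
  then show "scalar_linear s (neg_projector s T)"
    unfolding scalar_linear_def s_eq by (simp add: blinfun.bilinear_simps)
qed

theorem theorem5p4:
  shows "(\<forall>A B :: real \<Rightarrow> ('a::banach \<Rightarrow>\<^sub>L 'a).
            A \<in> C_h scaleR real_spectrum \<and> B \<in> C_h scaleR real_spectrum \<and>
            (\<forall>t\<ge>0. compact_operator (B t - A t)) \<longrightarrow>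
            compact_perturbation scaleR (stable_space A) (stable_space B) \<and>
            relative_dim scaleR (stable_space A) (stable_space B) =
              relative_dim scaleR (real_neg_space (limit_op A)) (real_neg_space (limit_op B)))
       \<and> (\<forall>(s :: complex \<Rightarrow> 'a \<Rightarrow> 'a) (A :: real \<Rightarrow> ('a \<Rightarrow>\<^sub>L 'a)) B.
            complex_banach_scaling s \<and>
            A \<in> C_h s (spectrum s) \<and> B \<in> C_h s (spectrum s) \<and>
            (\<forall>t\<ge>0. compact_operator (B t - A t)) \<longrightarrow>
            compact_perturbation s (stable_space A) (stable_space B) \<and>
            relative_dim s (stable_space A) (stable_space B) =
              relative_dim s (neg_space s (limit_op A)) (neg_space s (limit_op B)))"
proof (intro conjI allI impI; elim conjE)
  fix A B :: "real \<Rightarrow> ('a::banach \<Rightarrow>\<^sub>L 'a)"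
  assume "A \<in> C_h scaleR real_spectrum" "B \<in> C_h scaleR real_spectrum"
    and AB: "\<forall>t\<ge>0. compact_operator (B t - A t)"
  note A = C_h_D[OF this(1)] and B = C_h_D[OF this(2)]
  interpret bounded_scaling "scaleR :: real \<Rightarrow> 'a \<Rightarrow> 'a" by (rule bounded_scaling_scaleR)
  obtain P where P: "dichotomy (limit_op A) P" "real_neg_space (limit_op A) = range (blinfun_apply P)"
    using real_dichotomy[OF A(4)] by blast
  obtain Q where Q: "dichotomy (limit_op B) Q" "real_neg_space (limit_op B) = range (blinfun_apply Q)"
    using real_dichotomy[OF B(4)] by blast
  have "A t \<sim>\<^sub>K B t" if "t \<ge> 0" for t
    using AB that compact_eq_sym unfolding compact_eq_def by blast
  from stable_space_relative_dim[OF A(1-3) B(1-3) P(1) scalar_linear_scaleR Q(1) scalar_linear_scaleR this]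
  show "compact_perturbation scaleR (stable_space A) (stable_space B)"
    and "relative_dim scaleR (stable_space A) (stable_space B) =
      relative_dim scaleR (real_neg_space (limit_op A)) (real_neg_space (limit_op B))"
    unfolding P(2) Q(2) by auto
next
  fix s :: "complex \<Rightarrow> 'a \<Rightarrow> 'a" and A B :: "real \<Rightarrow> ('a \<Rightarrow>\<^sub>L 'a)"
  assume s: "complex_banach_scaling s" and "A \<in> C_h s (spectrum s)" "B \<in> C_h s (spectrum s)"
    and AB: "\<forall>t\<ge>0. compact_operator (B t - A t)"
  note A = C_h_D[OF this(2)] and B = C_h_D[OF this(3)]
  interpret bounded_scaling s by (rule bounded_scaling_complex[OF s])
  have ev: "\<forall>\<^sub>F t in at_top. (t :: real) \<ge> 0" by (rule eventually_ge_at_top)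
  have "scalar_linear s (limit_op A)" "scalar_linear s (limit_op B)"
    using scalar_linear_tendsto[OF A(2) _ eventually_mono[OF ev A(3)]]
      scalar_linear_tendsto[OF B(2) _ eventually_mono[OF ev B(3)]] by simp_all
  note P = complex_dichotomy[OF s this(1) A(4)] and Q = complex_dichotomy[OF s this(2) B(4)]
  have "A t \<sim>\<^sub>K B t" if "t \<ge> 0" for t
    using AB that compact_eq_sym unfolding compact_eq_def by blast
  from stable_space_relative_dim[OF A(1-3) B(1-3) P Q this]
  show "compact_perturbation s (stable_space A) (stable_space B)"
    and "relative_dim s (stable_space A) (stable_space B) =
      relative_dim s (neg_space s (limit_op A)) (neg_space s (limit_op B))"
    unfolding neg_space_def by auto
qed

end
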